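(* Suppose $\tau$ is in the limit-circle case at both endpoints $a$ and $b$. (1) An operator $S$ is a self-adjoint restriction of $T_{\max}$ with separated boundary conditions if and only if there are $\varphi_a,\varphi_b\in[0,\pi)$ such that $Sf=\tau f$ for $f\in\operatorname{dom}(S)$, where $$\operatorname{dom}(S)=\Big\{g\in\operatorname{dom}(T_{\max})\,\Big|\, BC_a^1(g)\cos\varphi_a-BC_a^2(g)\sin\varphi_a=0,\ BC_b^1(g)\cos\varphi_b-BC_b^2(g)\sin\varphi_b=0\Big\}.$$ (2) An operator $S$ is a self-adjoint restriction of $T_{\max}$ with coupled boundary conditions if and only if there are $\phi\in[0,\pi)$ and $R\in\mathbb R^{2\times2}$ with $\det(R)=1$ such that $Sf=\tau f$ for $f\in\operatorname{dom}(S)$, where $$\operatorname{dom}(S)=\left\{g\in\operatorname{dom}(T_{\max})\,\middle|\,\begin{pmatrix} BC_b^1(g) \\ BC_b^2(g) \end{pmatrix}=e^{i\phi}R\begin{pmatrix} BC_a^1(g) \\ BC_a^2(g) \end{pmatrix}\right\}.$$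
   Context: Setting. $(a,b)\subseteq\mathbb R$ is an open interval (possibly unbounded); $p,q,r,s$ are Lebesgue measurable and real-valued a.e. on $(a,b)$, with $p^{-1},q,r,s\in L^1_{\mathrm{loc}}((a,b);dx)$, $r>0$ and $p\neq0$ a.e. For $f\in AC_{\mathrm{loc}}((a,b))$ put $f^{[1]}=p(f'+sf)$ (first quasi-derivative), $\mathfrak D_\tau=\{f\in AC_{\mathrm{loc}}((a,b)) : f^{[1]}\in AC_{\mathrm{loc}}((a,b))\}$, and $\tau f=\frac1r\big(-(f^{[1]})'+sf^{[1]}+qf\big)$ for $f\in\mathfrak D_\tau$. The Wronskian is $W(f,g)=fg^{[1]}-f^{[1]}g$. In $L^2((a,b);r(x)dx)$ the maximal operator is $T_{\max}f=\tau f$, $\operatorname{dom}(T_{\max})=\{g\in L^2((a,b);r\,dx): g\in\mathfrak D_\tau,\ \tau g\in L^2((a,b);r\,dx)\}$. For $f,g\in\operatorname{dom}(T_{\max})$ the limits $W(f,g)(a)=\lim_{x\downarrow a}W(f,g)(x)$ and $W(f,g)(b)=\lim_{x\uparrow b}W(f,g)(x)$ exist. $\tau$ is in the limit-circle case at $a$ if for each $z\in\mathbb C$ all solutions of $(\tau-z)u=0$ lie in $L^2((a,c);r\,dx)$ for every $c\in(a,b)$; similarly at $b$. Boundary functionals. Fix $w_1,w_2\in\operatorname{dom}(T_{\max})$ with $W(w_1,\overline{w_2})(a)=1=W(w_1,\overline{w_2})(b)$ and $W(w_j,\overline{w_j})(a)=W(w_j,\overline{w_j})(b)=0$, $j=1,2$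 (such functions exist). For $c\in\{a,b\}$ and $f\in\operatorname{dom}(T_{\max})$ set $BC_c^1(f)=W(f,\overline{w_2})(c)$ and $BC_c^2(f)=W(\overline{w_1},f)(c)$. Separated/coupled. A self-adjoint restriction $S$ of $T_{\max}$ has separated boundary conditions if $\operatorname{dom}(S)=\{g\in\operatorname{dom}(T_{\max}): W(g,\overline v)(a)=W(g,\overline w)(b)=0\}$ for some $v,w\in\operatorname{dom}(T_{\max})$ with $W(v,\overline v)(a)=W(w,\overline w)(b)=0$ and $W(h,\overline v)(a)\neq0\neq W(h,\overline w)(b)$ for some $h\in\operatorname{dom}(T_{\max})$. All remaining self-adjoint restrictions of $T_{\max}$ are said to have coupled boundary conditions. *)

theory Defs
  imports "HOL-Analysis.Analysis"
begin

section \<open>Local integrability and local absolute continuity\<close>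

definition locally_integrable_on_ivl :: "ereal \<Rightarrow> ereal \<Rightarrow> (real \<Rightarrow> real) \<Rightarrow> bool" where
  "locally_integrable_on_ivl a b f \<longleftrightarrow>
     (\<forall>c d. {c..d} \<subseteq> einterval a b \<longrightarrow> f absolutely_integrable_on {c..d})"

text \<open>The usual \<open>\<epsilon>\<close>-\<open>\<delta>\<close> condition; a finite family of non-overlapping compact intervals is
  a division of its own union.\<close>

definition abs_continuous_on_ivl :: "real \<Rightarrow> real \<Rightarrow> (real \<Rightarrow> complex) \<Rightarrow> bool" where
  "abs_continuous_on_ivl c d f \<longleftrightarrow>
     (\<forall>\<epsilon>>0. \<exists>\<delta>>0. \<forall>D. D division_of \<Union>D \<and> \<Union>D \<subseteq> {c..d} \<and> (\<Sum>K\<in>D. measure lborel K) < \<delta> \<longrightarrow>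
        (\<Sum>K\<in>D. norm (f (Sup K) - f (Inf K))) < \<epsilon>)"

definition AC_loc :: "ereal \<Rightarrow> ereal \<Rightarrow> (real \<Rightarrow> complex) set" where
  "AC_loc a b = {f. \<forall>c d. {c..d} \<subseteq> einterval a b \<longrightarrow> abs_continuous_on_ivl c d f}"


section \<open>The Hilbert space \<open>L\<^sup>2\<close> and its unbounded operators\<close>

definition sq_integrable :: "'a measure \<Rightarrow> ('a \<Rightarrow> complex) set" where
  "sq_integrable M = {f \<in> borel_measurable M. integrable M (\<lambda>x. (norm (f x))\<^sup>2)}"

definition L2_class :: "'a measure \<Rightarrow> ('a \<Rightarrow> complex) \<Rightarrow> ('a \<Rightarrow> complex) set" where
  "L2_class M f = {g \<in> borel_measurable M. AE x in M. g x = f x}"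

definition L2_space :: "'a measure \<Rightarrow> ('a \<Rightarrow> complex) set set" where
  "L2_space M = L2_class M ` sq_integrable M"

definition L2_rep :: "('a \<Rightarrow> complex) set \<Rightarrow> 'a \<Rightarrow> complex" where
  "L2_rep u = (SOME f. f \<in> u)"

definition L2_inner :: "'a measure \<Rightarrow> ('a \<Rightarrow> complex) set \<Rightarrow> ('a \<Rightarrow> complex) set \<Rightarrow> complex" where
  "L2_inner M u v = (LINT x|M. cnj (L2_rep u x) * L2_rep v x)"

definition L2_dist :: "'a measure \<Rightarrow> ('a \<Rightarrow> complex) set \<Rightarrow> ('a \<Rightarrow> complex) set \<Rightarrow> real" where
  "L2_dist M u v = sqrt (LINT x|M. (norm (L2_rep u x - L2_rep v x))\<^sup>2)"

text \<open>An unbounded operator is identified with its graph, so \<open>Domain S\<close> is its domain and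
  inclusion of graphs means being a restriction.\<close>

type_synonym 'a L2_operator = "(('a \<Rightarrow> complex) set \<times> ('a \<Rightarrow> complex) set) set"

definition linear_operator :: "'a measure \<Rightarrow> 'a L2_operator \<Rightarrow> bool" where
  "linear_operator M S \<longleftrightarrow>
     S \<subseteq> L2_space M \<times> L2_space M \<and> single_valued S \<and>
     (L2_class M (\<lambda>_. 0), L2_class M (\<lambda>_. 0)) \<in> S \<and>
     (\<forall>f\<in>sq_integrable M. \<forall>g\<in>sq_integrable M. \<forall>h\<in>sq_integrable M. \<forall>k\<in>sq_integrable M. \<forall>\<alpha> \<beta>.
        (L2_class M f, L2_class M g) \<in> S \<longrightarrow> (L2_class M h, L2_class M k) \<in> S \<longrightarrow>
        (L2_class M (\<lambda>x. \<alpha> * f x + \<beta> * h x), L2_class M (\<lambda>x. \<alpha> * g x + \<beta> * k x)) \<in> S)"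

definition densely_defined :: "'a measure \<Rightarrow> 'a L2_operator \<Rightarrow> bool" where
  "densely_defined M S \<longleftrightarrow> (\<forall>u\<in>L2_space M. \<forall>\<epsilon>>0. \<exists>v\<in>Domain S. L2_dist M u v < \<epsilon>)"

definition adjoint_operator :: "'a measure \<Rightarrow> 'a L2_operator \<Rightarrow> 'a L2_operator" where
  "adjoint_operator M S =
     {(u, v) \<in> L2_space M \<times> L2_space M. \<forall>(f, g)\<in>S. L2_inner M u g = L2_inner M v f}"

definition self_adjoint_operator :: "'a measure \<Rightarrow> 'a L2_operator \<Rightarrow> bool" where
  "self_adjoint_operator M S \<longleftrightarrow>
     linear_operator M S \<and> densely_defined M S \<and> adjoint_operator M S = S"


section \<open>The differential expression\<close>

text \<open>The function \<open>p (f' + s f)\<close> is only determined almost everywhere. The first quasi-derivative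
  is its locally absolutely continuous version, which is unique on the interval and exists exactly
  for the functions in \<open>D_tau\<close>.\<close>

definition is_quasi_deriv :: "ereal \<Rightarrow> ereal \<Rightarrow> (real \<Rightarrow> real) \<Rightarrow> (real \<Rightarrow> real) \<Rightarrow>
    (real \<Rightarrow> complex) \<Rightarrow> (real \<Rightarrow> complex) \<Rightarrow> bool" where
  "is_quasi_deriv a b p s f h \<longleftrightarrow> h \<in> AC_loc a b \<and>
     (AE x in lebesgue_on (einterval a b).
        h x = of_real (p x) * (vector_derivative f (at x) + of_real (s x) * f x))"

definition quasi_deriv :: "ereal \<Rightarrow> ereal \<Rightarrow> (real \<Rightarrow> real) \<Rightarrow> (real \<Rightarrow> real) \<Rightarrow>
    (real \<Rightarrow> complex) \<Rightarrow> real \<Rightarrow> complex" where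
  "quasi_deriv a b p s f = (SOME h. is_quasi_deriv a b p s f h)"

definition D_tau :: "ereal \<Rightarrow> ereal \<Rightarrow> (real \<Rightarrow> real) \<Rightarrow> (real \<Rightarrow> real) \<Rightarrow> (real \<Rightarrow> complex) set" where
  "D_tau a b p s = {f \<in> AC_loc a b. \<exists>h. is_quasi_deriv a b p s f h}"

definition tau :: "ereal \<Rightarrow> ereal \<Rightarrow> (real \<Rightarrow> real) \<Rightarrow> (real \<Rightarrow> real) \<Rightarrow> (real \<Rightarrow> real) \<Rightarrow> (real \<Rightarrow> real) \<Rightarrow>
    (real \<Rightarrow> complex) \<Rightarrow> real \<Rightarrow> complex" where
  "tau a b p q r s f x = 1 / of_real (r x) *
     (- vector_derivative (quasi_deriv a b p s f) (at x)
      + of_real (s x) * quasi_deriv a b p s f x + of_real (q x) * f x)"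

definition wronskian :: "ereal \<Rightarrow> ereal \<Rightarrow> (real \<Rightarrow> real) \<Rightarrow> (real \<Rightarrow> real) \<Rightarrow>
    (real \<Rightarrow> complex) \<Rightarrow> (real \<Rightarrow> complex) \<Rightarrow> real \<Rightarrow> complex" where
  "wronskian a b p s f g x = f x * quasi_deriv a b p s g x - quasi_deriv a b p s f x * g x"

text \<open>The one-sided limit of the Wronskian at an endpoint \<open>c\<close>, where \<open>c = a\<close> or \<open>c = b\<close>.\<close>

definition wronskian_end :: "ereal \<Rightarrow> ereal \<Rightarrow> (real \<Rightarrow> real) \<Rightarrow> (real \<Rightarrow> real) \<Rightarrow> ereal \<Rightarrow>
    (real \<Rightarrow> complex) \<Rightarrow> (real \<Rightarrow> complex) \<Rightarrow> complex" where
  "wronskian_end a b p s c f g =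
     Lim (at c within {a<..<b}) (\<lambda>x. wronskian a b p s f g (real_of_ereal x))"

definition weighted_measure :: "ereal \<Rightarrow> ereal \<Rightarrow> (real \<Rightarrow> real) \<Rightarrow> real measure" where
  "weighted_measure a b r = density (lebesgue_on (einterval a b)) (\<lambda>x. ennreal (r x))"

definition solution :: "ereal \<Rightarrow> ereal \<Rightarrow> (real \<Rightarrow> real) \<Rightarrow> (real \<Rightarrow> real) \<Rightarrow> (real \<Rightarrow> real) \<Rightarrow> (real \<Rightarrow> real) \<Rightarrow>
    complex \<Rightarrow> (real \<Rightarrow> complex) \<Rightarrow> bool" where
  "solution a b p q r s z u \<longleftrightarrow> u \<in> D_tau a b p s \<and>
     (AE x in lebesgue_on (einterval a b). tau a b p q r s u x - z * u x = 0)"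

definition limit_circle_left :: "ereal \<Rightarrow> ereal \<Rightarrow> (real \<Rightarrow> real) \<Rightarrow> (real \<Rightarrow> real) \<Rightarrow> (real \<Rightarrow> real) \<Rightarrow>
    (real \<Rightarrow> real) \<Rightarrow> bool" where
  "limit_circle_left a b p q r s \<longleftrightarrow>
     (\<forall>z u. solution a b p q r s z u \<longrightarrow>
        (\<forall>c\<in>einterval a b. u \<in> sq_integrable (weighted_measure a (ereal c) r)))"

definition limit_circle_right :: "ereal \<Rightarrow> ereal \<Rightarrow> (real \<Rightarrow> real) \<Rightarrow> (real \<Rightarrow> real) \<Rightarrow> (real \<Rightarrow> real) \<Rightarrow>
    (real \<Rightarrow> real) \<Rightarrow> bool" where
  "limit_circle_right a b p q r s \<longleftrightarrow>
     (\<forall>z u. solution a b p q r s z u \<longrightarrow>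
        (\<forall>c\<in>einterval a b. u \<in> sq_integrable (weighted_measure (ereal c) b r)))"


section \<open>Realizations of the differential expression and boundary conditions\<close>

text \<open>Domains are given as sets of functions. As \<open>r > 0\<close> almost everywhere, an \<open>L\<^sup>2\<close>-class has at
  most one continuous representative on the interval.\<close>

definition dom_Tmax :: "ereal \<Rightarrow> ereal \<Rightarrow> (real \<Rightarrow> real) \<Rightarrow> (real \<Rightarrow> real) \<Rightarrow> (real \<Rightarrow> real) \<Rightarrow>
    (real \<Rightarrow> real) \<Rightarrow> (real \<Rightarrow> complex) set" where
  "dom_Tmax a b p q r s =
     {g \<in> sq_integrable (weighted_measure a b r).
        g \<in> D_tau a b p s \<and> tau a b p q r s g \<in> sq_integrable (weighted_measure a b r)}"

text \<open>The operator \<open>g \<mapsto> \<tau> g\<close> with domain (the classes of the functions in) \<open>D\<close>.\<close>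

definition tau_operator :: "ereal \<Rightarrow> ereal \<Rightarrow> (real \<Rightarrow> real) \<Rightarrow> (real \<Rightarrow> real) \<Rightarrow> (real \<Rightarrow> real) \<Rightarrow>
    (real \<Rightarrow> real) \<Rightarrow> (real \<Rightarrow> complex) set \<Rightarrow> real L2_operator" where
  "tau_operator a b p q r s D =
     (\<lambda>g. (L2_class (weighted_measure a b r) g,
           L2_class (weighted_measure a b r) (tau a b p q r s g))) ` D"

definition Tmax :: "ereal \<Rightarrow> ereal \<Rightarrow> (real \<Rightarrow> real) \<Rightarrow> (real \<Rightarrow> real) \<Rightarrow> (real \<Rightarrow> real) \<Rightarrow>
    (real \<Rightarrow> real) \<Rightarrow> real L2_operator" where
  "Tmax a b p q r s = tau_operator a b p q r s (dom_Tmax a b p q r s)"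

definition self_adjoint_restriction :: "ereal \<Rightarrow> ereal \<Rightarrow> (real \<Rightarrow> real) \<Rightarrow> (real \<Rightarrow> real) \<Rightarrow>
    (real \<Rightarrow> real) \<Rightarrow> (real \<Rightarrow> real) \<Rightarrow> real L2_operator \<Rightarrow> bool" where
  "self_adjoint_restriction a b p q r s S \<longleftrightarrow>
     self_adjoint_operator (weighted_measure a b r) S \<and> S \<subseteq> Tmax a b p q r s"

definition separated_bc :: "ereal \<Rightarrow> ereal \<Rightarrow> (real \<Rightarrow> real) \<Rightarrow> (real \<Rightarrow> real) \<Rightarrow> (real \<Rightarrow> real) \<Rightarrow>
    (real \<Rightarrow> real) \<Rightarrow> real L2_operator \<Rightarrow> bool" where
  "separated_bc a b p q r s S \<longleftrightarrow>
     (\<exists>v\<in>dom_Tmax a b p q r s. \<exists>w\<in>dom_Tmax a b p q r s.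
        wronskian_end a b p s a v (cnj \<circ> v) = 0 \<and> wronskian_end a b p s b w (cnj \<circ> w) = 0 \<and>
        (\<exists>h\<in>dom_Tmax a b p q r s.
           wronskian_end a b p s a h (cnj \<circ> v) \<noteq> 0 \<and> wronskian_end a b p s b h (cnj \<circ> w) \<noteq> 0) \<and>
        Domain S = L2_class (weighted_measure a b r) `
          {g \<in> dom_Tmax a b p q r s.
             wronskian_end a b p s a g (cnj \<circ> v) = 0 \<and> wronskian_end a b p s b g (cnj \<circ> w) = 0})"

definition sa_separated :: "ereal \<Rightarrow> ereal \<Rightarrow> (real \<Rightarrow> real) \<Rightarrow> (real \<Rightarrow> real) \<Rightarrow> (real \<Rightarrow> real) \<Rightarrow>
    (real \<Rightarrow> real) \<Rightarrow> real L2_operator \<Rightarrow> bool" where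
  "sa_separated a b p q r s S \<longleftrightarrow>
     self_adjoint_restriction a b p q r s S \<and> separated_bc a b p q r s S"

definition sa_coupled :: "ereal \<Rightarrow> ereal \<Rightarrow> (real \<Rightarrow> real) \<Rightarrow> (real \<Rightarrow> real) \<Rightarrow> (real \<Rightarrow> real) \<Rightarrow>
    (real \<Rightarrow> real) \<Rightarrow> real L2_operator \<Rightarrow> bool" where
  "sa_coupled a b p q r s S \<longleftrightarrow>
     self_adjoint_restriction a b p q r s S \<and> \<not> separated_bc a b p q r s S"

definition BC1 :: "ereal \<Rightarrow> ereal \<Rightarrow> (real \<Rightarrow> real) \<Rightarrow> (real \<Rightarrow> real) \<Rightarrow> (real \<Rightarrow> complex) \<Rightarrow> ereal \<Rightarrow>
    (real \<Rightarrow> complex) \<Rightarrow> complex" where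
  "BC1 a b p s w2 c f = wronskian_end a b p s c f (cnj \<circ> w2)"

definition BC2 :: "ereal \<Rightarrow> ereal \<Rightarrow> (real \<Rightarrow> real) \<Rightarrow> (real \<Rightarrow> real) \<Rightarrow> (real \<Rightarrow> complex) \<Rightarrow> ereal \<Rightarrow>
    (real \<Rightarrow> complex) \<Rightarrow> complex" where
  "BC2 a b p s w1 c f = wronskian_end a b p s c (cnj \<circ> w1) f"

end

theory Submission
  imports Defs
begin

text \<open>The definitions pick quasi-derivatives by \<open>SOME\<close>, turn limits into values
  by \<open>Lim\<close> and let operators act on classes. The proof carries explicit data instead: a
  function, a continuous quasi-derivative and a representative of \<tau> f
  (\<open>max_triple\<close>), and limits as relations (\<open>end_limit\<close>). The choices are
  harmless because continuous functions that agree almost everywhere agree on the interval.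

  Apart from linearity, the operator theory uses three facts about the boundary map
  \<open>BB\<close> into the four-dimensional space of boundary values: it is onto, it vanishes on
  compactly supported functions, and Green's formula holds. Self-adjointness then becomes
  \<open>bform_perp L = L\<close>, an equation that by itself forces \<open>L\<close> to be a
  subspace.

  All angles lie in [0, pi) for one reason: an isotropic vector is a complex multiple of a real one,
  and both the real vector and the phase are determined only up to a real factor, whose sign reduces
  the angle to half a turn. In the coupled case the phases of the two columns may differ by a sign;
  it is moved into \<open>R\<close>, where it enters the determinant squared.\<close>

text \<open>
By Lagrange's identity the boundary form of the maximal operator is the difference of the Wronskians
\<open>W(f, cnj g)\<close> at \<open>b\<close> and at \<open>a\<close>. Pluecker's identity for Wronskians turns \<open>W(f, cnj g)(c)\<close> into
\<open>BC1 f * cnj (BC2 g) - BC2 f * cnj (BC1 g)\<close>, and patching solutions together shows that the boundary values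
at the two endpoints can be prescribed independently. Hence the self-adjoint restrictions of the maximal operator
correspond to the subspaces \<open>L\<close> of \<open>\<complex>\<^sup>2 \<times> \<complex>\<^sup>2\<close> that equal their own orthogonal complement for
the boundary form. Such an \<open>L\<close> either meets one of the two factors, and then it is the product of two isotropic
lines, which are spanned by real vectors \<open>(sin \<phi>, cos \<phi>)\<close>; or it is the graph of an isometry of the form
\<open>x\<^sub>1 * cnj y\<^sub>2 - x\<^sub>2 * cnj y\<^sub>1\<close>, and these are the matrices \<open>exp(\<i> \<phi>) R\<close> with \<open>R\<close> real and
\<open>det R = 1\<close>.

The analytic input is that a pair \<open>(u, v)\<close> with \<open>\<langle>u, \<tau> g\<rangle> = \<langle>v, g\<rangle>\<close> for all compactly supported \<open>g\<close> satisfies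
\<open>\<tau> u = v\<close>: if \<open>f\<close> solves \<open>\<tau> f = v\<close>, then on every compact interval \<open>u - f\<close> is orthogonal to all functions
orthogonal to the solutions of \<open>\<tau> y = 0\<close>. The equation itself is read as a system of integral equations, which is
possible because locally absolutely continuous functions are indefinite integrals.
\<close>

subsection \<open>Absolutely continuous functions are indefinite integrals\<close>

text \<open>Pairs of endpoints replace the sets of a division, so that clipping, splitting and
  merging families become operations on pairs. Degenerate intervals are excluded, which makes the
  passage from pairs to intervals injective.\<close>

definition nonoverlapping :: "(real \<times> real) set \<Rightarrow> bool" where
  "nonoverlapping D \<longleftrightarrow> finite D \<and> (\<forall>(u, v)\<in>D. u < v) \<and>
     (\<forall>u v u' v'. (u, v) \<in> D \<longrightarrow> (u', v') \<in> D \<longrightarrow> (u, v) \<noteq> (u', v') \<longrightarrow> v \<le> u' \<or> v' \<le> u)"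

definition ac_pairs :: "real \<Rightarrow> real \<Rightarrow> (real \<Rightarrow> 'a::real_normed_vector) \<Rightarrow> bool" where
  "ac_pairs c d f \<longleftrightarrow>
     (\<forall>\<epsilon>>0. \<exists>\<delta>>0. \<forall>D. nonoverlapping D \<and> D \<subseteq> {c..d} \<times> {c..d} \<and> (\<Sum>(u, v)\<in>D. v - u) < \<delta> \<longrightarrow>
        (\<Sum>(u, v)\<in>D. norm (f v - f u)) < \<epsilon>)"

text \<open>The families need not cover \<open>{x..y}\<close>. This does not change the total
  variation, and the empty family keeps the set under the supremum nonempty.\<close>

definition variation :: "(real \<Rightarrow> 'a::real_normed_vector) \<Rightarrow> real \<Rightarrow> real \<Rightarrow> real" where
  "variation f x y =
     Sup {(\<Sum>(u, v)\<in>D. norm (f v - f u)) | D. nonoverlapping D \<and> D \<subseteq> {x..y} \<times> {x..y}}"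

lemma nonoverlapping_empty [simp]: "nonoverlapping {}"
  by (simp add: nonoverlapping_def)

lemma nonoverlapping_singleton [simp]: "nonoverlapping {(u, v)} \<longleftrightarrow> u < v"
  by (simp add: nonoverlapping_def)

lemma nonoverlapping_disjoint:
  assumes "nonoverlapping D" "(u, v) \<in> D" "(u', v') \<in> D" "(u, v) \<noteq> (u', v')"
  shows "v \<le> u' \<or> v' \<le> u"
  using assms unfolding nonoverlapping_def by blast

lemma nonoverlappingI:
  assumes "finite D" "\<And>u v. (u, v) \<in> D \<Longrightarrow> u < v"
    and "\<And>u v u' v'. (u, v) \<in> D \<Longrightarrow> (u', v') \<in> D \<Longrightarrow> (u, v) \<noteq> (u', v') \<Longrightarrow> v \<le> u' \<or> v' \<le> u"
  shows "nonoverlapping D"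
  unfolding nonoverlapping_def using assms by blast

text \<open>The open intervals are disjoint, so their total length is the measure of a subset of
  \<open>{x..y}\<close>.\<close>

lemma nonoverlapping_length:
  assumes D: "nonoverlapping D" "D \<subseteq> {x..y} \<times> {x..y}" and "x \<le> y"
  shows "(\<Sum>(u, v)\<in>D. v - u) \<le> y - x"
proof -
  have fin: "finite D" using D(1) by (simp add: nonoverlapping_def)
  have lt: "u < v" if "(u, v) \<in> D" for u v using D(1) that by (auto simp: nonoverlapping_def)
  have dj: "disjoint_family_on (\<lambda>z. {fst z<..<snd z}) D"
    unfolding disjoint_family_on_def
  proof (intro ballI impI)
    fix z z' assume "z \<in> D" "z' \<in> D" "z \<noteq> z'"
    then have "snd z \<le> fst z' \<or> snd z' \<le> fst z"
      using nonoverlapping_disjoint[OF D(1), of "fst z" "snd z" "fst z'" "snd z'"]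
      by (simp add: prod_eq_iff)
    then show "{fst z<..<snd z} \<inter> {fst z'<..<snd z'} = {}" by auto
  qed
  have "(\<Sum>(u, v)\<in>D. v - u) = (\<Sum>z\<in>D. measure lborel {fst z<..<snd z})"
    by (intro sum.cong refl) (auto dest: lt)
  also have "\<dots> = measure lborel (\<Union>z\<in>D. {fst z<..<snd z})"
    using fin dj lt
    by (intro measure_finite_Union[symmetric]) (auto simp: emeasure_lborel_Ioo less_imp_le)
  also have "\<dots> \<le> measure lborel (cbox x y)"
    using D(2) by (intro measure_mono_fmeasurable fmeasurable_cbox) (auto simp: fin subset_iff, force+)
  also have "\<dots> = y - x" using \<open>x \<le> y\<close> by simp
  finally show ?thesis .
qed

lemma ac_pairs_of_abs_continuous:
  assumes "abs_continuous_on_ivl c d f"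
  shows "ac_pairs c d f"
  unfolding ac_pairs_def
proof (intro allI impI)
  fix \<epsilon> :: real assume "\<epsilon> > 0"
  with assms obtain \<delta> where \<delta>: "\<delta> > 0"
    and *: "\<And>D. D division_of \<Union>D \<Longrightarrow> \<Union>D \<subseteq> {c..d} \<Longrightarrow> (\<Sum>K\<in>D. measure lborel K) < \<delta> \<Longrightarrow>
        (\<Sum>K\<in>D. norm (f (Sup K) - f (Inf K))) < \<epsilon>"
    unfolding abs_continuous_on_ivl_def by meson
  have "(\<Sum>(u, v)\<in>D. norm (f v - f u)) < \<epsilon>"
    if D: "nonoverlapping D" "D \<subseteq> {c..d} \<times> {c..d}" "(\<Sum>(u, v)\<in>D. v - u) < \<delta>" for D
  proof -
    let ?J = "\<lambda>(u, v). {u..v::real}"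
    have lt: "u < v" if "(u, v) \<in> D" for u v using D(1) that by (auto simp: nonoverlapping_def)
    have inj: "inj_on ?J D"
      using lt by (fastforce simp: inj_on_def)
    have "?J ` D division_of \<Union>(?J ` D)"
    proof (rule division_ofI)
      show "finite (?J ` D)" using D(1) by (simp add: nonoverlapping_def)
      show "K \<noteq> {}" "\<exists>a b. K = cbox a b" if "K \<in> ?J ` D" for K
        using that lt by (force simp: box_real)+
      show "interior K \<inter> interior L = {}" if KL: "K \<in> ?J ` D" "L \<in> ?J ` D" "K \<noteq> L" for K L
      proof -
        obtain u v u' v' where w: "(u, v) \<in> D" "(u', v') \<in> D" "K = {u..v}" "L = {u'..v'}"
          using KL(1,2) by (auto simp: image_iff)
        with KL(3) nonoverlapping_disjoint[OF D(1) w(1,2)] show ?thesis by auto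
      qed
    qed auto
    moreover have "\<Union>(?J ` D) \<subseteq> {c..d}" using D(2) by auto
    moreover have "(\<Sum>K\<in>?J ` D. measure lborel K) = (\<Sum>(u, v)\<in>D. v - u)"
      unfolding sum.reindex[OF inj] by (rule sum.cong) (auto dest: lt)
    ultimately have "(\<Sum>K\<in>?J ` D. norm (f (Sup K) - f (Inf K))) < \<epsilon>"
      using * D(3) by metis
    moreover have "(\<Sum>K\<in>?J ` D. norm (f (Sup K) - f (Inf K))) = (\<Sum>(u, v)\<in>D. norm (f v - f u))"
      unfolding sum.reindex[OF inj] by (rule sum.cong) (auto dest: lt)
    ultimately show ?thesis by simp
  qed
  with \<delta> show "\<exists>\<delta>>0. \<forall>D. nonoverlapping D \<and> D \<subseteq> {c..d} \<times> {c..d} \<and> (\<Sum>(u, v)\<in>D. v - u) < \<delta> \<longrightarrow>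
        (\<Sum>(u, v)\<in>D. norm (f v - f u)) < \<epsilon>" by blast
qed

lemma ac_pairs_subset: "ac_pairs c d f \<Longrightarrow> c \<le> c' \<Longrightarrow> d' \<le> d \<Longrightarrow> ac_pairs c' d' f"
  unfolding ac_pairs_def by (meson Sigma_mono atLeastatMost_subset_iff subset_trans)

lemma ac_pairs_continuous:
  assumes "ac_pairs c d f"
  shows "continuous_on {c..d} f"
proof (clarsimp simp: continuous_on_iff)
  fix x e assume x: "c \<le> x" "x \<le> d" "0 < (e::real)"
  then obtain \<delta> where \<delta>: "\<delta> > 0"
    and *: "\<And>D. nonoverlapping D \<Longrightarrow> D \<subseteq> {c..d} \<times> {c..d} \<Longrightarrow> (\<Sum>(u, v)\<in>D. v - u) < \<delta> \<Longrightarrow>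
        (\<Sum>(u, v)\<in>D. norm (f v - f u)) < e"
    using assms unfolding ac_pairs_def by meson
  have "dist (f y) (f x) < e" if y: "y \<in> {c..d}" "dist y x < \<delta>" for y
  proof (cases y x rule: linorder_cases)
    case less
    then have "(\<Sum>(u, v)\<in>{(y,x)}. norm (f v - f u)) < e"
      using x y by (intro *) (auto simp: dist_real_def)
    then show ?thesis by (simp add: dist_norm norm_minus_commute)
  next
    case greater
    then have "(\<Sum>(u, v)\<in>{(x,y)}. norm (f v - f u)) < e"
      using x y by (intro *) (auto simp: dist_real_def)
    then show ?thesis by (simp add: dist_norm)
  qed (use x in auto)
  with \<delta> show "\<exists>\<delta>>0. \<forall>y\<in>{c..d}. dist y x < \<delta> \<longrightarrow> dist (f y) (f x) < e" by blast
qed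

section \<open>Total variation of functions of bounded variation\<close>

context
  fixes f :: "real \<Rightarrow> 'a::real_normed_vector" and c d B :: real
  assumes bdd: "\<And>D. nonoverlapping D \<Longrightarrow> D \<subseteq> {c..d} \<times> {c..d} \<Longrightarrow> (\<Sum>(u, v)\<in>D. norm (f v - f u)) \<le> B"
begin

text \<open>The supremum of an unbounded set of reals is unspecified; the bound \<open>B\<close> of
  the context makes it an upper bound.\<close>

lemma variation_upper:
  assumes "c \<le> x" "y \<le> d" "nonoverlapping D" "D \<subseteq> {x..y} \<times> {x..y}"
  shows "(\<Sum>(u, v)\<in>D. norm (f v - f u)) \<le> variation f x y"
  unfolding variation_def
proof (rule cSup_upper)
  show "bdd_above {(\<Sum>(u, v)\<in>D. norm (f v - f u)) | D. nonoverlapping D \<and> D \<subseteq> {x..y} \<times> {x..y}}"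
    unfolding bdd_above_def
    using assms by (intro exI[of _ B]) (force intro!: bdd)
qed (use assms in blast)

lemma variation_least:
  assumes "\<And>D. nonoverlapping D \<Longrightarrow> D \<subseteq> {x..y} \<times> {x..y} \<Longrightarrow> (\<Sum>(u, v)\<in>D. norm (f v - f u)) \<le> C"
  shows "variation f x y \<le> C"
  unfolding variation_def
proof (rule cSup_least)
  have "nonoverlapping {} \<and> {} \<subseteq> {x..y} \<times> {x..y}" by simp
  then show "{(\<Sum>(u, v)\<in>D. norm (f v - f u)) | D. nonoverlapping D \<and> D \<subseteq> {x..y} \<times> {x..y}} \<noteq> {}" by blast
qed (use assms in blast)

text \<open>Adjoining the pair \<open>(x, y)\<close> to a family inside \<open>{c..x}\<close> gives
  an admissible family inside \<open>{c..y}\<close>.\<close>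

lemma variation_super:
  assumes "c \<le> x" "x \<le> y" "y \<le> d"
  shows "variation f c x + norm (f y - f x) \<le> variation f c y"
proof (cases "x = y")
  case False
  have "variation f c x \<le> variation f c y - norm (f y - f x)"
  proof (rule variation_least)
    fix D assume D: "nonoverlapping D" "D \<subseteq> {c..x} \<times> {c..x}"
    have "nonoverlapping (insert (x, y) D)"
    proof (rule nonoverlappingI)
      show "finite (insert (x, y) D)" using D(1) by (simp add: nonoverlapping_def)
      show "u < v" if "(u, v) \<in> insert (x, y) D" for u v
        using that D(1) False assms by (auto simp: nonoverlapping_def)
      show "v \<le> u' \<or> v' \<le> u" if "(u, v) \<in> insert (x, y) D" "(u', v') \<in> insert (x, y) D"
        "(u, v) \<noteq> (u', v')" for u v u' v'
        using that D nonoverlapping_disjoint[OF D(1), of u v u' v'] by auto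
    qed
    moreover have "insert (x, y) D \<subseteq> {c..y} \<times> {c..y}" using D(2) assms by auto
    ultimately have "(\<Sum>(u, v)\<in>insert (x, y) D. norm (f v - f u)) \<le> variation f c y"
      using assms by (intro variation_upper) auto
    moreover have "(x, y) \<notin> D" using D(2) False assms by auto
    moreover have "finite D" using D(1) by (simp add: nonoverlapping_def)
    ultimately show "(\<Sum>(u, v)\<in>D. norm (f v - f u)) \<le> variation f c y - norm (f y - f x)"
      by simp
  qed
  then show ?thesis by simp
qed simp

text \<open>Every interval is cut at \<open>x\<close>; by the triangle inequality the sum does not
  decrease, and the two halves are families on either side of \<open>x\<close>.\<close>

lemma variation_sub:
  assumes "c \<le> x" "x \<le> y" "y \<le> d"
  shows "variation f c y \<le> variation f c x + variation f x y"
proof (rule variation_least)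
  fix D assume D: "nonoverlapping D" "D \<subseteq> {c..y} \<times> {c..y}"
  have fin: "finite D" using D(1) by (simp add: nonoverlapping_def)
  have lt: "u < v" if "(u, v) \<in> D" for u v using D(1) that by (auto simp: nonoverlapping_def)
  \<comment> \<open>\<open>L\<close> and \<open>R\<close> keep exactly the intervals whose clipped
    versions under \<open>l\<close> and \<open>r\<close> are still nondegenerate. An interval across
    \<open>x\<close> belongs to both.\<close>
  define L where "L = {w\<in>D. fst w < x}"
  define R where "R = {w\<in>D. x < snd w}"
  define l where "l = (\<lambda>(u, v). (u::real, min v x))"
  define r where "r = (\<lambda>(u, v). (max u x, v::real))"
  have injl: "inj_on l L"
    using nonoverlapping_disjoint[OF D(1)] lt by (fastforce simp: inj_on_def l_def L_def)
  have injr: "inj_on r R"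
    using nonoverlapping_disjoint[OF D(1)] lt by (fastforce simp: inj_on_def r_def R_def)
  have "nonoverlapping (l ` L)"
  proof (rule nonoverlappingI)
    show "v \<le> u' \<or> v' \<le> u" if "(u, v) \<in> l ` L" "(u', v') \<in> l ` L" "(u, v) \<noteq> (u', v')" for u v u' v'
      using that nonoverlapping_disjoint[OF D(1)] by (fastforce simp: l_def L_def)
  qed (use fin lt in \<open>auto simp: l_def L_def\<close>)
  then have l1: "(\<Sum>(u, v)\<in>l ` L. norm (f v - f u)) \<le> variation f c x"
    using assms D(2) by (intro variation_upper) (auto simp: l_def L_def)
  have "nonoverlapping (r ` R)"
  proof (rule nonoverlappingI)
    show "v \<le> u' \<or> v' \<le> u" if "(u, v) \<in> r ` R" "(u', v') \<in> r ` R" "(u, v) \<noteq> (u', v')" for u v u' v'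
      using that nonoverlapping_disjoint[OF D(1)] by (fastforce simp: r_def R_def)
  qed (use fin lt in \<open>auto simp: r_def R_def\<close>)
  then have r1: "(\<Sum>(u, v)\<in>r ` R. norm (f v - f u)) \<le> variation f x y"
    using assms D(2) by (intro variation_upper) (auto simp: r_def R_def)
  have "(\<Sum>(u, v)\<in>D. norm (f v - f u)) \<le>
     (\<Sum>(u, v)\<in>D. (if u < x then norm (f (min v x) - f u) else 0) + (if x < v then norm (f v - f (max u x)) else 0))"
  proof (rule sum_mono, clarify)
    fix u v assume "(u, v) \<in> D"
    have "norm (f v - f u) \<le> norm (f x - f u) + norm (f v - f x)"
      using norm_triangle_ineq[of "f x - f u" "f v - f x"] by simp
    with lt[OF \<open>(u,v) \<in> D\<close>] show "norm (f v - f u) \<le> (if u < x then norm (f (min v x) - f u) else 0) + (if x < v then norm (f v - f (max u x)) else 0)"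
      by (auto simp: min_def max_def)
  qed
  also have "\<dots> = (\<Sum>(u, v)\<in>D. (if u < x then norm (f (min v x) - f u) else 0)) + (\<Sum>(u, v)\<in>D. (if x < v then norm (f v - f (max u x)) else 0))"
    by (simp add: sum.distrib case_prod_unfold)
  also have "(\<Sum>(u, v)\<in>D. (if u < x then norm (f (min v x) - f u) else 0)) = (\<Sum>(u, v)\<in>l ` L. norm (f v - f u))"
    unfolding sum.reindex[OF injl] unfolding L_def using fin
    by (simp add: sum.inter_filter case_prod_unfold l_def)
  also have "(\<Sum>(u, v)\<in>D. (if x < v then norm (f v - f (max u x)) else 0)) = (\<Sum>(u, v)\<in>r ` R. norm (f v - f u))"
    unfolding sum.reindex[OF injr] unfolding R_def using fin
    by (simp add: sum.inter_filter case_prod_unfold r_def)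
  finally show "(\<Sum>(u, v)\<in>D. norm (f v - f u)) \<le> variation f c x + variation f x y"
    using l1 r1 by linarith
qed

lemma variation_near:
  assumes "c \<le> x" "y \<le> d" "0 < e"
  shows "\<exists>D. nonoverlapping D \<and> D \<subseteq> {x..y} \<times> {x..y} \<and> variation f x y - e < (\<Sum>(u, v)\<in>D. norm (f v - f u))"
proof (rule ccontr)
  assume "\<not> ?thesis"
  then have "variation f x y \<le> variation f x y - e"
    by (intro variation_least) (auto simp: not_less)
  then show False using assms by simp
qed

text \<open>In each interval of a short family a nearly optimal subfamily is chosen. All of them
  together form a family that is no longer than the original one, so absolute continuity of
  \<open>f\<close> bounds its sum, and only the deficits remain.\<close>

lemma variation_ac:
  assumes "ac_pairs c d f"
  shows "ac_pairs c d (variation f c)"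
  unfolding ac_pairs_def
proof (intro allI impI)
  fix \<epsilon> :: real assume "\<epsilon> > 0"
  then obtain \<delta> where \<delta>: "\<delta> > 0"
    and *: "\<And>D. nonoverlapping D \<Longrightarrow> D \<subseteq> {c..d} \<times> {c..d} \<Longrightarrow> (\<Sum>(u, v)\<in>D. v - u) < \<delta> \<Longrightarrow>
        (\<Sum>(u, v)\<in>D. norm (f v - f u)) < \<epsilon> / 2"
    using assms unfolding ac_pairs_def by (meson half_gt_zero)
  have "(\<Sum>(u, v)\<in>D. norm (variation f c v - variation f c u)) < \<epsilon>"
    if D: "nonoverlapping D" "D \<subseteq> {c..d} \<times> {c..d}" "(\<Sum>(u, v)\<in>D. v - u) < \<delta>" for D
  proof -
    have fin: "finite D" using D(1) by (simp add: nonoverlapping_def)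
    have lt: "u < v" if "(u, v) \<in> D" for u v using D(1) that by (auto simp: nonoverlapping_def)
    \<comment> \<open>The \<open>card D\<close> deficits add up to at most half of \<epsilon>; the
      added 1 covers an empty \<open>D\<close>.\<close>
    define \<eta> where "\<eta> = \<epsilon> / 2 / (card D + 1)"
    have \<eta>: "\<eta> > 0" using \<open>\<epsilon> > 0\<close> by (simp add: \<eta>_def)
    have "\<forall>w\<in>D. \<exists>E. nonoverlapping E \<and> E \<subseteq> {fst w..snd w} \<times> {fst w..snd w} \<and>
        variation f (fst w) (snd w) - \<eta> < (\<Sum>(u, v)\<in>E. norm (f v - f u))"
      using D(2) \<eta> by (intro ballI variation_near) auto
    then obtain E where E: "\<And>w. w \<in> D \<Longrightarrow> nonoverlapping (E w)"
      "\<And>w. w \<in> D \<Longrightarrow> E w \<subseteq> {fst w..snd w} \<times> {fst w..snd w}"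
      "\<And>w. w \<in> D \<Longrightarrow> variation f (fst w) (snd w) - \<eta> < (\<Sum>(u, v)\<in>E w. norm (f v - f u))"
      by metis
    have finE: "finite (E w)" if "w \<in> D" for w using E(1)[OF that] by (simp add: nonoverlapping_def)
    have ltE: "u < v" if "w \<in> D" "(u, v) \<in> E w" for u v w
      using E(1)[OF that(1)] that(2) by (auto simp: nonoverlapping_def)
    have sep: "snd z \<le> fst z' \<or> snd z' \<le> fst z" if "w \<in> D" "w' \<in> D" "w \<noteq> w'" "z \<in> E w" "z' \<in> E w'" for w w' z z'
    proof -
      have "z \<in> {fst w..snd w} \<times> {fst w..snd w}" "z' \<in> {fst w'..snd w'} \<times> {fst w'..snd w'}"
        using that E(2) by blast+
      moreover have "snd w \<le> fst w' \<or> snd w' \<le> fst w"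
        using nonoverlapping_disjoint[OF D(1), of "fst w" "snd w" "fst w'" "snd w'"] that by (simp add: prod_eq_iff)
      ultimately show ?thesis by (force simp: mem_Times_iff)
    qed
    have disj: "E w \<inter> E w' = {}" if "w \<in> D" "w' \<in> D" "w \<noteq> w'" for w w'
      using sep[OF that] ltE that by fastforce
    have no: "nonoverlapping (\<Union>(E ` D))"
    proof (rule nonoverlappingI)
      show "finite (\<Union>(E ` D))" using fin finE by auto
      show "v \<le> u' \<or> v' \<le> u" if uv: "(u, v) \<in> \<Union>(E ` D)" "(u', v') \<in> \<Union>(E ` D)" "(u, v) \<noteq> (u', v')" for u v u' v'
      proof -
        obtain w w' where w: "w \<in> D" "w' \<in> D" "(u, v) \<in> E w" "(u', v') \<in> E w'" using uv(1,2) by blast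
        show ?thesis
          using nonoverlapping_disjoint[OF E(1)[OF w(1)] w(3), of u' v'] sep[OF w(1,2) _ w(3,4)] w uv(3) by auto
      qed
    qed (use ltE in auto)
    have sumE: "(\<Sum>z\<in>\<Union>(E ` D). g z) = (\<Sum>w\<in>D. \<Sum>z\<in>E w. g z)" for g :: "real \<times> real \<Rightarrow> real"
      using fin finE disj by (intro sum.UNION_disjoint) auto
    have len: "(\<Sum>(u, v)\<in>E w. v - u) \<le> snd w - fst w" if "w \<in> D" for w
      using nonoverlapping_length[OF E(1,2)[OF that]] lt that by (cases w) (auto intro: less_imp_le)
    have "(\<Sum>(u, v)\<in>\<Union>(E ` D). v - u) \<le> (\<Sum>(u, v)\<in>D. v - u)"
      unfolding sumE using len by (intro sum_mono) (auto simp: case_prod_unfold)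
    then have "(\<Sum>(u, v)\<in>\<Union>(E ` D). v - u) < \<delta>" using D(3) by simp
    moreover have "\<Union>(E ` D) \<subseteq> {c..d} \<times> {c..d}" using D(2) E(2) by force
    ultimately have 1: "(\<Sum>(u, v)\<in>\<Union>(E ` D). norm (f v - f u)) < \<epsilon> / 2" using no by (intro *)
    have "(\<Sum>(u, v)\<in>D. norm (variation f c v - variation f c u)) \<le> (\<Sum>w\<in>D. \<eta> + (\<Sum>(u, v)\<in>E w. norm (f v - f u)))"
    proof (rule sum_mono, clarify)
      fix u v assume uv: "(u, v) \<in> D"
      have "c \<le> u" "u \<le> v" "v \<le> d" using uv D(2) lt[OF uv] by auto
      then have "variation f c u \<le> variation f c v" "variation f c v \<le> variation f c u + variation f u v"
        using variation_super[of u v] norm_ge_zero[of "f v - f u"] variation_sub[of u v] by linarith+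
      with E(3)[OF uv] show "norm (variation f c v - variation f c u) \<le> \<eta> + (\<Sum>(u, v)\<in>E (u, v). norm (f v - f u))"
        by simp
    qed
    also have "\<dots> = card D * \<eta> + (\<Sum>(u, v)\<in>\<Union>(E ` D). norm (f v - f u))"
      unfolding sumE by (simp add: sum.distrib)
    also have "card D * \<eta> \<le> \<epsilon> / 2" using \<open>\<epsilon> > 0\<close> by (simp add: \<eta>_def field_simps)
    finally show ?thesis using 1 by simp
  qed
  with \<delta> show "\<exists>\<delta>>0. \<forall>D. nonoverlapping D \<and> D \<subseteq> {c..d} \<times> {c..d} \<and> (\<Sum>(u, v)\<in>D. v - u) < \<delta> \<longrightarrow>
        (\<Sum>(u, v)\<in>D. norm (variation f c v - variation f c u)) < \<epsilon>" by blast
qed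

end


text \<open>The Lebesgue--Stieltjes measure of \<open>G\<close> is absolutely continuous, and its Radon--Nikodym density is the
  derivative.\<close>

lemma mono_ac_indefinite_integral:
  fixes G :: "real \<Rightarrow> real"
  assumes "c \<le> d" and mono: "mono_on {c..d} G" and ac: "ac_pairs c d G"
  obtains g where "g absolutely_integrable_on {c..d}"
    "\<And>x. x \<in> {c..d} \<Longrightarrow> (g has_integral (G x - G c)) {c..x}"
proof -
  \<comment> \<open>The constant extension makes the function monotone and continuous on the whole
    line, as \<open>interval_measure\<close> requires, and puts no mass outside
    \<open>{c..d}\<close>.\<close>
  define H where "H x = G (max c (min d x))" for x
  have mH: "H x \<le> H y" if "x \<le> y" for x y
    using that \<open>c \<le> d\<close> unfolding H_def by (intro mono_onD[OF mono]) auto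
  have cH: "continuous_on UNIV H"
    unfolding H_def
    by (rule continuous_on_compose2[OF ac_pairs_continuous[OF ac]])
       (use \<open>c \<le> d\<close> in \<open>auto intro!: continuous_intros\<close>)
  have HG: "H x = G x" if "x \<in> {c..d}" for x using that by (auto simp: H_def)
  define N where "N = interval_measure H"
  have sN [measurable_cong]: "sets N = sets borel" by (simp add: N_def)
  have NIcc: "emeasure N {x..y} = ennreal (H y - H x)" if "x \<le> y" for x y
    unfolding N_def by (rule emeasure_interval_measure_Icc[OF that mH cH])
  have out: "- {c..d} \<in> null_sets N"
  proof -
    have "{c - real n..c} \<in> null_sets N" "{d..d + real n} \<in> null_sets N" for n
      using \<open>c \<le> d\<close> by (auto simp: null_sets_def sN NIcc H_def)
    then have "(\<Union>n. {c - real n..c}) \<union> (\<Union>n. {d..d + real n}) \<in> null_sets N"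
      by (intro null_sets.Un null_sets_UN) auto
    moreover have "- {c..d} \<subseteq> (\<Union>n. {c - real n..c}) \<union> (\<Union>n. {d..d + real n})"
    proof
      fix x assume x: "x \<in> - {c..d}"
      obtain n :: nat where "\<bar>x\<bar> + \<bar>c\<bar> + \<bar>d\<bar> \<le> real n" using real_arch_simple by blast
      with x show "x \<in> (\<Union>n. {c - real n..c}) \<union> (\<Union>n. {d..d + real n})"
        by (cases "x < c") (auto intro!: exI[of _ n])
    qed
    ultimately show ?thesis using null_sets_subset[of _ N "- {c..d}"] by (simp add: sN)
  qed
  \<comment> \<open>Outer regularity encloses the null set in an open set of measure below \<delta>.
    That set is exhausted by finite unions \<open>E n\<close> of closed intervals, to whose
    divisions the condition \<open>ac_pairs\<close> applies.\<close>
  have null: "emeasure N A \<le> ennreal \<epsilon>" if A: "A \<in> null_sets lborel" and "\<epsilon> > 0" for A \<epsilon>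
  proof -
    obtain \<delta> where \<delta>: "\<delta> > 0"
      and *: "\<And>D. nonoverlapping D \<Longrightarrow> D \<subseteq> {c..d} \<times> {c..d} \<Longrightarrow> (\<Sum>(u, v)\<in>D. v - u) < \<delta> \<Longrightarrow>
          (\<Sum>(u, v)\<in>D. norm (G v - G u)) < \<epsilon>"
      using ac \<open>\<epsilon> > 0\<close> unfolding ac_pairs_def by meson
    have Ab: "A \<in> sets borel" using A by auto
    obtain U where U: "open U" "A \<subseteq> U" "emeasure lborel (U - A) < ennreal \<delta>"
      using outer_regular_lborel[OF Ab \<delta>] by auto
    have "emeasure lborel U \<le> emeasure lborel (U - A) + emeasure lborel A"
      using U Ab by (metis Diff_partition Un_commute borel_open emeasure_subadditive sets.Diff sets_lborel)
    then have Um: "emeasure lborel U < ennreal \<delta>" using U(3) A by auto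
    have "\<exists>B :: nat \<Rightarrow> real set. (\<forall>n. \<exists>u v. B n = {u..v}) \<and> U = (\<Union>n. B n)"
    proof -
      define I where "I = {(u, v). u \<in> \<rat> \<and> v \<in> \<rat> \<and> {u..v} \<subseteq> U}"
      have "I \<subseteq> \<rat> \<times> \<rat>" by (auto simp: I_def)
      then have "countable I" by (rule countable_subset) (auto intro: countable_rat)
      moreover have "(1, 0) \<in> I" by (simp add: I_def)
      ultimately have r: "range (from_nat_into I) = I" by (intro range_from_nat_into) auto
      have "U \<subseteq> (\<Union>(u, v)\<in>I. {u..v})"
      proof
        fix x assume "x \<in> U"
        then obtain e where e: "e > 0" "cball x e \<subseteq> U" using U(1) open_contains_cball by blast
        obtain u v where "u \<in> \<rat>" "x - e < u" "u < x" "v \<in> \<rat>" "x < v" "v < x + e"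
          using Rats_dense_in_real[of "x - e" x] Rats_dense_in_real[of x "x + e"] e(1) by auto
        moreover from this have "{u..v} \<subseteq> cball x e" by (auto simp: dist_real_def)
        then have "{u..v} \<subseteq> U" using e(2) by blast
        ultimately have "(u, v) \<in> I" "x \<in> {u..v}" by (auto simp: I_def)
        then show "x \<in> (\<Union>(u, v)\<in>I. {u..v})" by blast
      qed
      then have "U = (\<Union>(u, v)\<in>I. {u..v})" by (auto simp: I_def)
      then have "U = (\<Union>n. case from_nat_into I n of (u, v) \<Rightarrow> {u..v})" by (subst (asm) r[symmetric]) auto
      then show ?thesis
        by (intro exI[of _ "\<lambda>n. case from_nat_into I n of (u, v) \<Rightarrow> {u..v}"]) (auto split: prod.split)
    qed
    then obtain B :: "nat \<Rightarrow> real set" where B: "\<And>n. \<exists>u v. B n = {u..v}" "U = (\<Union>n. B n)" by auto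
    define E where "E n = (\<Union>i<n. B i \<inter> {c..d})" for n
    have Bb: "B n \<in> sets borel" for n using B(1)[of n] by auto
    have Eb: "E n \<in> sets borel" for n using Bb unfolding E_def by auto
    have NE: "emeasure N (E n) \<le> ennreal \<epsilon>" for n
    proof -
      have "\<exists>a b. K = cbox a b" if "K \<in> (\<lambda>i. B i \<inter> {c..d}) ` {..<n}" for K
        using that B(1) by (auto simp: box_real Int_atLeastAtMost) (metis Int_atLeastAtMost)
      then obtain p where p: "p division_of (\<Union>((\<lambda>i. B i \<inter> {c..d}) ` {..<n}))"
        using elementary_unions_intervals[of "(\<lambda>i. B i \<inter> {c..d}) ` {..<n}"] by blast
      then have p: "p division_of E n" by (simp add: E_def)
      \<comment> \<open>A division may contain single points, which \<open>nonoverlapping\<close>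
        forbids. Dropping them changes none of the sums, as \<open>sumD\<close> records.\<close>
      define D where "D = (\<lambda>K. (Inf K, Sup K)) ` {K\<in>p. Inf K < Sup K}"
      have pK: "K = {Inf K..Sup K}" "Inf K \<le> Sup K" if "K \<in> p" for K
        using division_ofD(3,4)[OF p that] by auto
      have finp: "finite p" using p by auto
      have inj: "inj_on (\<lambda>K. (Inf K, Sup K)) {K\<in>p. Inf K < Sup K}"
        using pK by (intro inj_onI) (metis (mono_tags, lifting) mem_Collect_eq prod.inject)
      have no: "nonoverlapping D"
      proof (rule nonoverlappingI)
        show "v \<le> u' \<or> v' \<le> u" if uv: "(u, v) \<in> D" "(u', v') \<in> D" "(u, v) \<noteq> (u', v')" for u v u' v'
        proof -
          have "{u..v} \<in> p" "{u'..v'} \<in> p" "u < v" "u' < v'" using uv pK by (auto simp: D_def)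
          moreover from this have "{u..v} \<noteq> {u'..v'}" using uv(3) by auto
          ultimately have "{u<..<v} \<inter> {u'<..<v'} = {}" using division_ofD(5)[OF p] by fastforce
          with \<open>u < v\<close> \<open>u' < v'\<close> show ?thesis by (auto simp: max_def min_def split: if_splits)
        qed
      qed (use finp in \<open>auto simp: D_def\<close>)
      have Dsub: "D \<subseteq> {c..d} \<times> {c..d}"
      proof -
        have "K \<subseteq> {c..d}" if "K \<in> p" for K using division_ofD(2)[OF p that] by (auto simp: E_def)
        then show ?thesis using pK by (fastforce simp: D_def)
      qed
      have sumD: "(\<Sum>(u, v)\<in>D. \<phi> u v) = (\<Sum>K\<in>p. \<phi> (Inf K) (Sup K))" if "\<And>u. \<phi> u u = (0::real)" for \<phi>
      proof -
        have "(\<Sum>(u, v)\<in>D. \<phi> u v) = (\<Sum>K\<in>{K\<in>p. Inf K < Sup K}. \<phi> (Inf K) (Sup K))"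
          unfolding D_def sum.reindex[OF inj] by (simp add: o_def)
        also have "\<dots> = (\<Sum>K\<in>p. \<phi> (Inf K) (Sup K))"
        proof (intro sum.mono_neutral_left ballI)
          fix K assume "K \<in> p - {K\<in>p. Inf K < Sup K}"
          then have "Inf K = Sup K" using pK(2)[of K] by auto
          then show "\<phi> (Inf K) (Sup K) = 0" using that by simp
        qed (use finp in auto)
        finally show ?thesis .
      qed
      have "(\<Sum>(u, v)\<in>D. v - u) = (\<Sum>K\<in>p. measure lborel K)"
        by (subst sumD) (auto intro!: sum.cong simp: pK(2) simp flip: pK(1), metis measure_lborel_Icc pK)
      also have "\<dots> = measure lebesgue (E n)"
      proof -
        have "sum (measure lebesgue) p = sum (measure lborel) p"
          by (rule sum.cong[OF refl], subst (1 2) pK(1)) (auto simp: measure_completion)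
        then show ?thesis using content_division[OF p] by simp
      qed
      also have "\<dots> < \<delta>"
      proof -
        have "emeasure lborel (E n) \<le> emeasure lborel U"
          using U(1) B(2) by (intro emeasure_mono) (auto simp: E_def)
        then have "emeasure lborel (E n) < ennreal \<delta>" using Um by (rule le_less_trans)
        then have "measure lborel (E n) < \<delta>" using \<delta>
          by (cases "emeasure lborel (E n)") (auto simp: measure_def ennreal_less_iff)
        then show ?thesis using Eb by (simp add: measure_completion)
      qed
      finally have "(\<Sum>(u, v)\<in>D. norm (G v - G u)) < \<epsilon>" using no Dsub by (intro *)
      then have "(\<Sum>K\<in>p. norm (G (Sup K) - G (Inf K))) < \<epsilon>" by (subst (asm) sumD) auto
      moreover have "emeasure N K = ennreal (norm (G (Sup K) - G (Inf K)))" if K: "K \<in> p" for K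
      proof -
        have "K \<subseteq> {c..d}" using division_ofD(2)[OF p K] by (auto simp: E_def)
        moreover have "Inf K \<in> K" "Sup K \<in> K" using pK[OF K] by (metis atLeastAtMost_iff order_refl)+
        ultimately have "H (Inf K) = G (Inf K)" "H (Sup K) = G (Sup K)" by (auto intro!: HG)
        moreover have "emeasure N K = ennreal (H (Sup K) - H (Inf K))" using NIcc pK[OF K] by metis
        ultimately show ?thesis using mH[OF pK(2)[OF K]] by simp
      qed
      moreover have "emeasure N (E n) \<le> (\<Sum>K\<in>p. emeasure N K)"
      proof -
        have "E n = (\<Union>K\<in>p. K)" using division_ofD(6)[OF p] by auto
        moreover have "K \<in> sets N" if "K \<in> p" for K unfolding sN by (subst pK(1)[OF that]) simp
        ultimately show ?thesis
          using emeasure_subadditive_finite[OF finp, of "\<lambda>K. K" N] by auto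
      qed
      ultimately show ?thesis by (simp add: sum_ennreal) (metis (no_types, lifting) ennreal_leI less_imp_le order_trans)
    qed
    have "emeasure N A \<le> emeasure N ((\<Union>n. E n) \<union> - {c..d})"
    proof (rule emeasure_mono)
      show "A \<subseteq> (\<Union>n. E n) \<union> - {c..d}"
      proof
        fix x assume "x \<in> A"
        then obtain n where "x \<in> B n" using U(2) B(2) by auto
        then show "x \<in> (\<Union>n. E n) \<union> - {c..d}" by (auto simp: E_def intro!: exI[of _ "Suc n"])
      qed
      show "(\<Union>n. E n) \<union> - {c..d} \<in> sets N"
        unfolding sN using Eb by (intro sets.Un sets.countable_UN) auto
    qed
    also have "\<dots> \<le> emeasure N (\<Union>n. E n) + emeasure N (- {c..d})"
      using Eb by (intro emeasure_subadditive) (auto simp: sN)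
    also have "\<dots> = emeasure N (\<Union>n. E n)" using out by auto
    also have "\<dots> = (SUP n. emeasure N (E n))"
    proof (rule SUP_emeasure_incseq[symmetric])
      show "incseq E" unfolding incseq_def E_def by (intro allI impI UN_mono) auto
    qed (use Eb in \<open>auto simp: sN\<close>)
    also have "\<dots> \<le> ennreal \<epsilon>" using NE by (rule SUP_least)
    finally show ?thesis .
  qed
  have "absolutely_continuous lborel N"
  proof -
    have "emeasure N A = 0" if A: "A \<in> null_sets lborel" for A
    proof -
      have "emeasure N A \<le> 0" by (rule ennreal_le_epsilon) (use null[OF A] in auto)
      then show ?thesis by simp
    qed
    then show ?thesis by (auto simp: absolutely_continuous_def null_sets_def sN)
  qed
  then obtain f where f: "f \<in> borel_measurable lborel" "density lborel f = N"
    using sigma_finite_measure.Radon_Nikodym[OF sigma_finite_lborel, of N] by (auto simp: sN)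
  have fint: "(\<integral>\<^sup>+t. f t * indicator {c..x} t \<partial>lborel) = ennreal (G x - G c)" if "x \<in> {c..d}" for x
  proof -
    have "emeasure (density lborel f) {c..x} = (\<integral>\<^sup>+t. f t * indicator {c..x} t \<partial>lborel)"
      using f(1) by (intro emeasure_density) auto
    then show ?thesis using f(2) NIcc[of c x] HG that by auto
  qed
  \<comment> \<open>The density may be infinite on a null set, and \<open>enn2real\<close> gives it
    finite values there.\<close>
  define g where "g t = (if t \<in> {c..d} then enn2real (f t) else 0)" for t
  have gm: "g \<in> borel_measurable borel" using f(1) unfolding g_def by measurable
  have gnn: "0 \<le> g t" for t by (simp add: g_def)
  have "AE t in lborel. f t * indicator {c..d} t \<noteq> \<infinity>"
    using f(1) fint[of d] \<open>c \<le> d\<close> by (intro nn_integral_noteq_infinite) auto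
  then have fg: "AE t in lborel. t \<in> {c..d} \<longrightarrow> ennreal (g t) = f t"
    by eventually_elim (auto simp: g_def less_top)
  have hi: "(g has_integral (G x - G c)) {c..x}" if x: "x \<in> {c..d}" for x
  proof -
    have "((\<lambda>t. g t * indicator {c..x} t) has_integral (G x - G c)) UNIV"
    proof (rule nn_integral_has_integral)
      have "(\<integral>\<^sup>+t. ennreal (g t * indicator {c..x} t) \<partial>lborel) = (\<integral>\<^sup>+t. f t * indicator {c..x} t \<partial>lborel)"
        by (rule nn_integral_cong_AE, use fg in eventually_elim) (use x in \<open>auto split: split_indicator\<close>)
      then show "(\<integral>\<^sup>+t. ennreal (g t * indicator {c..x} t) \<partial>lborel) = ennreal (G x - G c)" using fint[OF x] by simp
      show "0 \<le> G x - G c" using x mono_onD[OF mono, of c x] by auto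
    qed (use gm gnn in auto)
    then show ?thesis
      by (subst has_integral_restrict_UNIV[symmetric]) (auto elim!: has_integral_eq[rotated] split: split_indicator)
  qed
  moreover have "g absolutely_integrable_on {c..d}"
    using hi[of d] \<open>c \<le> d\<close> by (intro nonnegative_absolutely_integrable_1) (auto simp: g_def has_integral_integrable)
  ultimately show ?thesis using that by blast
qed

text \<open>\<open>integrable_ccontinuous_explicit\<close> controls averages over
  \<open>{x..x + h}\<close> only. Applied to the reflected function as well it controls the averages
  to the left of \<open>x\<close>, and off both exceptional sets the derivative is
  two-sided.\<close>

lemma lebesgue_differentiation_real:
  fixes g :: "real \<Rightarrow> complex"
  assumes int: "\<And>c d. g integrable_on {c..d}"
  obtains N where "negligible N"
    "\<And>x c. x \<notin> N \<Longrightarrow> c < x \<Longrightarrow> ((\<lambda>t. integral {c..t} g) has_vector_derivative g x) (at x)"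
proof -
  obtain N1 where N1: "negligible N1"
    "\<And>x e. x \<notin> N1 \<Longrightarrow> 0 < e \<Longrightarrow> \<exists>d>0. \<forall>h. 0 < h \<and> h < d \<longrightarrow> norm (integral {x..x + h} g /\<^sub>R h - g x) < e"
    using integrable_ccontinuous_explicit[of g] int by (auto simp: box_real)
  have int': "(\<lambda>x. g (- x)) integrable_on {c..d}" for c d
    using int[of "-d" "-c"] Henstock_Kurzweil_Integration.integrable_reflect_real[where f = g and a = "-d" and b = "-c"] by simp
  obtain N2 where N2: "negligible N2"
    "\<And>x e. x \<notin> N2 \<Longrightarrow> 0 < e \<Longrightarrow> \<exists>d>0. \<forall>h. 0 < h \<and> h < d \<longrightarrow> norm (integral {x..x + h} (\<lambda>x. g (- x)) /\<^sub>R h - g (- x)) < e"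
    using integrable_ccontinuous_explicit[of "\<lambda>x. g (- x)"] int' by (auto simp: box_real)
  have "negligible (uminus ` N2)"
    by (rule negligible_differentiable_image_negligible[OF _ N2(1)]) (auto intro!: derivative_intros)
  then have "negligible (N1 \<union> uminus ` N2)" using N1(1) by simp
  moreover have "((\<lambda>t. integral {c..t} g) has_vector_derivative g x) (at x)"
    if x: "x \<notin> N1 \<union> uminus ` N2" "c < x" for x c
    unfolding has_vector_derivative_def has_derivative_at_alt
  proof (intro conjI allI impI bounded_linear_scaleR_left)
    fix e :: real assume "e > 0"
    have "- x \<notin> N2" using x(1) by (metis UnI2 image_eqI minus_minus)
    from N2(2)[OF this \<open>e > 0\<close>] obtain d2 where d2: "d2 > 0"
      "\<And>h. 0 < h \<Longrightarrow> h < d2 \<Longrightarrow> norm (integral {- x..- x + h} (\<lambda>x. g (- x)) /\<^sub>R h - g x) < e" by auto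
    from N1(2)[OF _ \<open>e > 0\<close>, of x] x(1) obtain d1 where d1: "d1 > 0"
      "\<And>h. 0 < h \<Longrightarrow> h < d1 \<Longrightarrow> norm (integral {x..x + h} g /\<^sub>R h - g x) < e" by auto
    have scale: "norm (w - h *\<^sub>R z) \<le> e * h" if "norm (w /\<^sub>R h - z) < e" "h > 0" for w z :: complex and h
    proof -
      have "w - h *\<^sub>R z = h *\<^sub>R (w /\<^sub>R h - z)" using that(2) by (simp add: scaleR_diff_right)
      then have "norm (w - h *\<^sub>R z) = h * norm (w /\<^sub>R h - z)" using that(2) by (metis abs_of_pos norm_scaleR)
      then show ?thesis using that by (simp add: mult.commute)
    qed
    have "norm (integral {c..y} g - integral {c..x} g - (y - x) *\<^sub>R g x) \<le> e * norm (y - x)"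
      if y: "norm (y - x) < min (min d1 d2) (x - c)" for y
    proof (cases y x rule: linorder_cases)
      case greater
      have "integral {c..x} g + integral {x..y} g = integral {c..y} g"
        using greater x(2) by (intro Henstock_Kurzweil_Integration.integral_combine int) auto
      then have "integral {c..y} g - integral {c..x} g = integral {x..y} g" by (simp add: algebra_simps)
      moreover have "norm (integral {x..y} g - (y - x) *\<^sub>R g x) \<le> e * (y - x)"
        using d1(2)[of "y - x"] greater y by (intro scale) auto
      ultimately show ?thesis using greater by simp
    next
      case less
      have "integral {c..y} g + integral {y..x} g = integral {c..x} g"
        using less y by (intro Henstock_Kurzweil_Integration.integral_combine int) auto
      then have "integral {c..y} g - integral {c..x} g = - integral {y..x} g" by (simp add: algebra_simps)
      moreover have "norm (integral {y..x} g - (x - y) *\<^sub>R g x) \<le> e * (x - y)"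
      proof (intro scale)
        have "integral {- x..- y} (\<lambda>x. g (- x)) = integral {y..x} g"
          by (rule Henstock_Kurzweil_Integration.integral_reflect_real)
        then show "norm (integral {y..x} g /\<^sub>R (x - y) - g x) < e"
          using d2(2)[of "x - y"] less y by auto
      qed (use less in auto)
      moreover have "- integral {y..x} g - (y - x) *\<^sub>R g x = - (integral {y..x} g - (x - y) *\<^sub>R g x)"
        by (simp add: algebra_simps)
      ultimately have "norm (integral {c..y} g - integral {c..x} g - (y - x) *\<^sub>R g x) \<le> e * (x - y)"
        by (simp only: norm_minus_cancel)
      then show ?thesis using less by simp
    qed simp
    moreover have "min (min d1 d2) (x - c) > 0" using d1 d2 x by simp
    ultimately show "\<exists>d>0. \<forall>y. norm (y - x) < d \<longrightarrow>
        norm (integral {c..y} g - integral {c..x} g - (y - x) *\<^sub>R g x) \<le> e * norm (y - x)" by blast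
  qed
  ultimately show ?thesis using that by blast
qed

text \<open>No base point is fixed and \<open>g\<close> matters only up to null sets, so sums,
  products and conjugates of such pairs can be formed freely. This is the form in which the
  differential equation is stated.\<close>

definition indef :: "real set \<Rightarrow> (real \<Rightarrow> complex) \<Rightarrow> (real \<Rightarrow> complex) \<Rightarrow> bool" where
  "indef I F g \<longleftrightarrow> (\<forall>c d. c \<le> d \<longrightarrow> {c..d} \<subseteq> I \<longrightarrow>
     g absolutely_integrable_on {c..d} \<and> integral {c..d} g = F d - F c)"

lemma indefD:
  assumes "indef I F g" "c \<le> d" "{c..d} \<subseteq> I"
  shows "g absolutely_integrable_on {c..d}" "integral {c..d} g = F d - F c" "(g has_integral (F d - F c)) {c..d}"
  using assms unfolding indef_def
  by (auto simp: has_integral_iff absolutely_integrable_on_def)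

section \<open>Localizing statements that hold almost everywhere, and derivatives of indefinite
  integrals\<close>

lemma AE_lebesgue_on_iff:
  assumes "S \<in> sets lebesgue"
  shows "(AE x in lebesgue_on S. P x) \<longleftrightarrow> (\<exists>N. negligible N \<and> (\<forall>x\<in>S - N. P x))"
proof -
  have "(AE x in lebesgue_on S. P x) \<longleftrightarrow> (AE x in lebesgue. x \<in> S \<longrightarrow> P x)"
    using AE_restrict_space_iff[of S lebesgue P] assms by simp
  also have "\<dots> \<longleftrightarrow> (\<exists>N\<in>null_sets lebesgue. {x. \<not> (x \<in> S \<longrightarrow> P x)} \<subseteq> N)"
    by (simp add: eventually_ae_filter)
  also have "\<dots> \<longleftrightarrow> (\<exists>N. negligible N \<and> (\<forall>x\<in>S - N. P x))"
    by (auto simp: negligible_iff_null_sets)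
  finally show ?thesis .
qed

text \<open>Rational endpoints leave only countably many intervals, so that
  \<open>AE_einterval_localI\<close> can unite their exceptional null sets.\<close>

lemma einterval_rat_cover:
  assumes "x \<in> einterval a b"
  obtains c d :: rat where "of_rat c < x" "x < of_rat d" "{of_rat c..of_rat d} \<subseteq> einterval a b"
proof -
  obtain e where e: "e > 0" "cball x e \<subseteq> einterval a b"
    using assms open_contains_cball[of "einterval a b"] open_einterval by blast
  obtain c where c: "x - e < of_rat c" "of_rat c < x" using of_rat_dense[of "x - e" x] e(1) by auto
  obtain d where d: "x < of_rat d" "of_rat d < x + e" using of_rat_dense[of x "x + e"] e(1) by auto
  have "{of_rat c..of_rat d} \<subseteq> cball x e" using c d by (auto simp: dist_real_def)
  with that c d e show ?thesis by blast
qed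

lemma AE_einterval_localI:
  assumes "\<And>c d. c < d \<Longrightarrow> {c..d} \<subseteq> einterval a b \<Longrightarrow> \<exists>N. negligible N \<and> (\<forall>x\<in>{c<..<d} - N. P x)"
  shows "AE x in lebesgue_on (einterval a b). P x"
proof -
  have "\<exists>N. negligible N \<and> (of_rat c < (of_rat d :: real) \<longrightarrow> {of_rat c..of_rat d} \<subseteq> einterval a b \<longrightarrow> (\<forall>x\<in>{of_rat c<..<of_rat d} - N. P x))" for c d
    using assms[of "of_rat c" "of_rat d"] negligible_empty by blast
  then obtain N where N: "\<And>c d. negligible (N c d)"
    "\<And>c d x. of_rat c < (of_rat d :: real) \<Longrightarrow> {of_rat c..of_rat d} \<subseteq> einterval a b \<Longrightarrow> x\<in>{of_rat c<..<of_rat d} - N c d \<Longrightarrow> P x"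
    by metis
  have "negligible (\<Union>(range (\<lambda>(c, d). N c d)))"
    by (rule negligible_countable_Union) (auto simp: N(1))
  moreover have "P x" if "x \<in> einterval a b - \<Union>(range (\<lambda>(c, d). N c d))" for x
  proof -
    have "x \<in> einterval a b" using that by simp
    then obtain c d where cd: "of_rat c < x" "x < of_rat d" "{of_rat c..of_rat d} \<subseteq> einterval a b"
      by (rule einterval_rat_cover)
    show ?thesis by (rule N(2)[of c d]) (use cd that in auto)
  qed
  ultimately show ?thesis by (subst AE_lebesgue_on_iff) auto
qed

lemma indefinite_integral_has_derivative:
  fixes g :: "real \<Rightarrow> complex"
  assumes "g integrable_on {c..d}" "\<And>x. x \<in> {c..d} \<Longrightarrow> integral {c..x} g = F x - F c"
  shows "\<exists>N. negligible N \<and> (\<forall>x\<in>{c<..<d} - N. (F has_vector_derivative g x) (at x))"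
proof -
  \<comment> \<open>Extension by zero makes the integrand integrable on every interval, as
    \<open>lebesgue_differentiation_real\<close> demands.\<close>
  define h where "h t = (if t \<in> {c..d} then g t else 0)" for t
  have "h integrable_on UNIV" using assms(1) integrable_restrict_UNIV[of "{c..d}" g] by (simp add: h_def[abs_def])
  then have "h integrable_on {u..v}" for u v
    using integrable_on_subcbox[of h UNIV u v] by (auto simp: box_real)
  from lebesgue_differentiation_real[OF this] obtain N where N: "negligible N"
    "\<And>x c. x \<notin> N \<Longrightarrow> c < x \<Longrightarrow> ((\<lambda>t. integral {c..t} h) has_vector_derivative h x) (at x)" by blast
  have "(F has_vector_derivative g x) (at x)" if x: "x \<in> {c<..<d} - N" for x
  proof -
    have "((\<lambda>t. F c + integral {c..t} h) has_vector_derivative 0 + h x) (at x)"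
      using x by (intro has_vector_derivative_add has_vector_derivative_const N) auto
    then have "(F has_vector_derivative 0 + h x) (at x)"
    proof (rule has_vector_derivative_transform_within_open)
      show "open {c<..<d}" "x \<in> {c<..<d}" using x by auto
      fix t assume t: "t \<in> {c<..<d}"
      have "integral {c..t} h = integral {c..t} g" by (rule integral_cong) (use t in \<open>auto simp: h_def\<close>)
      then show "F c + integral {c..t} h = F t" using assms(2)[of t] t by auto
    qed
    then show ?thesis using x by (auto simp: h_def)
  qed
  with N(1) show ?thesis by blast
qed

lemma indef_AE_derivative:
  assumes "indef (einterval a b) F g"
  shows "AE x in lebesgue_on (einterval a b). (F has_vector_derivative g x) (at x)"
proof (rule AE_einterval_localI)
  fix c d :: real assume cd: "c < d" "{c..d} \<subseteq> einterval a b"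
  show "\<exists>N. negligible N \<and> (\<forall>x\<in>{c<..<d} - N. (F has_vector_derivative g x) (at x))"
  proof (rule indefinite_integral_has_derivative)
    show "g integrable_on {c..d}" using indefD(1)[OF assms, of c d] cd by (auto simp: absolutely_integrable_on_def)
    show "integral {c..x} g = F x - F c" if "x \<in> {c..d}" for x
      by (rule indefD(2)[OF assms]) (use cd that in auto)
  qed
qed

section \<open>Densities of locally absolutely continuous functions\<close>

lemma ac_pairs_diff:
  assumes "ac_pairs c d f" "ac_pairs c d g"
  shows "ac_pairs c d (\<lambda>x. f x - g x)"
  unfolding ac_pairs_def
proof (intro allI impI)
  fix \<epsilon> :: real assume "\<epsilon> > 0"
  then have e2: "\<epsilon>/2 > 0" by simp
  obtain \<delta>1 where 1: "\<delta>1 > 0"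
    "\<And>D. nonoverlapping D \<and> D \<subseteq> {c..d} \<times> {c..d} \<and> (\<Sum>(u, v)\<in>D. v - u) < \<delta>1 \<Longrightarrow> (\<Sum>(u, v)\<in>D. norm (f v - f u)) < \<epsilon>/2"
    using assms(1) e2 unfolding ac_pairs_def by meson
  obtain \<delta>2 where 2: "\<delta>2 > 0"
    "\<And>D. nonoverlapping D \<and> D \<subseteq> {c..d} \<times> {c..d} \<and> (\<Sum>(u, v)\<in>D. v - u) < \<delta>2 \<Longrightarrow> (\<Sum>(u, v)\<in>D. norm (g v - g u)) < \<epsilon>/2"
    using assms(2) e2 unfolding ac_pairs_def by meson
  have "(\<Sum>(u, v)\<in>D. norm ((f v - g v) - (f u - g u))) < \<epsilon>"
    if "nonoverlapping D \<and> D \<subseteq> {c..d} \<times> {c..d} \<and> (\<Sum>(u, v)\<in>D. v - u) < min \<delta>1 \<delta>2" for D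
  proof -
    have norm_diff_triangle: "norm ((f v - g v) - (f u - g u)) \<le> norm (f v - f u) + norm (g v - g u)" for u v
      using norm_triangle_ineq4[of "f v - f u" "g v - g u"] by (simp add: algebra_simps)
    have "(\<Sum>(u, v)\<in>D. norm ((f v - g v) - (f u - g u))) \<le> (\<Sum>(u, v)\<in>D. norm (f v - f u) + norm (g v - g u))"
      by (intro sum_mono) (auto simp: norm_diff_triangle)
    also have "\<dots> = (\<Sum>(u, v)\<in>D. norm (f v - f u)) + (\<Sum>(u, v)\<in>D. norm (g v - g u))"
      by (simp add: sum.distrib case_prod_unfold)
    finally show ?thesis using 1(2)[of D] 2(2)[of D] that by linarith
  qed
  with 1(1) 2(1) show "\<exists>\<delta>>0. \<forall>D. nonoverlapping D \<and> D \<subseteq> {c..d} \<times> {c..d} \<and> (\<Sum>(u, v)\<in>D. v - u) < \<delta> \<longrightarrow>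
        (\<Sum>(u, v)\<in>D. norm ((f v - g v) - (f u - g u))) < \<epsilon>" by (intro exI[of _ "min \<delta>1 \<delta>2"]) auto
qed

lemma ac_pairs_mono:
  assumes "ac_pairs c d f" "\<And>u v. norm (g v - g u) \<le> norm (f v - f u)"
  shows "ac_pairs c d g"
  unfolding ac_pairs_def
proof (intro allI impI)
  fix \<epsilon> :: real assume "\<epsilon> > 0"
  then obtain \<delta> where \<delta>: "\<delta> > 0"
    "\<And>D. nonoverlapping D \<and> D \<subseteq> {c..d} \<times> {c..d} \<and> (\<Sum>(u, v)\<in>D. v - u) < \<delta> \<Longrightarrow> (\<Sum>(u, v)\<in>D. norm (f v - f u)) < \<epsilon>"
    using assms(1) unfolding ac_pairs_def by meson
  have "(\<Sum>(u, v)\<in>D. norm (g v - g u)) \<le> (\<Sum>(u, v)\<in>D. norm (f v - f u))" for D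
    using assms(2) by (intro sum_mono) auto
  with \<delta> show "\<exists>\<delta>>0. \<forall>D. nonoverlapping D \<and> D \<subseteq> {c..d} \<times> {c..d} \<and> (\<Sum>(u, v)\<in>D. v - u) < \<delta> \<longrightarrow>
        (\<Sum>(u, v)\<in>D. norm (g v - g u)) < \<epsilon>" by (meson le_less_trans)
qed

text \<open>Jordan decomposition: with \<open>V\<close> the variation, \<open>V\<close>,
  \<open>V - Re f\<close> and \<open>V - Im f\<close> are increasing and absolutely continuous, so
  each has a density, and \<open>f\<close> is recovered from their differences.\<close>

lemma ac_bv_indefinite_integral:
  fixes f :: "real \<Rightarrow> complex"
  assumes "c \<le> d" and ac: "ac_pairs c d f"
    and bdd: "\<And>D. nonoverlapping D \<Longrightarrow> D \<subseteq> {c..d} \<times> {c..d} \<Longrightarrow> (\<Sum>(u, v)\<in>D. norm (f v - f u)) \<le> B"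
  obtains g where "g absolutely_integrable_on {c..d}"
    "\<And>x. x \<in> {c..d} \<Longrightarrow> integral {c..x} g = f x - f c"
proof -
  let ?V = "variation f c"
  have V: "?V x + norm (f y - f x) \<le> ?V y" if "c \<le> x" "x \<le> y" "y \<le> d" for x y
    by (rule variation_super[OF bdd that])
  have acV: "ac_pairs c d ?V" by (rule variation_ac[OF bdd ac])
  have "mono_on {c..d} ?V"
    by (rule mono_onI) (use V norm_ge_zero in \<open>fastforce intro: order_trans[rotated]\<close>)
  then obtain v where v: "v absolutely_integrable_on {c..d}" "\<And>x. x \<in> {c..d} \<Longrightarrow> (v has_integral (?V x - ?V c)) {c..x}"
    using mono_ac_indefinite_integral[OF \<open>c \<le> d\<close> _ acV] by blast
  have mono: "mono_on {c..d} (\<lambda>x. ?V x - L (f x))" if "\<And>u v. \<bar>L v - L u\<bar> \<le> norm (v - u)" for L :: "complex \<Rightarrow> real"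
  proof (rule mono_onI)
    fix r s assume "r \<in> {c..d}" "s \<in> {c..d}" "r \<le> s"
    then show "?V r - L (f r) \<le> ?V s - L (f s)" using V[of r s] that[of "f s" "f r"] by auto
  qed
  have acL: "ac_pairs c d (\<lambda>x. ?V x - L (f x))" if "\<And>u v. \<bar>L v - L u\<bar> \<le> norm (v - u)" for L :: "complex \<Rightarrow> real"
    using that by (intro ac_pairs_diff acV ac_pairs_mono[OF ac]) auto
  have Re: "\<bar>Re v - Re u\<bar> \<le> norm (v - u)" and Im: "\<bar>Im v - Im u\<bar> \<le> norm (v - u)" for u v
    by (metis abs_Re_le_cmod minus_complex.simps(1)) (metis abs_Im_le_cmod minus_complex.simps(2))
  obtain r where r: "r absolutely_integrable_on {c..d}"
    "\<And>x. x \<in> {c..d} \<Longrightarrow> (r has_integral ((?V x - Re (f x)) - (?V c - Re (f c)))) {c..x}"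
    using mono_ac_indefinite_integral[OF \<open>c \<le> d\<close> mono[OF Re] acL[OF Re]] by blast
  obtain i where i: "i absolutely_integrable_on {c..d}"
    "\<And>x. x \<in> {c..d} \<Longrightarrow> (i has_integral ((?V x - Im (f x)) - (?V c - Im (f c)))) {c..x}"
    using mono_ac_indefinite_integral[OF \<open>c \<le> d\<close> mono[OF Im] acL[OF Im]] by blast
  define g where "g x = (v x - r x) *\<^sub>R (1::complex) + (v x - i x) *\<^sub>R \<i>" for x
  have "g absolutely_integrable_on {c..d}"
    unfolding g_def using v r i
    by (intro set_integral_add absolutely_integrable_scaleR_right set_integrable_scaleR_left set_integral_diff impI)
  moreover have "integral {c..x} g = f x - f c" if "x \<in> {c..d}" for x
  proof -
    have "(g has_integral ((?V x - ?V c - ((?V x - Re (f x)) - (?V c - Re (f c)))) *\<^sub>R 1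
        + (?V x - ?V c - ((?V x - Im (f x)) - (?V c - Im (f c)))) *\<^sub>R \<i>)) {c..x}"
      unfolding g_def by (intro has_integral_add has_integral_scaleR_left has_integral_diff v r i that)
    then show ?thesis
      by (auto dest!: integral_unique simp: complex_eq_iff)
  qed
  ultimately show ?thesis using that by blast
qed

text \<open>The \<epsilon>-\<delta> condition bounds the variation only on intervals shorter than
  \<delta>. There a density exists and equals the derivative almost everywhere. As the derivative
  does not depend on the piece, \<open>Bolzano\<close> glues the pieces together.\<close>

lemma AC_loc_indef:
  assumes F: "F \<in> AC_loc a b"
  shows "indef (einterval a b) F (\<lambda>x. vector_derivative F (at x))"
  unfolding indef_def
proof (intro allI impI)
  fix c d :: real assume cd: "c \<le> d" "{c..d} \<subseteq> einterval a b"
  let ?g = "\<lambda>x. vector_derivative F (at x)"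
  have ac: "ac_pairs c d F" using F cd by (auto simp: AC_loc_def intro: ac_pairs_of_abs_continuous)
  then obtain \<delta> where \<delta>: "\<delta> > 0"
    "\<And>D. nonoverlapping D \<Longrightarrow> D \<subseteq> {c..d} \<times> {c..d} \<Longrightarrow> (\<Sum>(u, v)\<in>D. v - u) < \<delta> \<Longrightarrow> (\<Sum>(u, v)\<in>D. norm (F v - F u)) < 1"
    unfolding ac_pairs_def by (meson zero_less_one)
  have small: "?g absolutely_integrable_on {u..v} \<and> integral {u..v} ?g = F v - F u"
    if uv: "c \<le> u" "u \<le> v" "v \<le> d" "v - u < \<delta>" for u v
  proof -
    have acu: "ac_pairs u v F" using ac_pairs_subset[OF ac] uv by simp
    have "(\<Sum>(x, y)\<in>D. norm (F y - F x)) \<le> 1" if D: "nonoverlapping D" "D \<subseteq> {u..v} \<times> {u..v}" for D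
    proof -
      have "(\<Sum>(x, y)\<in>D. y - x) < \<delta>" using nonoverlapping_length[OF D uv(2)] uv(4) by simp
      moreover have "D \<subseteq> {c..d} \<times> {c..d}" using D(2) uv by auto
      ultimately show ?thesis using \<delta>(2)[OF D(1)] by simp
    qed
    then obtain g where g: "g absolutely_integrable_on {u..v}" "\<And>x. x \<in> {u..v} \<Longrightarrow> integral {u..x} g = F x - F u"
      using ac_bv_indefinite_integral[OF uv(2) acu] by blast
    have "g integrable_on {u..v}" using g(1) by (auto simp: absolutely_integrable_on_def)
    from indefinite_integral_has_derivative[OF this g(2)] obtain N where N: "negligible N"
      "\<And>x. x\<in>{u<..<v} - N \<Longrightarrow> (F has_vector_derivative g x) (at x)" by blast
    have "negligible (N \<union> {u, v})" using N(1) by simp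
    moreover have eq: "?g x = g x" if "x \<in> {u..v} - (N \<union> {u, v})" for x
      using N(2)[of x] that by (intro vector_derivative_at) auto
    ultimately show ?thesis
      using absolutely_integrable_spike[OF g(1), of "N \<union> {u, v}" ?g] integral_spike[of "N \<union> {u, v}" "{u..v}" ?g g] g(2)[of v] uv by auto
  qed
  let ?P = "\<lambda>u v. c \<le> u \<and> v \<le> d \<longrightarrow> ?g absolutely_integrable_on {u..v} \<and> integral {u..v} ?g = F v - F u"
  have "?P c d"
    using cd(1)
  proof (induction rule: Bolzano[where P = "?P"])
    case (trans x y z)
    show ?case
    proof
      assume "c \<le> x \<and> z \<le> d"
      with trans have *: "?g absolutely_integrable_on {x..y}" "?g absolutely_integrable_on {y..z}"
        "integral {x..y} ?g = F y - F x" "integral {y..z} ?g = F z - F y" by auto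
      then have "?g absolutely_integrable_on {x..z}"
        using absolutely_integrable_Un[OF *(1,2)] trans(3,4) by (simp add: ivl_disj_un_two_touch)
      moreover from this have "integral {x..y} ?g + integral {y..z} ?g = integral {x..z} ?g"
        using trans(3,4) by (intro Henstock_Kurzweil_Integration.integral_combine) (auto simp: absolutely_integrable_on_def)
      ultimately show "?g absolutely_integrable_on {x..z} \<and> integral {x..z} ?g = F z - F x"
        using * by simp
    qed
  next
    case (local x)
    then show ?case using \<delta>(1) small by (intro exI[of _ \<delta>]) auto
  qed
  then show "?g absolutely_integrable_on {c..d} \<and> integral {c..d} ?g = F d - F c" by simp
qed


text \<open>The part of \<open>norm g\<close> above a level \<open>n\<close> has small integral by
  dominated convergence; the remaining part is at most \<open>n\<close>, so its integral is
  controlled by the total length.\<close>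

lemma absolutely_integrable_small:
  fixes g :: "real \<Rightarrow> complex"
  assumes g: "g absolutely_integrable_on {c..d}" and "\<epsilon> > 0"
  obtains \<delta> where "\<delta> > 0"
    "\<And>D. D division_of \<Union>D \<Longrightarrow> \<Union>D \<subseteq> {c..d} \<Longrightarrow> (\<Sum>K\<in>D. measure lborel K) < \<delta> \<Longrightarrow>
        (\<Sum>K\<in>D. integral K (\<lambda>x. norm (g x))) < \<epsilon>"
proof -
  let ?h = "\<lambda>x. norm (g x)"
  let ?t = "\<lambda>n x. max (?h x - real n) 0"
  have h: "?h integrable_on {c..d}" using g by (auto simp: absolutely_integrable_on_def)
  have hn: "?h absolutely_integrable_on {c..d}" using absolutely_integrable_norm[OF g] by (simp add: o_def)
  have ti: "?t n integrable_on {c..d}" for n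
  proof -
    have "(\<lambda>x. ?h x - real n) absolutely_integrable_on {c..d}"
      by (intro set_integral_diff hn) (auto simp: absolutely_integrable_on_const)
    then have "(\<lambda>x. max (?h x - real n) 0) absolutely_integrable_on {c..d}"
      by (intro absolutely_integrable_max_1) (auto simp: absolutely_integrable_on_const)
    then show ?thesis by (auto simp: absolutely_integrable_on_def)
  qed
  have "(\<lambda>n. integral {c..d} (?t n)) \<longlonglongrightarrow> integral {c..d} (\<lambda>x. 0)"
  proof (rule dominated_convergence(2)[OF ti h])
    show "norm (?t n x) \<le> ?h x" for n x by simp
    show "(\<lambda>n. ?t n x) \<longlonglongrightarrow> 0" for x
    proof (rule tendsto_eventually)
      obtain m :: nat where "?h x \<le> real m" using real_arch_simple by blast
      then show "\<forall>\<^sub>F n in sequentially. ?t n x = 0"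
        by (auto simp: eventually_sequentially max_def intro!: exI[of _ m])
    qed
  qed
  then have "\<forall>\<^sub>F n in sequentially. integral {c..d} (?t n) < \<epsilon> / 2"
    using \<open>\<epsilon> > 0\<close> by (intro order_tendstoD(2)) auto
  then obtain n where n: "integral {c..d} (?t n) < \<epsilon> / 2" by (auto simp: eventually_sequentially)
  \<comment> \<open>Chosen so that \<open>real n * \<delta>\<close> is at most half of \<epsilon>;
    adding 1 covers \<open>n = 0\<close>.\<close>
  define \<delta> where "\<delta> = \<epsilon> / 2 / (real n + 1)"
  have \<delta>: "\<delta> > 0" using \<open>\<epsilon> > 0\<close> by (simp add: \<delta>_def)
  have "(\<Sum>K\<in>D. integral K ?h) < \<epsilon>"
    if D: "D division_of \<Union>D" "\<Union>D \<subseteq> {c..d}" "(\<Sum>K\<in>D. measure lborel K) < \<delta>" for D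
  proof -
    have K: "\<exists>u v. K = {u..v} \<and> u \<le> v" if "K \<in> D" for K
      using division_ofD(3,4)[OF D(1) that] by auto
    have sub: "\<phi> integrable_on K" if "K \<in> D" "\<phi> integrable_on {c..d}" for K and \<phi> :: "real \<Rightarrow> real"
      using K[OF that(1)] D(2) that by (auto intro!: integrable_subinterval_real[OF that(2)])
    have tU: "?t n integrable_on \<Union>D"
      using integrable_on_subdivision[OF D(1) ti D(2)] .
    have "(\<Sum>K\<in>D. integral K ?h) \<le> (\<Sum>K\<in>D. integral K (?t n) + real n * measure lborel K)"
    proof (rule sum_mono)
      fix K assume KD: "K \<in> D"
      have cK: "(\<lambda>x. real n) integrable_on K" using K[OF KD] by auto
      have "integral K ?h \<le> integral K (\<lambda>x. ?t n x + real n)"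
        using sub[OF KD h] sub[OF KD ti] cK by (intro integral_le integrable_add) auto
      also have "\<dots> = integral K (?t n) + integral K (\<lambda>x. real n)"
        using sub[OF KD ti] cK by (intro Henstock_Kurzweil_Integration.integral_add)
      also have "integral K (\<lambda>x. real n) = real n * measure lborel K"
        using K[OF KD] by auto
      finally show "integral K ?h \<le> integral K (?t n) + real n * measure lborel K" .
    qed
    also have "\<dots> = integral (\<Union>D) (?t n) + real n * (\<Sum>K\<in>D. measure lborel K)"
      using integral_combine_division_topdown[OF tU D(1)] by (simp add: sum.distrib sum_distrib_left)
    also have "integral (\<Union>D) (?t n) \<le> integral {c..d} (?t n)"
      by (rule integral_subset_le[OF D(2) tU ti]) auto
    also have "real n * (\<Sum>K\<in>D. measure lborel K) \<le> real n * \<delta>"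
      using D(3) by (intro mult_left_mono) auto
    also have "real n * \<delta> \<le> \<epsilon> / 2" using \<open>\<epsilon> > 0\<close> by (simp add: \<delta>_def field_simps)
    finally show ?thesis using n by simp
  qed
  with \<delta> that show ?thesis by blast
qed

lemma indef_AC_loc:
  assumes F: "indef (einterval a b) F g"
  shows "F \<in> AC_loc a b"
  unfolding AC_loc_def abs_continuous_on_ivl_def
proof (intro CollectI allI impI)
  fix c d \<epsilon> :: real assume cd: "{c..d} \<subseteq> einterval a b" and "\<epsilon> > 0"
  have "g absolutely_integrable_on {c..d}"
    using indefD(1)[OF F, of c d] cd by (cases "c \<le> d") auto
  from absolutely_integrable_small[OF this \<open>\<epsilon> > 0\<close>] obtain \<delta> where \<delta>: "\<delta> > 0"
    "\<And>D. D division_of \<Union>D \<Longrightarrow> \<Union>D \<subseteq> {c..d} \<Longrightarrow> (\<Sum>K\<in>D. measure lborel K) < \<delta> \<Longrightarrow>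
        (\<Sum>K\<in>D. integral K (\<lambda>x. norm (g x))) < \<epsilon>" by blast
  have "(\<Sum>K\<in>D. norm (F (Sup K) - F (Inf K))) \<le> (\<Sum>K\<in>D. integral K (\<lambda>x. norm (g x)))"
    if D: "D division_of \<Union>D" "\<Union>D \<subseteq> {c..d}" for D
  proof (rule sum_mono)
    fix K assume KD: "K \<in> D"
    then obtain u v where K: "K = {u..v}" "u \<le> v" using division_ofD(3,4)[OF D(1) KD] by auto
    with KD D(2) cd have "{u..v} \<subseteq> einterval a b" by blast
    note * = indefD[OF F K(2) this]
    have "norm (F v - F u) = norm (integral {u..v} g)" using *(2) by simp
    also have "\<dots> \<le> integral {u..v} (\<lambda>x. norm (g x))"
      using *(1) by (intro integral_norm_bound_integral) (auto simp: absolutely_integrable_on_def)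
    finally show "norm (F (Sup K) - F (Inf K)) \<le> integral K (\<lambda>x. norm (g x))" using K by simp
  qed
  with \<delta> show "\<exists>\<delta>>0. \<forall>D. D division_of \<Union>D \<and> \<Union>D \<subseteq> {c..d} \<and> (\<Sum>K\<in>D. measure lborel K) < \<delta> \<longrightarrow>
        (\<Sum>K\<in>D. norm (F (Sup K) - F (Inf K))) < \<epsilon>"
    by (meson le_less_trans)
qed

lemma AC_loc_continuous:
  assumes "F \<in> AC_loc a b"
  shows "continuous_on (einterval a b) F"
proof (rule continuous_at_imp_continuous_on, rule ballI)
  fix x assume "x \<in> einterval a b"
  then obtain c d where cd: "of_rat c < x" "x < of_rat d" "{of_rat c..of_rat d} \<subseteq> einterval a b"
    by (rule einterval_rat_cover)
  then have "continuous_on {of_rat c..of_rat d} F"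
    using assms by (auto simp: AC_loc_def intro!: ac_pairs_continuous ac_pairs_of_abs_continuous)
  then show "isCont F x"
    using cd(1,2) continuous_on_interior[of "{of_rat c..of_rat d}" F x] by auto
qed

lemma AC_loc_mult:
  assumes F: "F \<in> AC_loc a b" and G: "G \<in> AC_loc a b"
  shows "(\<lambda>x. F x * G x) \<in> AC_loc a b"
  unfolding AC_loc_def abs_continuous_on_ivl_def
proof (intro CollectI allI impI)
  fix c d \<epsilon> :: real assume cd: "{c..d} \<subseteq> einterval a b" and "\<epsilon> > 0"
  have "bounded (F ` {c..d})" "bounded (G ` {c..d})"
    using cd by (auto intro!: compact_imp_bounded compact_continuous_image continuous_on_subset[OF AC_loc_continuous] F G)
  then obtain A B where "A > 0" "B > 0" and A: "\<And>x. x \<in> {c..d} \<Longrightarrow> norm (F x) \<le> A" and B: "\<And>x. x \<in> {c..d} \<Longrightarrow> norm (G x) \<le> B"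
    by (metis bounded_pos imageI)
  define M where "M = A + B"
  have M: "M > 0" "\<And>x. x \<in> {c..d} \<Longrightarrow> norm (F x) \<le> M" "\<And>x. x \<in> {c..d} \<Longrightarrow> norm (G x) \<le> M"
    using \<open>A > 0\<close> \<open>B > 0\<close> A B by (fastforce simp: M_def)+
  have e: "\<epsilon> / (2 * M) > 0" using \<open>\<epsilon> > 0\<close> M(1) by simp
  obtain \<delta>1 where 1: "\<delta>1 > 0" "\<And>D. D division_of \<Union>D \<and> \<Union>D \<subseteq> {c..d} \<and> (\<Sum>K\<in>D. measure lborel K) < \<delta>1 \<Longrightarrow>
        (\<Sum>K\<in>D. norm (F (Sup K) - F (Inf K))) < \<epsilon> / (2 * M)"
    using F cd e unfolding AC_loc_def abs_continuous_on_ivl_def by blast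
  obtain \<delta>2 where 2: "\<delta>2 > 0" "\<And>D. D division_of \<Union>D \<and> \<Union>D \<subseteq> {c..d} \<and> (\<Sum>K\<in>D. measure lborel K) < \<delta>2 \<Longrightarrow>
        (\<Sum>K\<in>D. norm (G (Sup K) - G (Inf K))) < \<epsilon> / (2 * M)"
    using G cd e unfolding AC_loc_def abs_continuous_on_ivl_def by blast
  have "(\<Sum>K\<in>D. norm (F (Sup K) * G (Sup K) - F (Inf K) * G (Inf K))) < \<epsilon>"
    if D: "D division_of \<Union>D \<and> \<Union>D \<subseteq> {c..d} \<and> (\<Sum>K\<in>D. measure lborel K) < min \<delta>1 \<delta>2" for D
  proof -
    have "(\<Sum>K\<in>D. norm (F (Sup K) * G (Sup K) - F (Inf K) * G (Inf K)))
        \<le> (\<Sum>K\<in>D. M * norm (F (Sup K) - F (Inf K)) + M * norm (G (Sup K) - G (Inf K)))"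
    proof (rule sum_mono)
      fix K assume KD: "K \<in> D"
      then obtain u v where K: "K = {u..v}" "u \<le> v" using division_ofD(3,4)[OF conjunct1[OF D] KD] by auto
      with KD D have uv: "u \<in> {c..d}" "v \<in> {c..d}" by fastforce+
      have "F v * G v - F u * G u = (F v - F u) * G v + F u * (G v - G u)" by (simp add: algebra_simps)
      then have "norm (F v * G v - F u * G u) \<le> norm (F v - F u) * norm (G v) + norm (F u) * norm (G v - G u)"
        by (metis norm_mult norm_triangle_ineq)
      also have "\<dots> \<le> norm (F v - F u) * M + M * norm (G v - G u)"
        using M uv by (intro add_mono mult_left_mono mult_right_mono) auto
      finally show "norm (F (Sup K) * G (Sup K) - F (Inf K) * G (Inf K)) \<le> M * norm (F (Sup K) - F (Inf K)) + M * norm (G (Sup K) - G (Inf K))"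
        using K by (simp add: mult.commute)
    qed
    also have "\<dots> = M * (\<Sum>K\<in>D. norm (F (Sup K) - F (Inf K))) + M * (\<Sum>K\<in>D. norm (G (Sup K) - G (Inf K)))"
      by (simp add: sum.distrib sum_distrib_left)
    also have "\<dots> < M * (\<epsilon> / (2 * M)) + M * (\<epsilon> / (2 * M))"
      using M(1) 1(2)[of D] 2(2)[of D] D by (intro add_strict_mono mult_strict_left_mono) auto
    also have "\<dots> = \<epsilon>" using M(1) by (simp add: field_simps)
    finally show ?thesis .
  qed
  with 1(1) 2(1) show "\<exists>\<delta>>0. \<forall>D. D division_of \<Union>D \<and> \<Union>D \<subseteq> {c..d} \<and> (\<Sum>K\<in>D. measure lborel K) < \<delta> \<longrightarrow>
        (\<Sum>K\<in>D. norm (F (Sup K) * G (Sup K) - F (Inf K) * G (Inf K))) < \<epsilon>"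
    by (intro exI[of _ "min \<delta>1 \<delta>2"]) auto
qed

section \<open>Calculus of indefinite integrals\<close>

lemma indef_cong_AE:
  assumes F: "indef (einterval a b) F g" and ae: "AE x in lebesgue_on (einterval a b). h x = g x"
    and eq: "\<And>x. x \<in> einterval a b \<Longrightarrow> G x = F x"
  shows "indef (einterval a b) G h"
  unfolding indef_def
proof (intro allI impI)
  fix c d assume cd: "c \<le> d" "{c..d} \<subseteq> einterval a b"
  from ae obtain N where N: "negligible N" "\<And>x. x \<in> einterval a b - N \<Longrightarrow> h x = g x"
    by (subst (asm) AE_lebesgue_on_iff) auto
  have N': "h x = g x" if "x \<in> {c..d} - N" for x using that cd N by auto
  show "h absolutely_integrable_on {c..d} \<and> integral {c..d} h = G d - G c"
    using absolutely_integrable_spike[OF indefD(1)[OF F cd] N(1) N'] integral_spike[OF N(1), of "{c..d}" h g] N'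
      indefD(2)[OF F cd] eq[of c] eq[of d] cd by (auto simp: subset_iff)
qed

text \<open>The product is again locally absolutely continuous, hence an indefinite integral of its
  own derivative, which the product rule computes almost everywhere. This is integration by parts
  for densities that are merely integrable.\<close>

lemma indef_mult:
  assumes "indef (einterval a b) F f" "indef (einterval a b) G g"
  shows "indef (einterval a b) (\<lambda>x. F x * G x) (\<lambda>x. F x * g x + f x * G x)"
proof (rule indef_cong_AE)
  show "indef (einterval a b) (\<lambda>x. F x * G x) (\<lambda>x. vector_derivative (\<lambda>x. F x * G x) (at x))"
    by (intro AC_loc_indef AC_loc_mult indef_AC_loc[OF assms(1)] indef_AC_loc[OF assms(2)])
  show "AE x in lebesgue_on (einterval a b). F x * g x + f x * G x = vector_derivative (\<lambda>x. F x * G x) (at x)"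
    using indef_AE_derivative[OF assms(1)] indef_AE_derivative[OF assms(2)]
    by eventually_elim (rule vector_derivative_at[OF has_vector_derivative_mult, symmetric])
qed simp

lemma indef_add:
  assumes F: "indef I F f" and G: "indef I G g"
  shows "indef I (\<lambda>x. F x + G x) (\<lambda>x. f x + g x)"
  unfolding indef_def
proof (intro allI impI conjI)
  fix c d assume cd: "c \<le> d" "{c..d} \<subseteq> I"
  show "(\<lambda>x. f x + g x) absolutely_integrable_on {c..d}"
    by (rule set_integral_add(1)[OF indefD(1)[OF F cd] indefD(1)[OF G cd]])
  show "integral {c..d} (\<lambda>x. f x + g x) = F d + G d - (F c + G c)"
    using integral_unique[OF has_integral_add[OF indefD(3)[OF F cd] indefD(3)[OF G cd]]] by simp
qed

lemma indef_cmult: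
  assumes "indef I F f"
  shows "indef I (\<lambda>x. k * F x) (\<lambda>x. k * f x)"
  using assms unfolding indef_def by (auto simp: right_diff_distrib)

lemma indef_diff:
  assumes "indef I F f" "indef I G g"
  shows "indef I (\<lambda>x. F x - G x) (\<lambda>x. f x - g x)"
  using indef_add[OF assms(1) indef_cmult[OF assms(2), of "-1"]] by simp

lemma indef_cnj:
  assumes "indef I F f"
  shows "indef I (\<lambda>x. cnj (F x)) (\<lambda>x. cnj (f x))"
  unfolding indef_def
proof (intro allI impI)
  fix c d assume cd: "c \<le> d" "{c..d} \<subseteq> I"
  have "cnj \<circ> f absolutely_integrable_on {c..d}"
    by (rule absolutely_integrable_linear[OF indefD(1)[OF assms cd]]) (rule bounded_linear_cnj)
  moreover have "integral {c..d} (cnj \<circ> f) = cnj (integral {c..d} f)"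
    using indefD[OF assms cd] by (intro integral_linear bounded_linear_cnj) auto
  ultimately show "(\<lambda>x. cnj (f x)) absolutely_integrable_on {c..d} \<and> integral {c..d} (\<lambda>x. cnj (f x)) = cnj (F d) - cnj (F c)"
    using indefD(2)[OF assms cd] by (simp add: o_def)
qed

lemma indef_const: "indef I (\<lambda>x. k) (\<lambda>x. 0)"
  by (simp add: indef_def)

subsection \<open>Initial value problems with locally integrable coefficients\<close>

definition loc_integrable :: "real set \<Rightarrow> (real \<Rightarrow> complex) \<Rightarrow> bool" where
  "loc_integrable I \<phi> \<longleftrightarrow> (\<forall>c d. {c..d} \<subseteq> I \<longrightarrow> \<phi> absolutely_integrable_on {c..d})"

lemma loc_integrable_add: "loc_integrable I \<phi> \<Longrightarrow> loc_integrable I \<psi> \<Longrightarrow> loc_integrable I (\<lambda>x. \<phi> x + \<psi> x)"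
  and loc_integrable_diff: "loc_integrable I \<phi> \<Longrightarrow> loc_integrable I \<psi> \<Longrightarrow> loc_integrable I (\<lambda>x. \<phi> x - \<psi> x)"
  by (auto simp: loc_integrable_def set_integral_add set_integral_diff)

lemma loc_integrable_mult_continuous:
  assumes "loc_integrable I \<phi>" "continuous_on I u"
  shows "loc_integrable I (\<lambda>x. \<phi> x * u x)"
  unfolding loc_integrable_def
proof (intro allI impI)
  fix c d assume cd: "{c..d} \<subseteq> I"
  have u: "continuous_on {c..d} u" using assms(2) cd by (rule continuous_on_subset)
  have "(\<lambda>x. u x * \<phi> x) absolutely_integrable_on {c..d}"
  proof (rule absolutely_integrable_bounded_measurable_product[where h = "(*)"])
    show "bilinear ((*) :: complex \<Rightarrow> _)" by (simp add: bilinear_conv_bounded_bilinear bounded_bilinear_mult)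
    show "u \<in> borel_measurable (lebesgue_on {c..d})"
      using u by (intro continuous_imp_measurable_on_sets_lebesgue) auto
    show "bounded (u ` {c..d})" using u by (intro compact_imp_bounded compact_continuous_image) auto
    show "\<phi> absolutely_integrable_on {c..d}" using assms(1) cd by (simp add: loc_integrable_def)
  qed auto
  then show "(\<lambda>x. \<phi> x * u x) absolutely_integrable_on {c..d}" by (simp add: mult.commute)
qed

lemma loc_integrable_of_real:
  assumes "locally_integrable_on_ivl a b f"
  shows "loc_integrable (einterval a b) (\<lambda>x. of_real (f x))"
  unfolding loc_integrable_def
proof (intro allI impI)
  fix c d assume "{c..d} \<subseteq> einterval a b"
  then have "f absolutely_integrable_on {c..d}" using assms by (simp add: locally_integrable_on_ivl_def)
  from absolutely_integrable_linear[OF this bounded_linear_of_real]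
  show "(\<lambda>x. complex_of_real (f x)) absolutely_integrable_on {c..d}" by (simp add: o_def)
qed

lemma indef_continuous: "indef (einterval a b) F g \<Longrightarrow> continuous_on (einterval a b) F"
  by (rule AC_loc_continuous[OF indef_AC_loc])

definition signed_integral :: "real \<Rightarrow> (real \<Rightarrow> complex) \<Rightarrow> real \<Rightarrow> complex" where
  "signed_integral x0 \<phi> x = (if x0 \<le> x then integral {x0..x} \<phi> else - integral {x..x0} \<phi>)"

lemma einterval_ivl_subset: "c \<in> einterval a b \<Longrightarrow> d \<in> einterval a b \<Longrightarrow> {c..d} \<subseteq> einterval a b"
  by (auto simp: einterval_iff) (meson ereal_less_eq(3) less_le_trans le_less_trans)+

lemma signed_integral_indef:
  assumes "loc_integrable (einterval a b) \<phi>" "x0 \<in> einterval a b"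
  shows "indef (einterval a b) (signed_integral x0 \<phi>) \<phi>"
  unfolding indef_def
proof (intro allI impI conjI)
  fix c d assume cd: "c \<le> d" "{c..d} \<subseteq> einterval a b"
  show "\<phi> absolutely_integrable_on {c..d}" using assms cd by (simp add: loc_integrable_def)
  have int: "\<phi> integrable_on {u..v}" if "u \<in> einterval a b" "v \<in> einterval a b" for u v
    using assms(1) einterval_ivl_subset[OF that] by (auto simp: loc_integrable_def absolutely_integrable_on_def)
  have cd': "c \<in> einterval a b" "d \<in> einterval a b" using cd by auto
  show "integral {c..d} \<phi> = signed_integral x0 \<phi> d - signed_integral x0 \<phi> c"
  proof -
    consider "x0 \<le> c" | "c < x0" "x0 \<le> d" | "d < x0" by linarith
    then show ?thesis
    proof cases
      case 1
      then show ?thesis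
        using Henstock_Kurzweil_Integration.integral_combine[of x0 c d \<phi>] int[OF assms(2) cd'(2)] cd(1)
        by (simp add: signed_integral_def algebra_simps)
    next
      case 2
      then show ?thesis
        using Henstock_Kurzweil_Integration.integral_combine[of c x0 d \<phi>] int[OF cd'] cd(1)
        by (simp add: signed_integral_def add.commute)
    next
      case 3
      then show ?thesis
        using Henstock_Kurzweil_Integration.integral_combine[of c d x0 \<phi>] int[OF cd'(1) assms(2)] cd(1)
        by (auto simp: signed_integral_def algebra_simps)
    qed
  qed
qed

lemma signed_integral_self [simp]: "signed_integral x0 \<phi> x0 = 0"
  by (simp add: signed_integral_def)

lemma signed_integral_diff:
  assumes "loc_integrable (einterval a b) \<phi>" "loc_integrable (einterval a b) \<psi>" "x0 \<in> einterval a b" "x \<in> einterval a b"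
  shows "signed_integral x0 (\<lambda>t. \<phi> t - \<psi> t) x = signed_integral x0 \<phi> x - signed_integral x0 \<psi> x"
proof -
  have "\<phi> integrable_on {u..v}" "\<psi> integrable_on {u..v}" if "u \<in> einterval a b" "v \<in> einterval a b" for u v
    using assms(1,2) einterval_ivl_subset[OF that] by (auto simp: loc_integrable_def absolutely_integrable_on_def)
  then show ?thesis using assms by (auto simp: signed_integral_def Henstock_Kurzweil_Integration.integral_diff)
qed

lemma indef_power:
  assumes "indef (einterval a b) N m"
  shows "indef (einterval a b) (\<lambda>x. N x ^ Suc n) (\<lambda>x. of_nat (Suc n) * N x ^ n * m x)"
proof (induction n)
  case 0
  then show ?case using assms by simp
next
  case (Suc n)
  have "indef (einterval a b) (\<lambda>x. N x * N x ^ Suc n) (\<lambda>x. N x * (of_nat (Suc n) * N x ^ n * m x) + m x * N x ^ Suc n)"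
    by (rule indef_mult[OF assms Suc])
  then show ?case by (rule indef_cong_AE) (auto simp: algebra_simps)
qed

text \<open>One step of the factorial bound \<open>\<bar>\<integral> m\<bar>\<^sup>n / n!\<close> for Picard iterates.\<close>

lemma signed_integral_power_bound:
  assumes m: "loc_integrable (einterval a b) (\<lambda>x. of_real (m x))" and m0: "\<And>x. 0 \<le> m x" and x0: "x0 \<in> einterval a b"
    and \<phi>: "loc_integrable (einterval a b) \<phi>"
    and bound: "\<And>t. t \<in> {c..d} \<Longrightarrow> norm (\<phi> t) \<le> m t * (C * norm (signed_integral x0 (\<lambda>x. of_real (m x)) t) ^ n / fact n)"
    and cd: "{c..d} \<subseteq> einterval a b" "x0 \<in> {c..d}" "x \<in> {c..d}" and C: "0 \<le> C"
  shows "norm (signed_integral x0 \<phi> x) \<le> C * norm (signed_integral x0 (\<lambda>x. of_real (m x)) x) ^ Suc n / fact (Suc n)"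
proof -
  define N where "N = signed_integral x0 (\<lambda>x. complex_of_real (m x))"
  have iN: "indef (einterval a b) N (\<lambda>x. of_real (m x))"
    unfolding N_def by (rule signed_integral_indef[OF m x0])
  \<comment> \<open>\<open>N ^ Suc n\<close> has density \<open>Suc n * N ^ n * m\<close>, and the
    factor \<open>C / fact (Suc n)\<close> turns it into the majorant
    \<open>m * C * N ^ n / fact n\<close>, up to the sign of \<open>N\<close>.\<close>
  note iP = indef_cmult[OF indef_power[OF iN, of n], of "of_real (C / fact (Suc n))"]
  have mr: "m integrable_on {u..v}" if "{u..v} \<subseteq> {c..d}" for u v
  proof -
    have "(\<lambda>x. complex_of_real (m x)) absolutely_integrable_on {u..v}"
      using m order_trans[OF that cd(1)] by (simp only: loc_integrable_def)
    from absolutely_integrable_linear[OF this bounded_linear_Re] show ?thesis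
      by (simp add: o_def absolutely_integrable_on_def)
  qed
  have intm: "integral {u..v} (\<lambda>x. complex_of_real (m x)) = of_real (integral {u..v} m)" if "{u..v} \<subseteq> {c..d}" for u v
    using integral_linear[OF mr[OF that] bounded_linear_of_real[where 'a=complex]] by (simp add: o_def)
  have pos: "0 \<le> integral {u..v} m" for u v
    by (cases "m integrable_on {u..v}") (auto intro!: Henstock_Kurzweil_Integration.integral_nonneg m0 simp: not_integrable_integral)
  have \<phi>i: "\<phi> integrable_on {u..v}" if "{u..v} \<subseteq> {c..d}" for u v
    using \<phi> order_trans[OF that cd(1)] by (simp add: loc_integrable_def absolutely_integrable_on_def)
  show ?thesis
  proof (cases "x0 \<le> x")
    case True
    have sub: "{x0..x} \<subseteq> {c..d}" using cd by auto
    have Nt: "N t = of_real (integral {x0..t} m)" if "t \<in> {x0..x}" for t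
      unfolding N_def signed_integral_def using that intm[of x0 t] sub by auto
    have "((\<lambda>t. complex_of_real (C / fact (Suc n)) * (of_nat (Suc n) * N t ^ n * of_real (m t))) has_integral
        (of_real (C / fact (Suc n)) * N x ^ Suc n - of_real (C / fact (Suc n)) * N x0 ^ Suc n)) {x0..x}"
      by (rule indefD(3)[OF iP True]) (use sub cd in auto)
    from has_integral_linear[OF this bounded_linear_Re]
    have hi: "((\<lambda>t. m t * (C * integral {x0..t} m ^ n / fact n)) has_integral (C * integral {x0..x} m ^ Suc n / fact (Suc n))) {x0..x}"
      (is "(?f has_integral _) _")
    proof (rule has_integral_eq_rhs[OF has_integral_eq[rotated]])
      show "(Re \<circ> (\<lambda>t. complex_of_real (C / fact (Suc n)) * (of_nat (Suc n) * N t ^ n * of_real (m t)))) t = m t * (C * integral {x0..t} m ^ n / fact n)" if "t \<in> {x0..x}" for t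
      proof -
        have "complex_of_real (C / fact (Suc n)) * (of_nat (Suc n) * N t ^ n * of_real (m t)) =
          of_real (C / fact (Suc n) * (of_nat (Suc n) * integral {x0..t} m ^ n * m t))"
          unfolding Nt[OF that] by (simp del: of_nat_Suc fact_Suc)
        also have "C / fact (Suc n) * (of_nat (Suc n) * integral {x0..t} m ^ n * m t) = m t * (C * integral {x0..t} m ^ n / fact n)"
          unfolding fact_Suc using of_nat_neq_0[of n, where 'a=real] by (simp add: field_simps del: of_nat_Suc)
        finally show ?thesis by (simp only: o_apply Re_complex_of_real)
      qed
      show "C * integral {x0..x} m ^ Suc n / fact (Suc n) = Re (of_real (C / fact (Suc n)) * N x ^ Suc n - of_real (C / fact (Suc n)) * N x0 ^ Suc n)"
      proof -
        have "of_real (C / fact (Suc n)) * N x ^ Suc n - of_real (C / fact (Suc n)) * N x0 ^ Suc n = of_real (C / fact (Suc n) * integral {x0..x} m ^ Suc n)"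
          using Nt[of x] Nt[of x0] True by simp
        then show ?thesis by (simp only: Re_complex_of_real) simp
      qed
    qed
    have "norm (integral {x0..x} \<phi>) \<le> integral {x0..x} ?f"
    proof (rule integral_norm_bound_integral)
      show "\<phi> integrable_on {x0..x}" by (rule \<phi>i[OF sub])
      show "?f integrable_on {x0..x}" using hi by blast
      show "norm (\<phi> t) \<le> ?f t" if "t \<in> {x0..x}" for t
        using bound[of t] that sub Nt[OF that] pos[of x0 t] by (auto simp: N_def)
    qed
    also have "\<dots> = C * integral {x0..x} m ^ Suc n / fact (Suc n)" using hi by blast
    finally show ?thesis using True Nt[of x] pos[of x0 x] by (simp add: signed_integral_def N_def)
  next
    case False
    have sub: "{x..x0} \<subseteq> {c..d}" using cd by auto
    have Nt: "N t = of_real (- integral {t..x0} m)" if "t \<in> {x..x0}" for t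
      unfolding N_def signed_integral_def using that intm[of t x0] sub by auto
    have "((\<lambda>t. complex_of_real (C / fact (Suc n)) * (of_nat (Suc n) * N t ^ n * of_real (m t))) has_integral
        (of_real (C / fact (Suc n)) * N x0 ^ Suc n - of_real (C / fact (Suc n)) * N x ^ Suc n)) {x..x0}"
      by (rule indefD(3)[OF iP]) (use sub cd False in auto)
    \<comment> \<open>To the left of \<open>x0\<close> the oriented integral \<open>N\<close> is at
      most 0, and \<open>(-1)^n\<close> turns \<open>N ^ n\<close> into the power of its
      modulus.\<close>
    from has_integral_linear[OF has_integral_mult_right[OF this, of "(-1)^n"] bounded_linear_Re]
    have hi: "((\<lambda>t. m t * (C * integral {t..x0} m ^ n / fact n)) has_integral (C * integral {x..x0} m ^ Suc n / fact (Suc n))) {x..x0}"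
      (is "(?f has_integral _) _")
    proof (rule has_integral_eq_rhs[OF has_integral_eq[rotated]])
      show "(Re \<circ> (\<lambda>t. (-1)^n * (complex_of_real (C / fact (Suc n)) * (of_nat (Suc n) * N t ^ n * of_real (m t))))) t = m t * (C * integral {t..x0} m ^ n / fact n)" if "t \<in> {x..x0}" for t
      proof -
        have "(-1)^n * (complex_of_real (C / fact (Suc n)) * (of_nat (Suc n) * N t ^ n * of_real (m t))) =
          of_real (C / fact (Suc n) * (of_nat (Suc n) * ((-1)^n * (- integral {t..x0} m) ^ n) * m t))"
          unfolding Nt[OF that] by (simp del: of_nat_Suc fact_Suc)
        also have "(-1)^n * (- integral {t..x0} m) ^ n = integral {t..x0} m ^ n"
          by (simp flip: power_mult_distrib)
        also have "C / fact (Suc n) * (of_nat (Suc n) * integral {t..x0} m ^ n * m t) = m t * (C * integral {t..x0} m ^ n / fact n)"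
          unfolding fact_Suc using of_nat_neq_0[of n, where 'a=real] by (simp add: field_simps del: of_nat_Suc)
        finally show ?thesis by (simp only: o_apply Re_complex_of_real)
      qed
      show "C * integral {x..x0} m ^ Suc n / fact (Suc n) = Re ((-1)^n * (of_real (C / fact (Suc n)) * N x0 ^ Suc n - of_real (C / fact (Suc n)) * N x ^ Suc n))"
      proof -
        have "(-1)^n * (of_real (C / fact (Suc n)) * N x0 ^ Suc n - of_real (C / fact (Suc n)) * N x ^ Suc n) = of_real (C / fact (Suc n) * ((-1) ^ Suc n * (- integral {x..x0} m) ^ Suc n))"
          using Nt[of x] Nt[of x0] False by simp
        also have "(-1) ^ Suc n * (- integral {x..x0} m) ^ Suc n = integral {x..x0} m ^ Suc n"
          by (simp flip: power_mult_distrib)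
        finally show ?thesis by (simp only: Re_complex_of_real) simp
      qed
    qed
    have "norm (integral {x..x0} \<phi>) \<le> integral {x..x0} ?f"
    proof (rule integral_norm_bound_integral)
      show "\<phi> integrable_on {x..x0}" by (rule \<phi>i[OF sub])
      show "?f integrable_on {x..x0}" using hi by blast
      show "norm (\<phi> t) \<le> ?f t" if "t \<in> {x..x0}" for t
        using bound[of t] that sub Nt[OF that] pos[of t x0] by (auto simp: N_def)
    qed
    also have "\<dots> = C * integral {x..x0} m ^ Suc n / fact (Suc n)" using hi by blast
    finally show ?thesis using False Nt[of x] pos[of x x0] by (simp add: signed_integral_def N_def)
  qed
qed

text \<open>Starting from 0 instead of the initial values makes the n-th iterate the plain sum of
  its first n increments; the initial values enter with the first step.\<close>

fun picard :: "real \<Rightarrow> (real \<Rightarrow> complex) \<Rightarrow> (real \<Rightarrow> complex) \<Rightarrow> (real \<Rightarrow> complex) \<Rightarrow> (real \<Rightarrow> complex) \<Rightarrow>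
    (real \<Rightarrow> complex) \<Rightarrow> (real \<Rightarrow> complex) \<Rightarrow> complex \<Rightarrow> complex \<Rightarrow> nat \<Rightarrow> (real \<Rightarrow> complex) \<times> (real \<Rightarrow> complex)" where
  "picard x0 a11 a12 a21 a22 b1 b2 y z 0 = (\<lambda>_. 0, \<lambda>_. 0)"
| "picard x0 a11 a12 a21 a22 b1 b2 y z (Suc n) =
    (let (u, v) = picard x0 a11 a12 a21 a22 b1 b2 y z n in
      (\<lambda>x. y + signed_integral x0 (\<lambda>t. a11 t * u t + a12 t * v t + b1 t) x,
       \<lambda>x. z + signed_integral x0 (\<lambda>t. a21 t * u t + a22 t * v t + b2 t) x))"

text \<open>With coefficients that are merely locally integrable there is no Lipschitz constant. The
  integral \<open>N\<close> of their norms takes the place of the length of the interval: the n-th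
  increment is at most \<open>C * norm (N x) ^ n / fact n\<close>. This is summable however large
  \<open>N\<close> is, so the solution exists on the whole interval at once.\<close>

proposition linear_system_exists:
  assumes x0: "x0 \<in> einterval a b"
    and a: "loc_integrable (einterval a b) a11" "loc_integrable (einterval a b) a12" "loc_integrable (einterval a b) a21" "loc_integrable (einterval a b) a22"
    and b: "loc_integrable (einterval a b) b1" "loc_integrable (einterval a b) b2"
  obtains u v where "indef (einterval a b) u (\<lambda>t. a11 t * u t + a12 t * v t + b1 t)"
    "indef (einterval a b) v (\<lambda>t. a21 t * u t + a22 t * v t + b2 t)" "u x0 = y" "v x0 = z"
proof -
  let ?I = "einterval a b"
  define P where "P = picard x0 a11 a12 a21 a22 b1 b2 y z"
  define U where "U n = fst (P n)" for n
  define V where "V n = snd (P n)" for n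
  define \<phi> where "\<phi> n t = a11 t * U n t + a12 t * V n t + b1 t" for n t
  define \<psi> where "\<psi> n t = a21 t * U n t + a22 t * V n t + b2 t" for n t
  have U0: "U 0 = (\<lambda>_. 0)" and V0: "V 0 = (\<lambda>_. 0)" by (simp_all add: U_def V_def P_def)
  have US: "U (Suc n) x = y + signed_integral x0 (\<phi> n) x" and VS: "V (Suc n) x = z + signed_integral x0 (\<psi> n) x" for n x
    by (simp_all add: U_def V_def P_def case_prod_unfold Let_def \<phi>_def[abs_def] \<psi>_def[abs_def])
  have "continuous_on ?I (U n) \<and> continuous_on ?I (V n) \<and> loc_integrable ?I (\<phi> n) \<and> loc_integrable ?I (\<psi> n)" for n
  proof (induction n)
    case 0
    show ?case using b by (simp add: \<phi>_def[abs_def] \<psi>_def[abs_def] U0 V0)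
  next
    case (Suc n)
    then have "continuous_on ?I (signed_integral x0 (\<phi> n))" "continuous_on ?I (signed_integral x0 (\<psi> n))"
      using x0 by (auto intro!: indef_continuous signed_integral_indef)
    then have c: "continuous_on ?I (U (Suc n))" "continuous_on ?I (V (Suc n))"
      unfolding US[abs_def] VS[abs_def] by (auto intro!: continuous_intros)
    then have "loc_integrable ?I (\<phi> (Suc n))" "loc_integrable ?I (\<psi> (Suc n))"
      unfolding \<phi>_def[abs_def] \<psi>_def[abs_def] by (intro loc_integrable_add loc_integrable_mult_continuous a b c)+
    with c show ?case by simp
  qed
  then have cU: "continuous_on ?I (U n)" and cV: "continuous_on ?I (V n)" and l\<phi>: "loc_integrable ?I (\<phi> n)" and l\<psi>: "loc_integrable ?I (\<psi> n)" for n
    by auto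
  \<comment> \<open>A single majorant for both rows of the matrix, so that both components satisfy
    the same induction.\<close>
  define m where "m t = norm (a11 t) + norm (a12 t) + norm (a21 t) + norm (a22 t)" for t
  have lnorm: "loc_integrable ?I (\<lambda>t. of_real (norm (f t)))" if "loc_integrable ?I f" for f :: "real \<Rightarrow> complex"
    unfolding loc_integrable_def
  proof (intro allI impI)
    fix c d assume "{c..d} \<subseteq> ?I"
    then have "f absolutely_integrable_on {c..d}" using that by (simp add: loc_integrable_def)
    from absolutely_integrable_linear[OF absolutely_integrable_norm[OF this] bounded_linear_of_real]
    show "(\<lambda>t. complex_of_real (norm (f t))) absolutely_integrable_on {c..d}" by (simp add: o_def)
  qed
  have lm: "loc_integrable ?I (\<lambda>t. of_real (m t))"
    unfolding m_def of_real_add by (intro loc_integrable_add lnorm a)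
  have m0: "0 \<le> m t" for t by (simp add: m_def)
  define N where "N = signed_integral x0 (\<lambda>t. complex_of_real (m t))"
  have cN: "continuous_on ?I N" unfolding N_def by (rule indef_continuous[OF signed_integral_indef[OF lm x0]])
  have key: "\<exists>C K. 0 \<le> C \<and> (\<forall>x\<in>{c..d}. \<forall>n. norm (U (Suc n) x - U n x) \<le> C * (K ^ n / fact n) \<and> norm (V (Suc n) x - V n x) \<le> C * (K ^ n / fact n))"
    if cd: "{c..d} \<subseteq> ?I" "x0 \<in> {c..d}" for c d
  proof -
    have "bounded (U 1 ` {c..d})" "bounded (V 1 ` {c..d})" "bounded (N ` {c..d})"
      by (intro compact_imp_bounded compact_continuous_image compact_Icc continuous_on_subset[OF _ cd(1)] cU cV cN)+
    then obtain CU CV K where CU: "\<And>x. x \<in> {c..d} \<Longrightarrow> norm (U 1 x) \<le> CU" and CV: "\<And>x. x \<in> {c..d} \<Longrightarrow> norm (V 1 x) \<le> CV"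
      and K: "\<And>x. x \<in> {c..d} \<Longrightarrow> norm (N x) \<le> K" unfolding bounded_iff by (metis imageI)
    define C where "C = CU + CV"
    have "0 \<le> CU" "0 \<le> CV" using CU[OF cd(2)] CV[OF cd(2)] norm_ge_zero order_trans by blast+
    then have C: "0 \<le> C" "CU \<le> C" "CV \<le> C" by (auto simp: C_def)
    have "\<forall>x\<in>{c..d}. norm (U (Suc n) x - U n x) \<le> C * norm (N x) ^ n / fact n \<and> norm (V (Suc n) x - V n x) \<le> C * norm (N x) ^ n / fact n" for n
    proof (induction n)
      case 0
      then show ?case using order_trans[OF CU C(2)] order_trans[OF CV C(3)] by (simp add: U0 V0)
    next
      case (Suc n)
      show ?case
      proof
        fix x assume x: "x \<in> {c..d}"
        then have xI: "x \<in> ?I" using cd by auto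
        have bd: "norm (p * (U (Suc n) t - U n t) + q * (V (Suc n) t - V n t)) \<le> m t * (C * norm (N t) ^ n / fact n)"
          if t: "t \<in> {c..d}" and pq: "norm p + norm q \<le> m t" for t p q
        proof -
          have "norm (p * (U (Suc n) t - U n t) + q * (V (Suc n) t - V n t)) \<le>
            norm p * norm (U (Suc n) t - U n t) + norm q * norm (V (Suc n) t - V n t)"
            by (metis norm_mult norm_triangle_ineq)
          also have "\<dots> \<le> norm p * (C * norm (N t) ^ n / fact n) + norm q * (C * norm (N t) ^ n / fact n)"
            using Suc t by (intro add_mono mult_left_mono) auto
          also have "\<dots> = (norm p + norm q) * (C * norm (N t) ^ n / fact n)" by (simp only: distrib_right)
          also have "\<dots> \<le> m t * (C * norm (N t) ^ n / fact n)"
            using pq C by (intro mult_right_mono) auto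
          finally show ?thesis .
        qed
        have "norm (signed_integral x0 (\<lambda>t. \<phi> (Suc n) t - \<phi> n t) x) \<le> C * norm (N x) ^ Suc n / fact (Suc n)"
          unfolding N_def
        proof (rule signed_integral_power_bound[OF lm m0 x0 loc_integrable_diff[OF l\<phi> l\<phi>] _ cd x C(1)])
          fix t assume t: "t \<in> {c..d}"
          have "\<phi> (Suc n) t - \<phi> n t = a11 t * (U (Suc n) t - U n t) + a12 t * (V (Suc n) t - V n t)"
            by (simp add: \<phi>_def algebra_simps)
          then show "norm (\<phi> (Suc n) t - \<phi> n t) \<le> m t * (C * norm (signed_integral x0 (\<lambda>t. complex_of_real (m t)) t) ^ n / fact n)"
            using bd[OF t, of "a11 t" "a12 t"] by (simp add: m_def N_def)
        qed
        moreover have "norm (signed_integral x0 (\<lambda>t. \<psi> (Suc n) t - \<psi> n t) x) \<le> C * norm (N x) ^ Suc n / fact (Suc n)"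
          unfolding N_def
        proof (rule signed_integral_power_bound[OF lm m0 x0 loc_integrable_diff[OF l\<psi> l\<psi>] _ cd x C(1)])
          fix t assume t: "t \<in> {c..d}"
          have "\<psi> (Suc n) t - \<psi> n t = a21 t * (U (Suc n) t - U n t) + a22 t * (V (Suc n) t - V n t)"
            by (simp add: \<psi>_def algebra_simps)
          then show "norm (\<psi> (Suc n) t - \<psi> n t) \<le> m t * (C * norm (signed_integral x0 (\<lambda>t. complex_of_real (m t)) t) ^ n / fact n)"
            using bd[OF t, of "a21 t" "a22 t"] by (simp add: m_def N_def)
        qed
        ultimately show "norm (U (Suc (Suc n)) x - U (Suc n) x) \<le> C * norm (N x) ^ Suc n / fact (Suc n) \<and> norm (V (Suc (Suc n)) x - V (Suc n) x) \<le> C * norm (N x) ^ Suc n / fact (Suc n)"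
          using signed_integral_diff[OF l\<phi> l\<phi> x0 xI] signed_integral_diff[OF l\<psi> l\<psi> x0 xI] by (simp add: US VS)
      qed
    qed
    moreover have "C * norm (N x) ^ n / fact n \<le> C * (K ^ n / fact n)" if "x \<in> {c..d}" for x n
      using K[OF that] C(1) by (auto intro!: divide_right_mono mult_left_mono power_mono)
    ultimately show ?thesis using C(1) by (meson order_trans)
  qed
  \<comment> \<open>The bound \<open>B\<close>, uniform in \<open>n\<close>, provides the integrable
    majorant \<open>h\<close> in \<open>pass\<close>.\<close>
  have conv: "\<exists>B. (\<forall>x\<in>{c..d}. \<forall>n. norm (U n x) \<le> B \<and> norm (V n x) \<le> B) \<and>
      (\<forall>x\<in>{c..d}. convergent (\<lambda>n. U n x) \<and> convergent (\<lambda>n. V n x))" if cd: "{c..d} \<subseteq> ?I" "x0 \<in> {c..d}" for c d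
  proof -
    obtain C K where CK: "0 \<le> C" "\<And>x n. x \<in> {c..d} \<Longrightarrow> norm (U (Suc n) x - U n x) \<le> C * (K ^ n / fact n)"
      "\<And>x n. x \<in> {c..d} \<Longrightarrow> norm (V (Suc n) x - V n x) \<le> C * (K ^ n / fact n)" using key[OF cd] by blast
    have sm: "summable (\<lambda>n. C * (K ^ n / fact n))"
      using summable_exp[of K] by (intro summable_mult) (simp add: field_simps)
    have gen: "norm (W n) \<le> (\<Sum>n. C * (K ^ n / fact n)) \<and> convergent W"
      if W0: "W 0 = 0" and W: "\<And>n. norm (W (Suc n) - W n) \<le> C * (K ^ n / fact n)" for W :: "nat \<Rightarrow> complex" and n
    proof -
      have tel: "(\<Sum>i<n. W (Suc i) - W i) = W n" for n using W0 by (simp add: sum_lessThan_telescope)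
      have s: "summable (\<lambda>n. norm (W (Suc n) - W n))" by (rule summable_comparison_test'[OF sm]) (use W in auto)
      have pos: "0 \<le> C * (K ^ n / fact n)" for n using W[of n] norm_ge_zero order_trans by blast
      have "norm (W n) \<le> (\<Sum>i<n. norm (W (Suc i) - W i))" using tel[of n] norm_sum by metis
      also have "\<dots> \<le> (\<Sum>i<n. C * (K ^ i / fact i))" by (intro sum_mono W)
      also have "\<dots> \<le> (\<Sum>n. C * (K ^ n / fact n))" using pos by (intro sum_le_suminf sm) auto
      finally have "norm (W n) \<le> (\<Sum>n. C * (K ^ n / fact n))" .
      moreover have "convergent W"
        using summable_LIMSEQ[OF summable_norm_cancel[OF s]] unfolding tel convergent_def by blast
      ultimately show ?thesis by simp
    qed
    show ?thesis
      by (intro exI[of _ "\<Sum>n. C * (K ^ n / fact n)"]) (use gen[of "\<lambda>n. U n _"] gen[of "\<lambda>n. V n _"] CK U0 V0 in auto)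
  qed
  define u where "u x = lim (\<lambda>n. U n x)" for x
  define v where "v x = lim (\<lambda>n. V n x)" for x
  have lim: "(\<lambda>n. U n x) \<longlonglongrightarrow> u x" "(\<lambda>n. V n x) \<longlonglongrightarrow> v x" if x: "x \<in> ?I" for x
  proof -
    have "{min x x0..max x x0} \<subseteq> ?I" using x x0 by (intro einterval_ivl_subset) (auto simp: min_def max_def)
    from conv[OF this] have "convergent (\<lambda>n. U n x)" "convergent (\<lambda>n. V n x)" by auto
    then show "(\<lambda>n. U n x) \<longlonglongrightarrow> u x" "(\<lambda>n. V n x) \<longlonglongrightarrow> v x" by (simp_all add: u_def v_def convergent_LIMSEQ_iff)
  qed
  define \<phi>' where "\<phi>' t = a11 t * u t + a12 t * v t + b1 t" for t
  define \<psi>' where "\<psi>' t = a21 t * u t + a22 t * v t + b2 t" for t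
  \<comment> \<open>Both rows have the same shape, so passing to the limit under the integral is
    done once, for arbitrary coefficients \<open>p\<close>, \<open>q\<close> and
    \<open>g\<close>.\<close>
  have pass: "loc_integrable ?I w' \<and> (\<forall>x\<in>?I. (\<lambda>n. signed_integral x0 (w n) x) \<longlonglongrightarrow> signed_integral x0 w' x)"
    if w: "\<And>n. loc_integrable ?I (w n)" "\<And>n t. w n t = p t * U n t + q t * V n t + g t" "\<And>t. w' t = p t * u t + q t * v t + g t"
      and pqg: "loc_integrable ?I p" "loc_integrable ?I q" "loc_integrable ?I g" for w w' p q g
  proof -
    have main: "w' absolutely_integrable_on {c..d} \<and> (\<lambda>n. integral {c..d} (w n)) \<longlonglongrightarrow> integral {c..d} w'"
      if cd: "{c..d} \<subseteq> ?I" for c d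
    proof (cases "c \<le> d")
      case True
      with cd have "{min c x0..max d x0} \<subseteq> ?I" using x0 by (intro einterval_ivl_subset) (auto simp: min_def max_def)
      from conv[OF this] True obtain B where B: "\<And>x n. x \<in> {c..d} \<Longrightarrow> norm (U n x) \<le> B \<and> norm (V n x) \<le> B" by fastforce
      define h where "h t = norm (p t) * B + norm (q t) * B + norm (g t)" for t
      have ab: "p absolutely_integrable_on {c..d}" "q absolutely_integrable_on {c..d}" "g absolutely_integrable_on {c..d}"
        using pqg cd by (auto simp: loc_integrable_def)
      then have hi: "h integrable_on {c..d}" unfolding h_def
        by (intro integrable_add integrable_on_mult_left) (auto simp: absolutely_integrable_on_def)
      have bd: "norm (w n t) \<le> h t" if "t \<in> {c..d}" for n t
      proof -
        have "norm (w n t) \<le> norm (p t) * norm (U n t) + norm (q t) * norm (V n t) + norm (g t)"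
          unfolding w(2) by (metis (no_types, opaque_lifting) add_right_mono norm_mult norm_triangle_ineq order_trans)
        also have "\<dots> \<le> h t" unfolding h_def using B[OF that] by (intro add_mono mult_left_mono) auto
        finally show ?thesis .
      qed
      have tI: "t \<in> ?I" if "t \<in> {c..d}" for t using that cd by auto
      have l: "(\<lambda>n. w n t) \<longlonglongrightarrow> w' t" if "t \<in> {c..d}" for t
        unfolding w(2,3) by (intro tendsto_intros lim tI that)
      have i: "w n integrable_on {c..d}" for n using w(1)[of n] cd by (auto simp: loc_integrable_def absolutely_integrable_on_def)
      note dc = dominated_convergence[OF i hi bd l]
      have "norm (w' t) \<le> h t" if "t \<in> {c..d}" for t
        by (rule LIMSEQ_le_const2[OF tendsto_norm[OF l[OF that]]]) (use bd[OF that] in auto)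
      then have "w' absolutely_integrable_on {c..d}"
        using dc(1) hi by (intro absolutely_integrable_integrable_bound) auto
      with dc(2) show ?thesis by simp
    qed auto
    then have "loc_integrable ?I w'" by (simp add: loc_integrable_def)
    moreover have "(\<lambda>n. signed_integral x0 (w n) x) \<longlonglongrightarrow> signed_integral x0 w' x" if "x \<in> ?I" for x
      unfolding signed_integral_def using main einterval_ivl_subset[OF x0 that] einterval_ivl_subset[OF that x0]
      by (auto intro!: tendsto_minus)
    ultimately show ?thesis by blast
  qed
  have p1: "loc_integrable ?I \<phi>'" "\<And>x. x \<in> ?I \<Longrightarrow> (\<lambda>n. signed_integral x0 (\<phi> n) x) \<longlonglongrightarrow> signed_integral x0 \<phi>' x"
    using pass[of \<phi> a11 a12 b1 \<phi>'] l\<phi> a b by (auto simp: \<phi>_def \<phi>'_def)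
  have p2: "loc_integrable ?I \<psi>'" "\<And>x. x \<in> ?I \<Longrightarrow> (\<lambda>n. signed_integral x0 (\<psi> n) x) \<longlonglongrightarrow> signed_integral x0 \<psi>' x"
    using pass[of \<psi> a21 a22 b2 \<psi>'] l\<psi> a b by (auto simp: \<psi>_def \<psi>'_def)
  have u: "u x = y + signed_integral x0 \<phi>' x" if "x \<in> ?I" for x
  proof (rule LIMSEQ_unique)
    show "(\<lambda>n. U (Suc n) x) \<longlonglongrightarrow> u x" by (rule LIMSEQ_Suc[OF lim(1)[OF that]])
    show "(\<lambda>n. U (Suc n) x) \<longlonglongrightarrow> y + signed_integral x0 \<phi>' x" unfolding US by (intro tendsto_intros p1 that)
  qed
  have v: "v x = z + signed_integral x0 \<psi>' x" if "x \<in> ?I" for x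
  proof (rule LIMSEQ_unique)
    show "(\<lambda>n. V (Suc n) x) \<longlonglongrightarrow> v x" by (rule LIMSEQ_Suc[OF lim(2)[OF that]])
    show "(\<lambda>n. V (Suc n) x) \<longlonglongrightarrow> z + signed_integral x0 \<psi>' x" unfolding VS by (intro tendsto_intros p2 that)
  qed
  show ?thesis
  proof (rule that)
    have "indef ?I (\<lambda>x. y + signed_integral x0 \<phi>' x) (\<lambda>x. 0 + \<phi>' x)"
      by (rule indef_add[OF indef_const signed_integral_indef[OF p1(1) x0]])
    then show "indef ?I u (\<lambda>t. a11 t * u t + a12 t * v t + b1 t)"
      by (rule indef_cong_AE) (auto simp: \<phi>'_def u)
    have "indef ?I (\<lambda>x. z + signed_integral x0 \<psi>' x) (\<lambda>x. 0 + \<psi>' x)"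
      by (rule indef_add[OF indef_const signed_integral_indef[OF p2(1) x0]])
    then show "indef ?I v (\<lambda>t. a21 t * u t + a22 t * v t + b2 t)"
      by (rule indef_cong_AE) (auto simp: \<psi>'_def v)
    show "u x0 = y" "v x0 = z" using u[OF x0] v[OF x0] by auto
  qed
qed

subsection \<open>Square integrable functions\<close>

text \<open>Computations are done with functions; \<open>L2_inner_class\<close> and
  \<open>L2_dist_class\<close> carry the results over to classes.\<close>

definition ip :: "'a measure \<Rightarrow> ('a \<Rightarrow> complex) \<Rightarrow> ('a \<Rightarrow> complex) \<Rightarrow> complex" where
  "ip M f g = (LINT x|M. cnj (f x) * g x)"

definition sqn :: "'a measure \<Rightarrow> ('a \<Rightarrow> complex) \<Rightarrow> real" where
  "sqn M f = (LINT x|M. (norm (f x))\<^sup>2)"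

lemma borel_measurable_cnj [measurable]: "cnj \<in> borel_measurable borel"
  by (intro borel_measurable_continuous_onI continuous_intros)

lemma sq_integrableD:
  assumes "f \<in> sq_integrable M"
  shows "f \<in> borel_measurable M" "integrable M (\<lambda>x. (norm (f x))\<^sup>2)"
  using assms by (auto simp: sq_integrable_def)

lemma norm_add_sq_le: "(norm (x + y :: complex))\<^sup>2 \<le> 2 * (norm x)\<^sup>2 + 2 * (norm y)\<^sup>2"
proof -
  have "(norm (x + y))\<^sup>2 \<le> (norm x + norm y)\<^sup>2" by (intro power_mono norm_triangle_ineq) auto
  also have "\<dots> \<le> 2 * (norm x)\<^sup>2 + 2 * (norm y)\<^sup>2"
    using zero_le_power2[of "norm x - norm y"] by (simp add: power2_eq_square algebra_simps)
  finally show ?thesis .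
qed

lemma sq_integrable_add:
  assumes f: "f \<in> sq_integrable M" and g: "g \<in> sq_integrable M"
  shows "(\<lambda>x. f x + g x) \<in> sq_integrable M"
  unfolding sq_integrable_def
proof (intro CollectI conjI)
  note [measurable] = sq_integrableD(1)[OF f] sq_integrableD(1)[OF g]
  show "(\<lambda>x. f x + g x) \<in> borel_measurable M" by measurable
  show "integrable M (\<lambda>x. (norm (f x + g x))\<^sup>2)"
  proof (rule Bochner_Integration.integrable_bound)
    show "integrable M (\<lambda>x. 2 * (norm (f x))\<^sup>2 + 2 * (norm (g x))\<^sup>2)"
      using sq_integrableD(2)[OF f] sq_integrableD(2)[OF g] by auto
  qed (use norm_add_sq_le in auto)
qed

lemma sq_integrable_cmult: "f \<in> sq_integrable M \<Longrightarrow> (\<lambda>x. k * f x) \<in> sq_integrable M"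
  by (auto simp: sq_integrable_def norm_mult power_mult_distrib)

lemma sq_integrable_zero [simp]: "(\<lambda>x. 0) \<in> sq_integrable M"
  by (simp add: sq_integrable_def)

lemma sq_integrable_diff:
  assumes "f \<in> sq_integrable M" "g \<in> sq_integrable M"
  shows "(\<lambda>x. f x - g x) \<in> sq_integrable M"
  using sq_integrable_add[OF assms(1) sq_integrable_cmult[OF assms(2), of "-1"]] by simp

lemma sq_integrable_cnj: "f \<in> sq_integrable M \<Longrightarrow> (\<lambda>x. cnj (f x)) \<in> sq_integrable M"
  unfolding sq_integrable_def by auto measurable

lemma sq_integrable_AE:
  assumes "f \<in> sq_integrable M" "g \<in> borel_measurable M" "AE x in M. g x = f x"
  shows "g \<in> sq_integrable M"
proof -
  note [measurable] = assms(2) sq_integrableD(1)[OF assms(1)]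
  have "integrable M (\<lambda>x. (norm (g x))\<^sup>2) \<longleftrightarrow> integrable M (\<lambda>x. (norm (f x))\<^sup>2)"
    by (rule integrable_cong_AE) (use assms(3) in auto)
  then show ?thesis using assms sq_integrableD(2)[OF assms(1)] by (simp add: sq_integrable_def)
qed

lemma sq_integrable_mult:
  assumes f: "f \<in> sq_integrable M" and g: "g \<in> sq_integrable M"
  shows "integrable M (\<lambda>x. f x * g x)"
proof (rule Bochner_Integration.integrable_bound)
  note [measurable] = sq_integrableD(1)[OF f] sq_integrableD(1)[OF g]
  show "(\<lambda>x. f x * g x) \<in> borel_measurable M" by measurable
  show "integrable M (\<lambda>x. (norm (f x))\<^sup>2 + (norm (g x))\<^sup>2)"
    using sq_integrableD(2)[OF f] sq_integrableD(2)[OF g] by auto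
  have "norm (x * y) \<le> (norm x)\<^sup>2 + (norm y)\<^sup>2" for x y :: complex
  proof -
    have "0 \<le> norm x * norm y" by simp
    then show ?thesis using sum_squares_bound[of "norm x" "norm y"] unfolding norm_mult by linarith
  qed
  then show "AE x in M. norm (f x * g x) \<le> norm ((norm (f x))\<^sup>2 + (norm (g x))\<^sup>2)" by simp
qed

lemma ip_integrable: "f \<in> sq_integrable M \<Longrightarrow> g \<in> sq_integrable M \<Longrightarrow> integrable M (\<lambda>x. cnj (f x) * g x)"
  by (intro sq_integrable_mult sq_integrable_cnj)

lemma ip_add_right:
  assumes "f \<in> sq_integrable M" "g \<in> sq_integrable M" "h \<in> sq_integrable M"
  shows "ip M f (\<lambda>x. g x + h x) = ip M f g + ip M f h"
  unfolding ip_def using ip_integrable[OF assms(1,2)] ip_integrable[OF assms(1,3)]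
  by (simp add: distrib_left)

lemma ip_cmult_right: "ip M f (\<lambda>x. k * g x) = k * ip M f g"
  unfolding ip_def by (subst integral_mult_right_zero[symmetric]) (simp add: mult.left_commute)

lemma ip_diff_right:
  assumes "f \<in> sq_integrable M" "g \<in> sq_integrable M" "h \<in> sq_integrable M"
  shows "ip M f (\<lambda>x. g x - h x) = ip M f g - ip M f h"
  unfolding ip_def using ip_integrable[OF assms(1,2)] ip_integrable[OF assms(1,3)]
  by (simp add: right_diff_distrib)

lemma ip_cnj: "cnj (ip M f g) = ip M g f"
  unfolding ip_def using Bochner_Integration.integral_cnj[of M "\<lambda>x. cnj (f x) * g x"] by (simp add: mult.commute)

lemma ip_diff_left:
  assumes "f \<in> sq_integrable M" "g \<in> sq_integrable M" "h \<in> sq_integrable M"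
  shows "ip M (\<lambda>x. g x - h x) f = ip M g f - ip M h f"
  using ip_diff_right[OF assms] by (metis ip_cnj complex_cnj_diff)

lemma ip_cmult_left: "ip M (\<lambda>x. k * f x) g = cnj k * ip M f g"
  by (metis ip_cnj complex_cnj_mult ip_cmult_right)

lemma ip_self: "ip M f f = of_real (sqn M f)"
  unfolding ip_def sqn_def
  by (subst integral_complex_of_real[symmetric]) (simp add: complex_norm_square mult.commute del: of_real_power integral_complex_of_real)

lemma sqn_nonneg [simp]: "0 \<le> sqn M f"
  by (simp add: sqn_def)

lemma sqn_eq_0:
  assumes "f \<in> sq_integrable M" "sqn M f = 0"
  shows "AE x in M. f x = 0"
  using integral_nonneg_eq_0_iff_AE[OF sq_integrableD(2)[OF assms(1)]] assms(2) by (simp add: sqn_def)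

lemma ip_cong_AE:
  assumes "f \<in> borel_measurable M" "f' \<in> borel_measurable M" "g \<in> borel_measurable M" "g' \<in> borel_measurable M"
    "AE x in M. f' x = f x" "AE x in M. g' x = g x"
  shows "ip M f' g' = ip M f g"
  unfolding ip_def
proof (rule integral_cong_AE)
  note [measurable] = assms(1-4)
  show "(\<lambda>x. cnj (f' x) * g' x) \<in> borel_measurable M" "(\<lambda>x. cnj (f x) * g x) \<in> borel_measurable M"
    by measurable
  show "AE x in M. cnj (f' x) * g' x = cnj (f x) * g x" using assms(5,6) by eventually_elim simp
qed

lemma ip_zero_left: 
  assumes "f \<in> sq_integrable M" "g \<in> sq_integrable M" "AE x in M. f x = 0"
  shows "ip M f g = 0"
proof -
  have "ip M f g = ip M (\<lambda>x. 0) g"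
    by (rule ip_cong_AE) (use assms sq_integrableD in auto)
  then show ?thesis by (simp add: ip_def)
qed

section \<open>Projections, completeness and a density criterion\<close>

lemma ip_projection:
  assumes f: "f \<in> sq_integrable M" and w: "w \<in> sq_integrable M"
  obtains c where "ip M f (\<lambda>x. w x - c * f x) = 0"
proof (cases "sqn M f = 0")
  case True
  then have "ip M f (\<lambda>x. w x - 0 * f x) = 0"
    using ip_zero_left[OF f w sqn_eq_0[OF f]] by simp
  then show ?thesis by (rule that)
next
  case False
  have "ip M f (\<lambda>x. w x - c * f x) = ip M f w - c * ip M f f" for c
    by (simp only: ip_diff_right[OF f w sq_integrable_cmult[OF f]] ip_cmult_right)
  from this[of "ip M f w / ip M f f"] False show ?thesis
    by (intro that[of "ip M f w / ip M f f"]) (simp add: ip_self)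
qed

text \<open>Gram--Schmidt: \<open>g\<close> is first replaced by its part orthogonal to
  \<open>f\<close>. Dependent \<open>f\<close> and \<open>g\<close> are allowed, since
  \<open>ip_projection\<close> also covers vectors of norm 0.\<close>

lemma ip_projection2:
  assumes f: "f \<in> sq_integrable M" and g: "g \<in> sq_integrable M" and w: "w \<in> sq_integrable M"
  obtains c d where "ip M f (\<lambda>x. w x - (c * f x + d * g x)) = 0" "ip M g (\<lambda>x. w x - (c * f x + d * g x)) = 0"
proof -
  obtain \<alpha> where \<alpha>: "ip M f (\<lambda>x. g x - \<alpha> * f x) = 0" using ip_projection[OF f g] .
  let ?e = "\<lambda>x. g x - \<alpha> * f x"
  have e: "?e \<in> sq_integrable M" by (intro sq_integrable_diff sq_integrable_cmult f g)
  obtain \<gamma> where \<gamma>: "ip M f (\<lambda>x. w x - \<gamma> * f x) = 0" using ip_projection[OF f w] .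
  obtain \<delta> where \<delta>: "ip M ?e (\<lambda>x. w x - \<delta> * ?e x) = 0" using ip_projection[OF e w] .
  let ?k = "\<lambda>x. w x - \<gamma> * f x - \<delta> * ?e x"
  have ef: "ip M ?e f = 0" using \<alpha> by (metis ip_cnj complex_cnj_zero)
  have sq: "(\<lambda>x. w x - \<gamma> * f x) \<in> sq_integrable M" "(\<lambda>x. \<delta> * ?e x) \<in> sq_integrable M"
    "(\<lambda>x. \<gamma> * f x) \<in> sq_integrable M" "(\<lambda>x. w x - \<delta> * ?e x) \<in> sq_integrable M"
    using f e w by (auto intro: sq_integrable_diff sq_integrable_cmult)
  have 1: "ip M f ?k = 0"
    using \<alpha> \<gamma> by (simp add: ip_diff_right[OF f sq(1,2)] ip_cmult_right)
  have "ip M ?e (\<lambda>x. w x - \<delta> * ?e x - \<gamma> * f x) = 0"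
    using \<delta> ef by (simp only: ip_diff_right[OF e sq(4,3)] ip_cmult_right) simp
  then have 2: "ip M ?e ?k = 0" by (simp add: algebra_simps)
  have k: "?k \<in> sq_integrable M" by (intro sq_integrable_diff sq)
  have "ip M (\<lambda>x. g x - \<alpha> * f x) ?k = ip M g ?k - cnj \<alpha> * ip M f ?k"
    by (simp only: ip_diff_left[OF k g sq_integrable_cmult[OF f]] ip_cmult_left)
  with 1 2 have "ip M g ?k = 0" by simp
  with 1 show ?thesis
    by (intro that[of "\<gamma> - \<delta> * \<alpha>" \<delta>]) (simp_all add: algebra_simps)
qed

text \<open>The part of each function that is orthogonal to the other gives a dual basis;
  independence makes the two diagonal entries nonzero. The lemma supplies the source term in
  \<open>naimark_patching\<close>.\<close>

lemma ip_moments: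
  assumes f: "f \<in> sq_integrable M" and g: "g \<in> sq_integrable M"
    and ind: "\<And>\<alpha> \<beta>. AE x in M. \<alpha> * f x + \<beta> * g x = 0 \<Longrightarrow> \<alpha> = 0 \<and> \<beta> = 0"
  obtains k where "k \<in> sq_integrable M" "ip M f k = y" "ip M g k = z"
proof -
  obtain c where c: "ip M g (\<lambda>x. f x - c * g x) = 0" using ip_projection[OF g f] .
  obtain d where d: "ip M f (\<lambda>x. g x - d * f x) = 0" using ip_projection[OF f g] .
  let ?e = "\<lambda>x. f x - c * g x" and ?e' = "\<lambda>x. g x - d * f x"
  have e: "?e \<in> sq_integrable M" "?e' \<in> sq_integrable M"
    by (intro sq_integrable_diff sq_integrable_cmult f g)+
  have "ip M f ?e \<noteq> 0"
  proof
    assume "ip M f ?e = 0"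
    with c have "ip M ?e ?e = 0"
      using ip_diff_left[OF e(1) f sq_integrable_cmult[OF g]] by (simp add: ip_cmult_left)
    then have "AE x in M. ?e x = 0" using sqn_eq_0[OF e(1)] by (simp add: ip_self)
    then have "AE x in M. 1 * f x + (- c) * g x = 0" by simp
    then show False using ind by (metis zero_neq_one)
  qed
  moreover have "ip M g ?e' \<noteq> 0"
  proof
    assume "ip M g ?e' = 0"
    with d have "ip M ?e' ?e' = 0"
      using ip_diff_left[OF e(2) g sq_integrable_cmult[OF f]] by (simp add: ip_cmult_left)
    then have "AE x in M. ?e' x = 0" using sqn_eq_0[OF e(2)] by (simp add: ip_self)
    then have "AE x in M. (- d) * f x + 1 * g x = 0" by (simp add: algebra_simps)
    then show False using ind by (metis zero_neq_one)
  qed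
  ultimately show ?thesis
  proof -
    assume nz: "ip M f ?e \<noteq> 0" "ip M g ?e' \<noteq> 0"
    define k where "k x = y / ip M f ?e * ?e x + z / ip M g ?e' * ?e' x" for x
    have sq: "(\<lambda>x. y / ip M f ?e * ?e x) \<in> sq_integrable M" "(\<lambda>x. z / ip M g ?e' * ?e' x) \<in> sq_integrable M"
      by (intro sq_integrable_cmult e)+
    have "k \<in> sq_integrable M" unfolding k_def by (intro sq_integrable_add sq)
    moreover have "ip M f k = y" "ip M g k = z"
      using nz unfolding k_def ip_add_right[OF f sq] ip_add_right[OF g sq] ip_cmult_right c d by simp_all
    ultimately show ?thesis by (rule that)
  qed
qed

lemma sqn_diff_scale:
  assumes e: "e \<in> sq_integrable M" and v: "v \<in> sq_integrable M"
  shows "sqn M (\<lambda>x. e x - c * v x) = sqn M e - 2 * Re (cnj c * ip M v e) + (norm c)\<^sup>2 * sqn M v"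
proof -
  have cv: "(\<lambda>x. c * v x) \<in> sq_integrable M" and d: "(\<lambda>x. e x - c * v x) \<in> sq_integrable M"
    by (intro sq_integrable_diff sq_integrable_cmult e v)+
  have "complex_of_real (sqn M (\<lambda>x. e x - c * v x)) = ip M e e - c * ip M e v - cnj c * ip M v e + cnj c * c * ip M v v"
    unfolding ip_self[symmetric]
    by (simp add: ip_diff_left[OF d e cv] ip_diff_right[OF _ e cv] e cv v ip_cmult_left ip_cmult_right algebra_simps)
  also have "c * ip M e v = cnj (cnj c * ip M v e)" by (simp add: ip_cnj)
  also have "ip M e e - cnj (cnj c * ip M v e) - cnj c * ip M v e + cnj c * c * ip M v v =
     of_real (sqn M e - 2 * Re (cnj c * ip M v e) + (norm c)\<^sup>2 * sqn M v)"
    by (simp add: ip_self complex_eq_iff cmod_power2) (simp add: power2_eq_square algebra_simps)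
  finally show ?thesis by (simp only: of_real_eq_iff)
qed

text \<open>With \<open>d = 0\<close> this is the Cauchy--Schwarz inequality; with \<open>d\<close> the squared distance to a subspace
  it shows that near-minimizers are nearly orthogonal to the subspace.\<close>

lemma ip_bound:
  assumes e: "e \<in> sq_integrable M" and v: "v \<in> sq_integrable M" and d: "\<And>c. d \<le> sqn M (\<lambda>x. e x - c * v x)"
  shows "(norm (ip M v e))\<^sup>2 \<le> sqn M v * (sqn M e - d)"
proof (cases "sqn M v = 0")
  case True
  then show ?thesis using ip_zero_left[OF v e sqn_eq_0[OF v]] by simp
next
  case False
  then have pos: "sqn M v > 0" using sqn_nonneg[of M v] by linarith
  \<comment> \<open>The minimizer of the quadratic in \<open>c\<close> given by
    \<open>sqn_diff_scale\<close>.\<close>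
  let ?c = "ip M v e / of_real (sqn M v)"
  have "d \<le> sqn M e - 2 * Re (cnj ?c * ip M v e) + (norm ?c)\<^sup>2 * sqn M v"
    using d[of ?c] by (simp only: sqn_diff_scale[OF e v])
  also have "cnj ?c * ip M v e = of_real ((norm (ip M v e))\<^sup>2 / sqn M v)"
  proof -
    have "cnj ?c * ip M v e = (ip M v e * cnj (ip M v e)) / of_real (sqn M v)" by simp
    then show ?thesis by (simp only: complex_norm_square[symmetric] of_real_divide)
  qed
  also have "(norm ?c)\<^sup>2 * sqn M v = (norm (ip M v e))\<^sup>2 / sqn M v"
    using pos by (simp add: norm_divide power2_eq_square)
  finally have "d \<le> sqn M e - (norm (ip M v e))\<^sup>2 / sqn M v" by simp
  then show ?thesis using pos by (simp add: field_simps)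
qed

lemma sqn_parallelogram:
  assumes f: "f \<in> sq_integrable M" and g: "g \<in> sq_integrable M"
  shows "sqn M (\<lambda>x. f x - g x) = 2 * sqn M f + 2 * sqn M g - sqn M (\<lambda>x. f x + g x)"
  using sqn_diff_scale[OF f g, of 1] sqn_diff_scale[OF f g, of "-1"] by simp

text \<open>The rate 1/4 leaves room for a weight: the integrals of \<open>2 ^ n * D n\<close> are
  still summable, so the sum \<open>S\<close> is integrable and finite almost everywhere. Each
  increment is then at most \<open>sqrt (S x) * \<rho> ^ n\<close>, which gives pointwise
  convergence, and \<open>S\<close> also dominates the squared distance to the limit.\<close>

lemma riesz_fischer_fast:
  fixes v :: "nat \<Rightarrow> 'a \<Rightarrow> complex"
  assumes v: "\<And>n. v n \<in> sq_integrable M"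
    and fast: "\<And>n. sqn M (\<lambda>x. v (Suc n) x - v n x) \<le> C * (1 / 4) ^ n"
  obtains w where "w \<in> sq_integrable M" "(\<lambda>n. sqn M (\<lambda>x. w x - v n x)) \<longlonglongrightarrow> 0"
proof -
  note [measurable] = sq_integrableD(1)[OF v]
  define D where "D n x = (norm (v (Suc n) x - v n x))\<^sup>2" for n x
  have D0: "0 \<le> D n x" for n x by (simp add: D_def)
  have iD: "integrable M (D n)" for n
    unfolding D_def using sq_integrableD(2)[OF sq_integrable_diff[OF v v]] .
  have ID: "(LINT x|M. 2 ^ n * D n x) \<le> C * (1 / 2) ^ n" for n
  proof -
    have "(LINT x|M. 2 ^ n * D n x) = 2 ^ n * sqn M (\<lambda>x. v (Suc n) x - v n x)"
      by (simp add: D_def sqn_def)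
    also have "\<dots> \<le> 2 ^ n * (C * (1 / 4) ^ n)" using fast by (intro mult_left_mono) auto
    also have "\<dots> = C * (1 / 2) ^ n" by (simp add: power_divide flip: power_mult_distrib) (simp add: field_simps flip: power_mult_distrib)
    finally show ?thesis .
  qed
  have sI: "summable (\<lambda>n. LINT x|M. 2 ^ n * D n x)"
  proof (rule summable_comparison_test')
    show "summable (\<lambda>n. C * (1 / 2 :: real) ^ n)" by (intro summable_mult summable_geometric) simp
    show "norm (LINT x|M. 2 ^ n * D n x) \<le> C * (1 / 2) ^ n" for n
    proof -
      have "0 \<le> (LINT x|M. 2 ^ n * D n x)" by (intro integral_nonneg_AE) (auto simp: D_def)
      then show ?thesis using ID[of n] by (simp only: real_norm_def abs_of_nonneg)
    qed
  qed
  have aeS: "AE x in M. summable (\<lambda>n. 2 ^ n * D n x)"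
  proof -
    have "(\<integral>\<^sup>+x. (\<Sum>n. ennreal (2 ^ n * D n x)) \<partial>M) = (\<Sum>n. \<integral>\<^sup>+x. ennreal (2 ^ n * D n x) \<partial>M)"
      by (rule nn_integral_suminf) (simp add: D_def)
    also have "\<dots> = (\<Sum>n. ennreal (LINT x|M. 2 ^ n * D n x))"
      by (intro suminf_cong nn_integral_eq_integral) (auto intro: iD simp: D0)
    also have "\<dots> \<noteq> \<infinity>"
    proof -
      have "0 \<le> (LINT x|M. 2 ^ n * D n x)" for n by (intro integral_nonneg_AE) (auto simp: D_def)
      then show ?thesis by (subst suminf_ennreal2[OF _ sI]) simp_all
    qed
    finally have "AE x in M. (\<Sum>n. ennreal (2 ^ n * D n x)) \<noteq> \<infinity>"
      by (intro nn_integral_PInf_AE) (simp_all add: D_def)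
    then show ?thesis
      by eventually_elim (rule summable_suminf_not_top, auto simp: D_def)
  qed
  define S where "S x = (\<Sum>n. 2 ^ n * D n x)" for x
  have iS: "integrable M S"
    unfolding S_def
    by (rule integrable_suminf) (use iD aeS sI in \<open>auto simp: D0\<close>)
  define \<rho> where "\<rho> = sqrt (1 / 2)"
  have \<rho>: "0 < \<rho>" "\<rho> < 1" "\<rho>\<^sup>2 = 1 / 2" by (auto simp: \<rho>_def)
  define w where "w x = lim (\<lambda>n. v n x)" for x
  have wm [measurable]: "w \<in> borel_measurable M" unfolding w_def by measurable
  have bound: "AE x in M. \<forall>n. (norm (w x - v n x))\<^sup>2 \<le> (1 / (1 - \<rho>))\<^sup>2 * ((1 / 2) ^ n * S x)"
    using aeS
  proof eventually_elim
    fix x assume sx: "summable (\<lambda>n. 2 ^ n * D n x)"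
    have D0: "0 \<le> 2 ^ n * D n x" for n by (simp add: D_def)
    have S0: "0 \<le> S x" unfolding S_def by (intro suminf_nonneg sx D0)
    have step: "norm (v (Suc n) x - v n x) \<le> sqrt (S x) * \<rho> ^ n" for n
    proof -
      have "2 ^ n * D n x \<le> S x"
        unfolding S_def using sum_le_suminf[OF sx, of "{n}"] D0 by auto
      then have "D n x \<le> S x * (1 / 2) ^ n" by (simp add: power_divide field_simps)
      also have "(1 / 2 :: real) ^ n = (\<rho> ^ n)\<^sup>2" by (metis \<rho>(3) power_mult power_mult mult.commute)
      finally have "sqrt (D n x) \<le> sqrt (S x * (\<rho> ^ n)\<^sup>2)" by (rule real_sqrt_le_mono)
      then show ?thesis using \<rho>(1) by (simp add: D_def real_sqrt_mult)
    qed
    have sg: "summable (\<lambda>k. sqrt (S x) * \<rho> ^ k)" by (intro summable_mult summable_geometric) (use \<rho> in auto)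
    have sn: "summable (\<lambda>k. norm (v (Suc k) x - v k x))"
      by (rule summable_comparison_test'[OF sg]) (use step in auto)
    have tel: "(\<Sum>k<n. v (Suc k) x - v k x) = v n x - v 0 x" for n by (rule sum_lessThan_telescope)
    have "(\<lambda>n. v n x - v 0 x) \<longlonglongrightarrow> (\<Sum>k. v (Suc k) x - v k x)"
      using summable_LIMSEQ[OF summable_norm_cancel[OF sn]] unfolding tel .
    from tendsto_add[OF this tendsto_const[of "v 0 x"]] have "convergent (\<lambda>n. v n x)"
      by (auto simp: convergent_def)
    then have lim: "(\<lambda>n. v n x) \<longlonglongrightarrow> w x" by (simp add: w_def convergent_LIMSEQ_iff)
    show "\<forall>n. (norm (w x - v n x))\<^sup>2 \<le> (1 / (1 - \<rho>))\<^sup>2 * ((1 / 2) ^ n * S x)"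
    proof
      fix n
      have part: "norm (v (n + m) x - v n x) \<le> sqrt (S x) * \<rho> ^ n / (1 - \<rho>)" for m
      proof -
        have "norm (v (n + m) x - v n x) \<le> sqrt (S x) * \<rho> ^ n * (\<Sum>k<m. \<rho> ^ k)"
        proof (induction m)
          case (Suc m)
          have "norm (v (n + Suc m) x - v n x) \<le> norm (v (n + m) x - v n x) + norm (v (Suc (n + m)) x - v (n + m) x)"
            using norm_triangle_ineq[of "v (n + m) x - v n x" "v (Suc (n + m)) x - v (n + m) x"] by simp
          also have "\<dots> \<le> sqrt (S x) * \<rho> ^ n * (\<Sum>k<m. \<rho> ^ k) + sqrt (S x) * \<rho> ^ (n + m)"
            using Suc step[of "n + m"] by linarith
          finally show ?case by (simp add: power_add algebra_simps)
        qed simp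
        also have "(\<Sum>k<m. \<rho> ^ k) \<le> (\<Sum>k. \<rho> ^ k)"
          using \<rho> by (intro sum_le_suminf summable_geometric) auto
        also have "(\<Sum>k. \<rho> ^ k) = 1 / (1 - \<rho>)" using \<rho> by (intro suminf_geometric) auto
        finally show ?thesis using S0 \<rho> by (simp add: mult_left_mono)
      qed
      have "(\<lambda>m. v (n + m) x) \<longlonglongrightarrow> w x"
        using LIMSEQ_ignore_initial_segment[OF lim, of n] by (simp add: add.commute)
      then have "(\<lambda>m. norm (v (n + m) x - v n x)) \<longlonglongrightarrow> norm (w x - v n x)" by (intro tendsto_intros)
      then have "norm (w x - v n x) \<le> sqrt (S x) * \<rho> ^ n / (1 - \<rho>)"
        by (rule LIMSEQ_le_const2) (use part in auto)
      then have "(norm (w x - v n x))\<^sup>2 \<le> (sqrt (S x) * \<rho> ^ n / (1 - \<rho>))\<^sup>2" by (intro power_mono) auto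
      also have "\<dots> = (1 / (1 - \<rho>))\<^sup>2 * ((\<rho>\<^sup>2) ^ n * S x)"
        using S0 by (simp add: power_mult_distrib power_divide flip: power_mult) (simp add: mult.commute)
      finally show "(norm (w x - v n x))\<^sup>2 \<le> (1 / (1 - \<rho>))\<^sup>2 * ((1 / 2) ^ n * S x)" by (simp add: \<rho>(3))
    qed
  qed
  have iw: "integrable M (\<lambda>x. (norm (w x - v n x))\<^sup>2)" for n
  proof (rule Bochner_Integration.integrable_bound)
    show "integrable M (\<lambda>x. (1 / (1 - \<rho>))\<^sup>2 * ((1 / 2) ^ n * S x))" using iS by auto
    show "AE x in M. norm ((norm (w x - v n x))\<^sup>2) \<le> norm ((1 / (1 - \<rho>))\<^sup>2 * ((1 / 2) ^ n * S x))"
      using bound by eventually_elim (auto intro: order_trans[OF _ abs_ge_self])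
  qed measurable
  then have "(\<lambda>x. w x - v 0 x) \<in> sq_integrable M" by (simp add: sq_integrable_def)
  from sq_integrable_add[OF this v[of 0]] have "w \<in> sq_integrable M" by simp
  moreover have "(\<lambda>n. sqn M (\<lambda>x. w x - v n x)) \<longlonglongrightarrow> 0"
  proof (rule tendsto_sandwich[where f = "\<lambda>_. 0"])
    show "\<forall>\<^sub>F n in sequentially. sqn M (\<lambda>x. w x - v n x) \<le> (1 / (1 - \<rho>))\<^sup>2 * ((1 / 2) ^ n * (LINT x|M. S x))"
    proof (rule always_eventually, rule allI)
      fix n
      have "sqn M (\<lambda>x. w x - v n x) \<le> (LINT x|M. (1 / (1 - \<rho>))\<^sup>2 * ((1 / 2) ^ n * S x))"
        unfolding sqn_def using iw iS bound by (intro integral_mono_AE) auto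
      then show "sqn M (\<lambda>x. w x - v n x) \<le> (1 / (1 - \<rho>))\<^sup>2 * ((1 / 2) ^ n * (LINT x|M. S x))" by simp
    qed
    show "(\<lambda>n. (1 / (1 - \<rho>))\<^sup>2 * ((1 / 2) ^ n * (LINT x|M. S x))) \<longlonglongrightarrow> 0"
      using tendsto_mult[OF tendsto_const[of "(1 / (1 - \<rho>))\<^sup>2"]
          tendsto_mult[OF LIMSEQ_realpow_zero[of "1 / 2 :: real"] tendsto_const[of "LINT x|M. S x"]]] by simp
  qed auto
  ultimately show ?thesis by (rule that)
qed

text \<open>By the parallelogram law a minimizing sequence for the distance from \<open>u\<close> to
  \<open>V\<close> converges to some \<open>w\<close>, and \<open>u - w\<close> is orthogonal to
  \<open>V\<close> by minimality. So \<open>u = w\<close> almost everywhere, and \<open>u\<close> is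
  itself a limit of elements of \<open>V\<close>.\<close>

proposition dense_if_orthogonal_trivial:
  assumes V: "V \<subseteq> sq_integrable M" "V \<noteq> {}"
    and lin: "\<And>f g \<alpha> \<beta>. f \<in> V \<Longrightarrow> g \<in> V \<Longrightarrow> (\<lambda>x. \<alpha> * f x + \<beta> * g x) \<in> V"
    and orth: "\<And>u. u \<in> sq_integrable M \<Longrightarrow> (\<And>v. v \<in> V \<Longrightarrow> ip M v u = 0) \<Longrightarrow> AE x in M. u x = 0"
    and u: "u \<in> sq_integrable M" and "0 < \<epsilon>"
  shows "\<exists>v\<in>V. sqn M (\<lambda>x. u x - v x) < \<epsilon>"
proof -
  define d where "d = (INF v\<in>V. sqn M (\<lambda>x. u x - v x))"
  have bb: "bdd_below ((\<lambda>v. sqn M (\<lambda>x. u x - v x)) ` V)" by (rule bdd_belowI[of _ 0]) auto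
  have d: "d \<le> sqn M (\<lambda>x. u x - v x)" if "v \<in> V" for v
    unfolding d_def by (rule cINF_lower[OF bb that])
  have "\<exists>v\<in>V. sqn M (\<lambda>x. u x - v x) < d + (1 / 4) ^ n" for n
  proof -
    have "d < d + (1 / 4) ^ n" by simp
    then show ?thesis unfolding d_def by (subst (asm) (1) cINF_less_iff[OF V(2) bb]) simp
  qed
  then obtain v where v: "\<And>n. v n \<in> V" "\<And>n. sqn M (\<lambda>x. u x - v n x) < d + (1 / 4) ^ n" by metis
  have vs: "v n \<in> sq_integrable M" for n using v(1) V(1) by blast
  \<comment> \<open>The excess over the minimum was chosen as a power of 1/4 to meet
    \<open>riesz_fischer_fast\<close>. Two consecutive excesses, each doubled, give 5/2 times that
    power, which the factor 4 covers.\<close>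
  have "sqn M (\<lambda>x. v (Suc n) x - v n x) \<le> 4 * (1 / 4) ^ n" for n
  proof -
    let ?f = "\<lambda>x. u x - v n x" and ?g = "\<lambda>x. u x - v (Suc n) x"
    have fg: "?f \<in> sq_integrable M" "?g \<in> sq_integrable M" by (intro sq_integrable_diff u vs)+
    \<comment> \<open>The midpoint lies in \<open>V\<close>, so its squared distance from
      \<open>u\<close> is at least \<open>d\<close>; this is what makes consecutive minimizers
      close.\<close>
    let ?m = "\<lambda>x. (1 / 2) * v n x + (1 / 2) * v (Suc n) x"
    have "sqn M (\<lambda>x. ?f x + ?g x) = sqn M (\<lambda>x. 2 * (u x - ?m x))"
      by (simp add: algebra_simps)
    also have "\<dots> = 4 * sqn M (\<lambda>x. u x - ?m x)"
      unfolding sqn_def norm_mult by (simp add: power_mult_distrib)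
    finally have par: "sqn M (\<lambda>x. ?f x + ?g x) = 4 * sqn M (\<lambda>x. u x - ?m x)" .
    have "d \<le> sqn M (\<lambda>x. u x - ?m x)" using d[OF lin[OF v(1) v(1)], of "1/2" n "1/2" "Suc n"] by simp
    note par = par this
    have "4 * d \<le> sqn M (\<lambda>x. ?f x + ?g x)" using par by simp
    then have "sqn M (\<lambda>x. ?f x - ?g x) \<le> 2 * sqn M ?f + 2 * sqn M ?g - 4 * d"
      using sqn_parallelogram[OF fg] by simp
    also have "\<dots> \<le> 2 * (d + (1 / 4) ^ n) + 2 * (d + (1 / 4) ^ Suc n) - 4 * d"
      by (intro diff_right_mono add_mono mult_left_mono less_imp_le v(2)) simp_all
    also have "\<dots> \<le> 4 * (1 / 4) ^ n" by simp
    finally show ?thesis by simp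
  qed
  from riesz_fischer_fast[of v M, OF vs this]
  obtain w where w: "w \<in> sq_integrable M" "(\<lambda>n. sqn M (\<lambda>x. w x - v n x)) \<longlonglongrightarrow> 0" by blast
  have "AE x in M. u x - w x = 0"
  proof (rule orth)
    show uw: "(\<lambda>x. u x - w x) \<in> sq_integrable M" by (intro sq_integrable_diff u w)
    fix z assume z: "z \<in> V"
    then have zs: "z \<in> sq_integrable M" using V(1) by blast
    have small: "f \<longlonglongrightarrow> 0" if "\<And>n. (norm (f n))\<^sup>2 \<le> sqn M z * g n" "g \<longlonglongrightarrow> 0" for f :: "nat \<Rightarrow> complex" and g
    proof -
      have "(\<lambda>n. (norm (f n))\<^sup>2) \<longlonglongrightarrow> 0"
      proof (rule tendsto_sandwich[where f = "\<lambda>_. 0" and h = "\<lambda>n. sqn M z * g n"])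
        show "(\<lambda>n. sqn M z * g n) \<longlonglongrightarrow> 0" using tendsto_mult[OF tendsto_const[of "sqn M z"] that(2)] by simp
      qed (use that(1) in auto)
      from tendsto_real_sqrt[OF this] have "(\<lambda>n. norm (f n)) \<longlonglongrightarrow> 0" by simp
      then show ?thesis by (simp add: tendsto_norm_zero_iff)
    qed
    have uv: "(\<lambda>x. u x - v n x) \<in> sq_integrable M" and wv: "(\<lambda>x. w x - v n x) \<in> sq_integrable M" for n
      by (intro sq_integrable_diff u w vs)+
    have "(\<lambda>n. ip M z (\<lambda>x. u x - v n x)) \<longlonglongrightarrow> 0"
    proof (rule small)
      show "(norm (ip M z (\<lambda>x. u x - v n x)))\<^sup>2 \<le> sqn M z * (1 / 4) ^ n" for n
      proof -
        have "(norm (ip M z (\<lambda>x. u x - v n x)))\<^sup>2 \<le> sqn M z * (sqn M (\<lambda>x. u x - v n x) - d)"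
        proof (rule ip_bound[OF uv zs])
          fix c
          have "d \<le> sqn M (\<lambda>x. u x - (1 * v n x + c * z x))" by (rule d[OF lin[OF v(1) z]])
          then show "d \<le> sqn M (\<lambda>x. u x - v n x - c * z x)" by (simp add: algebra_simps)
        qed
        also have "\<dots> \<le> sqn M z * (1 / 4) ^ n" using v(2)[of n] by (intro mult_left_mono) auto
        finally show ?thesis .
      qed
    qed (simp add: LIMSEQ_realpow_zero)
    moreover have "(\<lambda>n. ip M z (\<lambda>x. w x - v n x)) \<longlonglongrightarrow> 0"
    proof (rule small[OF _ w(2)])
      show "(norm (ip M z (\<lambda>x. w x - v n x)))\<^sup>2 \<le> sqn M z * sqn M (\<lambda>x. w x - v n x)" for n
        using ip_bound[OF wv zs, of 0] by simp
    qed
    ultimately have "(\<lambda>n. ip M z (\<lambda>x. u x - v n x) - ip M z (\<lambda>x. w x - v n x)) \<longlonglongrightarrow> 0 - 0" by (rule tendsto_diff)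
    moreover have "ip M z (\<lambda>x. u x - v n x) - ip M z (\<lambda>x. w x - v n x) = ip M z (\<lambda>x. u x - w x)" for n
      using ip_diff_right[OF zs u vs] ip_diff_right[OF zs w(1) vs] ip_diff_right[OF zs u w(1)] by simp
    ultimately show "ip M z (\<lambda>x. u x - w x) = 0" by (simp add: LIMSEQ_const_iff)
  qed
  then have ae: "AE x in M. u x = w x" by simp
  have "\<forall>\<^sub>F n in sequentially. sqn M (\<lambda>x. w x - v n x) < \<epsilon>"
    using order_tendstoD(2)[OF w(2) \<open>0 < \<epsilon>\<close>] .
  then obtain n where n: "sqn M (\<lambda>x. w x - v n x) < \<epsilon>" by (auto simp: eventually_sequentially)
  have "sqn M (\<lambda>x. u x - v n x) = sqn M (\<lambda>x. w x - v n x)"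
    unfolding sqn_def
  proof (rule integral_cong_AE)
    note [measurable] = sq_integrableD(1)[OF u] sq_integrableD(1)[OF w(1)] sq_integrableD(1)[OF vs]
    show "(\<lambda>x. (norm (u x - v n x))\<^sup>2) \<in> borel_measurable M" "(\<lambda>x. (norm (w x - v n x))\<^sup>2) \<in> borel_measurable M" by measurable
  qed (use ae in auto)
  with n v(1)[of n] show ?thesis by (intro bexI[of _ "v n"]) simp_all
qed

section \<open>From functions to classes\<close>

lemma L2_class_eq_iff:
  assumes "f \<in> borel_measurable M" "g \<in> borel_measurable M"
  shows "L2_class M f = L2_class M g \<longleftrightarrow> (AE x in M. f x = g x)"
proof
  assume "L2_class M f = L2_class M g"
  moreover have "f \<in> L2_class M f" using assms(1) by (simp add: L2_class_def)
  ultimately show "AE x in M. f x = g x" by (simp add: L2_class_def)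
next
  assume ae: "AE x in M. f x = g x"
  have "(AE x in M. h x = f x) \<longleftrightarrow> (AE x in M. h x = g x)" for h
    by (rule eventually_subst) (use ae in eventually_elim, auto)
  then show "L2_class M f = L2_class M g" by (simp add: L2_class_def)
qed

lemma L2_rep_class:
  assumes "f \<in> borel_measurable M"
  shows "L2_rep (L2_class M f) \<in> borel_measurable M" "AE x in M. L2_rep (L2_class M f) x = f x"
proof -
  have "f \<in> L2_class M f" using assms by (simp add: L2_class_def)
  then have "L2_rep (L2_class M f) \<in> L2_class M f" unfolding L2_rep_def using someI[of "\<lambda>g. g \<in> L2_class M f" f] by simp
  then show "L2_rep (L2_class M f) \<in> borel_measurable M" "AE x in M. L2_rep (L2_class M f) x = f x"
    by (simp_all add: L2_class_def)
qed

lemma L2_inner_class: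
  assumes "f \<in> borel_measurable M" "g \<in> borel_measurable M"
  shows "L2_inner M (L2_class M f) (L2_class M g) = ip M f g"
  using ip_cong_AE[OF assms(1) L2_rep_class(1)[OF assms(1)] assms(2) L2_rep_class(1)[OF assms(2)]
      L2_rep_class(2)[OF assms(1)] L2_rep_class(2)[OF assms(2)]]
  by (simp add: L2_inner_def ip_def)

lemma L2_dist_class:
  assumes "f \<in> borel_measurable M" "g \<in> borel_measurable M"
  shows "L2_dist M (L2_class M f) (L2_class M g) = sqrt (sqn M (\<lambda>x. f x - g x))"
proof -
  note [measurable] = assms L2_rep_class(1)[OF assms(1)] L2_rep_class(1)[OF assms(2)]
  have "(LINT x|M. (norm (L2_rep (L2_class M f) x - L2_rep (L2_class M g) x))\<^sup>2) = sqn M (\<lambda>x. f x - g x)"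
    unfolding sqn_def
  proof (rule integral_cong_AE)
    show "AE x in M. (norm (L2_rep (L2_class M f) x - L2_rep (L2_class M g) x))\<^sup>2 = (norm (f x - g x))\<^sup>2"
      using L2_rep_class(2)[OF assms(1)] L2_rep_class(2)[OF assms(2)] by eventually_elim simp
  qed measurable
  then show ?thesis by (simp add: L2_dist_def)
qed

subsection \<open>The differential equation as a system of integral equations\<close>

text \<open>The set where the functions differ is open, and a nonempty open set is not
  negligible.\<close>

lemma continuous_AE_eq:
  fixes f g :: "real \<Rightarrow> complex"
  assumes "continuous_on S f" "continuous_on S g" "open S"
    and N: "negligible N" "\<And>x. x \<in> S - N \<Longrightarrow> f x = g x" and "x \<in> S"
  shows "f x = g x"
proof (rule ccontr)
  assume "f x \<noteq> g x"
  define U where "U = S \<inter> (\<lambda>x. f x - g x) -` (- {0})"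
  have "open U" unfolding U_def
    by (intro continuous_open_preimage continuous_intros assms)
  moreover have "x \<in> U" using \<open>f x \<noteq> g x\<close> \<open>x \<in> S\<close> by (simp add: U_def)
  moreover have "U \<subseteq> N" using N(2) by (auto simp: U_def)
  ultimately show False using N(1) open_not_negligible negligible_subset by blast
qed

lemma loc_integrable_zero [simp]: "loc_integrable I (\<lambda>_. 0)"
  by (simp add: loc_integrable_def)

lemma loc_integrable_uminus: "loc_integrable I \<phi> \<Longrightarrow> loc_integrable I (\<lambda>x. - \<phi> x)"
  using loc_integrable_diff[of I "\<lambda>_. 0" \<phi>] by simp

lemma indef_zero_const:
  assumes "indef (einterval a b) W (\<lambda>_. 0)" "x \<in> einterval a b" "y \<in> einterval a b"
  shows "W x = W y"
proof (cases "x \<le> y")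
  case True
  then show ?thesis using indefD(2)[OF assms(1) _ einterval_ivl_subset[OF assms(2,3)]] by simp
next
  case False
  then show ?thesis using indefD(2)[OF assms(1) _ einterval_ivl_subset[OF assms(3,2)]] by simp
qed

locale sturm_liouville =
  fixes a b :: ereal and p q r s :: "real \<Rightarrow> real"
  assumes ab: "a < b"
    and r_meas: "r \<in> borel_measurable (lebesgue_on (einterval a b))"
    and p_int: "locally_integrable_on_ivl a b (\<lambda>x. 1 / p x)"
    and q_int: "locally_integrable_on_ivl a b q"
    and r_int: "locally_integrable_on_ivl a b r"
    and s_int: "locally_integrable_on_ivl a b s"
    and r_pos: "AE x in lebesgue_on (einterval a b). r x > 0"
    and p_nz: "AE x in lebesgue_on (einterval a b). p x \<noteq> 0"
begin

abbreviation "I \<equiv> einterval a b"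
abbreviation "M \<equiv> weighted_measure a b r"
abbreviation "qd \<equiv> quasi_deriv a b p s"
abbreviation "T \<equiv> tau a b p q r s"
abbreviation "dmax \<equiv> dom_Tmax a b p q r s"

text \<open>\<open>f\<close> is a solution of \<open>\<tau> f = g / r\<close> with quasi-derivative \<open>h\<close>.\<close>

definition quasi_system :: "(real \<Rightarrow> complex) \<Rightarrow> (real \<Rightarrow> complex) \<Rightarrow> (real \<Rightarrow> complex) \<Rightarrow> bool" where
  "quasi_system f h g \<longleftrightarrow> indef I f (\<lambda>x. of_real (1 / p x) * h x - of_real (s x) * f x) \<and>
     indef I h (\<lambda>x. of_real (s x) * h x + of_real (q x) * f x - g x)"

lemma I_lebesgue [simp]: "I \<in> sets lebesgue"
  by (metis borel_einterval lborelD sets_completionI_sets sets_lborel)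

lemma quasi_system_continuous:
  assumes "quasi_system f h g"
  shows "continuous_on I f" "continuous_on I h"
  using assms by (auto simp: quasi_system_def intro: indef_continuous)

text \<open>This pins down the function chosen by \<open>SOME\<close> in \<open>quasi_deriv\<close>,
  but on \<open>I\<close> only; hence the many congruence lemmas restricted to
  \<open>I\<close>.\<close>

lemma is_quasi_deriv_unique:
  assumes "is_quasi_deriv a b p s f h" "is_quasi_deriv a b p s f h'" "x \<in> I"
  shows "h x = h' x"
proof -
  have "AE x in lebesgue_on I. h x = h' x"
    using assms(1,2) unfolding is_quasi_deriv_def by (auto elim: eventually_elim2)
  then obtain N where N: "negligible N" "\<And>x. x \<in> I - N \<Longrightarrow> h x = h' x"
    by (subst (asm) AE_lebesgue_on_iff) auto
  show ?thesis
    by (rule continuous_AE_eq[OF _ _ open_einterval N assms(3)])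
       (use assms(1,2) in \<open>auto simp: is_quasi_deriv_def intro: AC_loc_continuous\<close>)
qed

lemma is_quasi_deriv_qd: "is_quasi_deriv a b p s f h \<Longrightarrow> is_quasi_deriv a b p s f (qd f)"
  unfolding quasi_deriv_def by (rule someI[of "is_quasi_deriv a b p s f"])

lemma D_tau_quasi_system:
  assumes "f \<in> D_tau a b p s"
  shows "quasi_system f (qd f) (\<lambda>x. of_real (r x) * T f x)"
proof -
  have f: "f \<in> AC_loc a b" and qf: "is_quasi_deriv a b p s f (qd f)"
    using assms unfolding D_tau_def by (auto intro: is_quasi_deriv_qd)
  have "indef I f (\<lambda>x. of_real (1 / p x) * qd f x - of_real (s x) * f x)"
  proof (rule indef_cong_AE[OF AC_loc_indef[OF f]])
    show "AE x in lebesgue_on I. of_real (1 / p x) * qd f x - of_real (s x) * f x = vector_derivative f (at x)"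
      using qf p_nz unfolding is_quasi_deriv_def by (auto elim!: eventually_elim2 simp: field_simps)
  qed simp
  moreover have "indef I (qd f) (\<lambda>x. of_real (s x) * qd f x + of_real (q x) * f x - of_real (r x) * T f x)"
  proof (rule indef_cong_AE[OF AC_loc_indef])
    show "qd f \<in> AC_loc a b" using qf by (simp add: is_quasi_deriv_def)
    show "AE x in lebesgue_on I. of_real (s x) * qd f x + of_real (q x) * f x - of_real (r x) * T f x = vector_derivative (qd f) (at x)"
      using r_pos by eventually_elim (simp add: tau_def)
  qed simp
  ultimately show ?thesis by (simp add: quasi_system_def)
qed

text \<open>Any \<open>h\<close> that solves the integral equations may stand for
  \<open>qd f\<close>. Together with \<open>D_tau_quasi_system\<close> this replaces
  \<open>tau\<close>, with its pointwise derivatives, by the system.\<close>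

lemma quasi_system_D_tau:
  assumes "quasi_system f h g"
  shows "f \<in> D_tau a b p s" "\<And>x. x \<in> I \<Longrightarrow> qd f x = h x"
    "AE x in lebesgue_on I. T f x = g x / of_real (r x)"
proof -
  have i: "indef I f (\<lambda>x. of_real (1 / p x) * h x - of_real (s x) * f x)"
    "indef I h (\<lambda>x. of_real (s x) * h x + of_real (q x) * f x - g x)" using assms by (auto simp: quasi_system_def)
  have qf: "is_quasi_deriv a b p s f h"
    unfolding is_quasi_deriv_def
  proof
    show "h \<in> AC_loc a b" by (rule indef_AC_loc[OF i(2)])
    show "AE x in lebesgue_on I. h x = of_real (p x) * (vector_derivative f (at x) + of_real (s x) * f x)"
      using indef_AE_derivative[OF i(1)] p_nz
      by eventually_elim (simp add: vector_derivative_at)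
  qed
  with indef_AC_loc[OF i(1)] show "f \<in> D_tau a b p s" by (auto simp: D_tau_def)
  have "is_quasi_deriv a b p s f (qd f)" by (rule is_quasi_deriv_qd[OF qf])
  then show eq: "qd f x = h x" if "x \<in> I" for x using is_quasi_deriv_unique qf that by blast
  have *: "AE x in lebesgue_on I. x \<in> I"
    using AE_space[of "lebesgue_on I"] by (simp add: space_restrict_space)
  show "AE x in lebesgue_on I. T f x = g x / of_real (r x)"
    using indef_AE_derivative[OF i(2)] r_pos *
  proof eventually_elim
    fix x assume x: "(h has_vector_derivative of_real (s x) * h x + of_real (q x) * f x - g x) (at x)" "0 < r x" "x \<in> I"
    have "(qd f has_vector_derivative of_real (s x) * h x + of_real (q x) * f x - g x) (at x)"
      by (rule has_vector_derivative_transform_within_open[OF x(1) open_einterval x(3)]) (simp add: eq)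
    then have "vector_derivative (qd f) (at x) = of_real (s x) * h x + of_real (q x) * f x - g x"
      by (rule vector_derivative_at)
    then show "T f x = g x / of_real (r x)" using x(3) by (simp add: tau_def eq)
  qed
qed

lemma quasi_system_cong:
  assumes "quasi_system f h g" "\<And>x. x \<in> I \<Longrightarrow> f' x = f x" "\<And>x. x \<in> I \<Longrightarrow> h' x = h x" "AE x in lebesgue_on I. g' x = g x"
  shows "quasi_system f' h' g'"
proof -
  have *: "AE x in lebesgue_on I. x \<in> I"
    using AE_space[of "lebesgue_on I"] by (simp add: space_restrict_space)
  show ?thesis unfolding quasi_system_def
  proof
    show "indef I f' (\<lambda>x. of_real (1 / p x) * h' x - of_real (s x) * f' x)"
      by (rule indef_cong_AE[OF conjunct1[OF assms(1)[unfolded quasi_system_def]] _ assms(2)])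
         (use * in \<open>auto elim!: eventually_mono simp: assms(2,3)\<close>)
    show "indef I h' (\<lambda>x. of_real (s x) * h' x + of_real (q x) * f' x - g' x)"
      by (rule indef_cong_AE[OF conjunct2[OF assms(1)[unfolded quasi_system_def]] _ assms(3)])
         (use * assms(4) in \<open>auto elim!: eventually_elim2 simp: assms(2,3)\<close>)
  qed
qed

lemma quasi_system_add:
  assumes "quasi_system f h g" "quasi_system f' h' g'"
  shows "quasi_system (\<lambda>x. f x + f' x) (\<lambda>x. h x + h' x) (\<lambda>x. g x + g' x)"
  using indef_add[OF conjunct1[OF assms(1)[unfolded quasi_system_def]] conjunct1[OF assms(2)[unfolded quasi_system_def]]]
    indef_add[OF conjunct2[OF assms(1)[unfolded quasi_system_def]] conjunct2[OF assms(2)[unfolded quasi_system_def]]]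
  by (simp add: quasi_system_def algebra_simps add_divide_distrib)

lemma quasi_system_cmult:
  assumes "quasi_system f h g"
  shows "quasi_system (\<lambda>x. k * f x) (\<lambda>x. k * h x) (\<lambda>x. k * g x)"
  using indef_cmult[OF conjunct1[OF assms(1)[unfolded quasi_system_def]], of k]
    indef_cmult[OF conjunct2[OF assms(1)[unfolded quasi_system_def]], of k]
  by (simp add: quasi_system_def algebra_simps)

lemma quasi_system_diff:
  assumes "quasi_system f h g" "quasi_system f' h' g'"
  shows "quasi_system (\<lambda>x. f x - f' x) (\<lambda>x. h x - h' x) (\<lambda>x. g x - g' x)"
  using quasi_system_add[OF assms(1) quasi_system_cmult[OF assms(2), of "-1"]] by simp

lemma quasi_system_cnj:
  assumes "quasi_system f h g"
  shows "quasi_system (\<lambda>x. cnj (f x)) (\<lambda>x. cnj (h x)) (\<lambda>x. cnj (g x))"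
  using indef_cnj[OF conjunct1[OF assms(1)[unfolded quasi_system_def]]]
    indef_cnj[OF conjunct2[OF assms(1)[unfolded quasi_system_def]]]
  by (simp add: quasi_system_def)

text \<open>The terms with \<open>1 / p\<close>, \<open>q\<close> and \<open>s\<close> cancel,
  because the matrix of the system has trace 0; only the sources remain.\<close>

lemma lagrange:
  assumes "quasi_system f h g" "quasi_system f' h' g'"
  shows "indef I (\<lambda>x. f x * h' x - h x * f' x) (\<lambda>x. g x * f' x - f x * g' x)"
proof -
  note i = assms[unfolded quasi_system_def]
  show ?thesis
    by (rule indef_cong_AE[OF indef_diff[OF indef_mult[OF conjunct1[OF i(1)] conjunct2[OF i(2)]]
          indef_mult[OF conjunct2[OF i(1)] conjunct1[OF i(2)]]]])
       (simp_all add: algebra_simps)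
qed

lemma quasi_system_exists:
  assumes "loc_integrable I g" "x0 \<in> I"
  obtains f h where "quasi_system f h g" "f x0 = y" "h x0 = z"
proof -
  obtain f h where fh: "indef I f (\<lambda>t. - of_real (s t) * f t + of_real (1 / p t) * h t + 0)"
    "indef I h (\<lambda>t. of_real (q t) * f t + of_real (s t) * h t + - g t)" "f x0 = y" "h x0 = z"
    by (rule linear_system_exists[OF assms(2) loc_integrable_uminus[OF loc_integrable_of_real[OF s_int]] loc_integrable_of_real[OF p_int]
        loc_integrable_of_real[OF q_int] loc_integrable_of_real[OF s_int] _ loc_integrable_uminus[OF assms(1)], of "\<lambda>_. 0" y z])
       (simp_all add: loc_integrable_def)
  have "quasi_system f h g" using fh(1,2) by (simp add: quasi_system_def algebra_simps)
  with fh(3,4) show ?thesis by (rule that[rotated 1])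
qed

section \<open>Fundamental systems of the homogeneous equation\<close>

definition fundamental :: "(real \<Rightarrow> complex) \<Rightarrow> (real \<Rightarrow> complex) \<Rightarrow> (real \<Rightarrow> complex) \<Rightarrow> (real \<Rightarrow> complex) \<Rightarrow> bool" where
  "fundamental u1 v1 u2 v2 \<longleftrightarrow> quasi_system u1 v1 (\<lambda>_. 0) \<and> quasi_system u2 v2 (\<lambda>_. 0) \<and> (\<forall>x\<in>I. u1 x * v2 x - v1 x * u2 x = 1)"

text \<open>Without sources Lagrange's identity makes the Wronskian constant, so it keeps the value
  1 given by the initial data.\<close>

lemma fundamental_exists: obtains u1 v1 u2 v2 where "fundamental u1 v1 u2 v2"
proof -
  obtain x0 where x0: "x0 \<in> I" using einterval_nonempty[OF ab] by blast
  have l0: "loc_integrable I (\<lambda>_. 0)" by (simp add: loc_integrable_def)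
  obtain u1 v1 where 1: "quasi_system u1 v1 (\<lambda>_. 0)" "u1 x0 = 1" "v1 x0 = 0" by (rule quasi_system_exists[OF l0 x0])
  obtain u2 v2 where 2: "quasi_system u2 v2 (\<lambda>_. 0)" "u2 x0 = 0" "v2 x0 = 1" by (rule quasi_system_exists[OF l0 x0])
  have "indef I (\<lambda>x. u1 x * v2 x - v1 x * u2 x) (\<lambda>x. 0)"
    using lagrange[OF 1(1) 2(1)] by simp
  from indef_zero_const[OF this _ x0] have "\<forall>x\<in>I. u1 x * v2 x - v1 x * u2 x = 1"
    using 1 2 by simp
  with 1 2 show ?thesis by (intro that) (simp add: fundamental_def)
qed

text \<open>Cramer's rule. It takes the place of uniqueness for initial value problems: wherever the
  source vanishes, the Wronskians with \<open>u1\<close> and \<open>u2\<close> are constant, and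
  once both are 0 the solution is 0.\<close>

lemma fundamental_zero:
  assumes "fundamental u1 v1 u2 v2" "x \<in> I" "f * v1 x - h * u1 x = 0" "f * v2 x - h * u2 x = 0"
  shows "f = 0" "h = 0"
proof -
  have w: "u1 x * v2 x - v1 x * u2 x = 1" using assms by (simp add: fundamental_def)
  have "f * (u1 x * v2 x - v1 x * u2 x) = u1 x * (f * v2 x - h * u2 x) - u2 x * (f * v1 x - h * u1 x)"
    by (simp add: algebra_simps)
  then show "f = 0" using assms w by simp
  have "h * (u1 x * v2 x - v1 x * u2 x) = v1 x * (f * v2 x - h * u2 x) - v2 x * (f * v1 x - h * u1 x)"
    by (simp add: algebra_simps)
  then show "h = 0" using assms w by simp
qed

text \<open>If the combination vanishes on an interval, the first equation forces its
  quasi-derivative to vanish at some point where \<open>p\<close> is nonzero, and the Wronskian 1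
  then leaves only trivial coefficients. The conjugates are those of the first argument of
  \<open>ip\<close>.\<close>

lemma fundamental_independent:
  assumes F: "fundamental u1 v1 u2 v2" and cd: "c < d" "{c..d} \<subseteq> I"
    and N: "negligible N" "\<And>x. x \<in> {c<..<d} - N \<Longrightarrow> \<alpha> * cnj (u1 x) + \<beta> * cnj (u2 x) = 0"
  shows "\<alpha> = 0" "\<beta> = 0"
proof -
  define f where "f x = \<alpha> * cnj (u1 x) + \<beta> * cnj (u2 x)" for x
  define h where "h x = \<alpha> * cnj (v1 x) + \<beta> * cnj (v2 x)" for x
  have u: "quasi_system u1 v1 (\<lambda>_. 0)" "quasi_system u2 v2 (\<lambda>_. 0)" using F by (auto simp: fundamental_def)
  have fh: "quasi_system f h (\<lambda>_. 0)"
    using quasi_system_add[OF quasi_system_cmult[OF quasi_system_cnj[OF u(1)], of \<alpha>] quasi_system_cmult[OF quasi_system_cnj[OF u(2)], of \<beta>]]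
    by (simp add: f_def[abs_def] h_def[abs_def])
  have J: "{c<..<d} \<subseteq> I" using cd by auto
  have f0: "f x = 0" if "x \<in> {c<..<d}" for x
    by (rule continuous_AE_eq[OF continuous_on_subset[OF quasi_system_continuous(1)[OF fh] J] continuous_on_const _ N(1) _ that])
       (use N(2) in \<open>auto simp: f_def\<close>)
  have "AE x in lebesgue_on I. (f has_vector_derivative of_real (1 / p x) * h x - of_real (s x) * f x) (at x) \<and> p x \<noteq> 0"
    using indef_AE_derivative[OF conjunct1[OF fh[unfolded quasi_system_def]]] p_nz by eventually_elim auto
  then obtain N' where N': "negligible N'"
    "\<And>x. x \<in> I - N' \<Longrightarrow> (f has_vector_derivative of_real (1 / p x) * h x - of_real (s x) * f x) (at x) \<and> p x \<noteq> 0"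
    by (subst (asm) AE_lebesgue_on_iff) auto
  have "\<not> negligible {c<..<d}" using cd(1) by (intro open_not_negligible) auto
  then obtain x where x: "x \<in> {c<..<d} - N'" using N'(1) negligible_subset by blast
  then have xI: "x \<in> I" using J by auto
  have "((\<lambda>_. 0) has_vector_derivative of_real (1 / p x) * h x - of_real (s x) * f x) (at x)"
    by (rule has_vector_derivative_transform_within_open[of f _ _ "{c<..<d}"]) (use N'(2)[of x] x xI f0 in auto)
  then have "of_real (1 / p x) * h x - of_real (s x) * f x = 0"
    using has_vector_derivative_const vector_derivative_unique_at by blast
  with f0[of x] x xI N'(2)[of x] have "h x = 0" "f x = 0" by auto
  then have "cnj (h x) = 0" "cnj (f x) = 0" by simp_all
  then have e: "cnj \<alpha> * u1 x + cnj \<beta> * u2 x = 0" "cnj \<alpha> * v1 x + cnj \<beta> * v2 x = 0" by (simp_all add: f_def h_def)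
  have w: "u1 x * v2 x - v1 x * u2 x = 1" using F xI by (simp add: fundamental_def)
  have "cnj \<alpha> * (u1 x * v2 x - v1 x * u2 x) = v2 x * (cnj \<alpha> * u1 x + cnj \<beta> * u2 x) - u2 x * (cnj \<alpha> * v1 x + cnj \<beta> * v2 x)"
    by (simp add: algebra_simps)
  with e w show "\<alpha> = 0" by simp
  have "cnj \<beta> * (u1 x * v2 x - v1 x * u2 x) = u1 x * (cnj \<alpha> * v1 x + cnj \<beta> * v2 x) - v1 x * (cnj \<alpha> * u1 x + cnj \<beta> * u2 x)"
    by (simp add: algebra_simps)
  with e w show "\<beta> = 0" by simp
qed

subsection \<open>The weighted measure\<close>

lemma space_M [simp]: "space M = I"
  by (simp add: weighted_measure_def space_restrict_space)

lemma sets_M: "sets M = sets (lebesgue_on I)"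
  by (simp add: weighted_measure_def)

lemma measurable_M: "borel_measurable M = borel_measurable (lebesgue_on I)"
  by (rule measurable_cong_sets[OF sets_M refl])

text \<open>As \<open>r\<close> is positive almost everywhere, the weighted measure and Lebesgue
  measure have the same null sets.\<close>

lemma AE_M: "(AE x in M. P x) \<longleftrightarrow> (AE x in lebesgue_on I. P x)"
  unfolding weighted_measure_def
proof (subst AE_density)
  show "(\<lambda>x. ennreal (r x)) \<in> borel_measurable (lebesgue_on I)" using r_meas by measurable
  show "(AE x in lebesgue_on I. 0 < ennreal (r x) \<longrightarrow> P x) \<longleftrightarrow> (AE x in lebesgue_on I. P x)"
    by (rule eventually_subst) (use r_pos in eventually_elim, simp)
qed

lemma continuous_measurable_M:
  assumes "continuous_on I f"
  shows "f \<in> borel_measurable M"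
  unfolding measurable_M by (rule continuous_imp_measurable_on_sets_lebesgue[OF assms]) simp

lemma integrable_M:
  fixes f :: "real \<Rightarrow> complex"
  assumes "f \<in> borel_measurable M"
  shows "integrable M f \<longleftrightarrow> (\<lambda>x. of_real (r x) * f x) absolutely_integrable_on I"
proof -
  have "integrable M f \<longleftrightarrow> integrable (lebesgue_on I) (\<lambda>x. r x *\<^sub>R f x)"
    unfolding weighted_measure_def
    by (rule integrable_density) (use assms measurable_M r_meas r_pos in \<open>auto elim: eventually_mono\<close>)
  also have "\<dots> \<longleftrightarrow> (\<lambda>x. r x *\<^sub>R f x) absolutely_integrable_on I"
    unfolding set_integrable_def by (rule integrable_restrict_space) simp
  finally show ?thesis by (simp add: scaleR_conv_of_real)
qed

lemma integral_M:
  fixes f :: "real \<Rightarrow> complex"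
  assumes "integrable M f"
  shows "(LINT x|M. f x) = integral I (\<lambda>x. of_real (r x) * f x)"
proof -
  have f: "f \<in> borel_measurable (lebesgue_on I)" using borel_measurable_integrable[OF assms] unfolding measurable_M .
  have "integrable (lebesgue_on I) (\<lambda>x. r x *\<^sub>R f x)"
    using assms unfolding weighted_measure_def
    by (subst (asm) integrable_density) (use f r_meas r_pos in \<open>auto elim: eventually_mono\<close>)
  moreover have "(LINT x|M. f x) = (LINT x|lebesgue_on I. r x *\<^sub>R f x)"
    unfolding weighted_measure_def
    by (rule integral_density) (use f r_meas r_pos in \<open>auto elim: eventually_mono\<close>)
  ultimately show ?thesis
    by (simp add: lebesgue_integral_eq_integral scaleR_conv_of_real)
qed

lemma integral_M_compact:
  fixes f :: "real \<Rightarrow> complex"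
  assumes "integrable M f" "{c..d} \<subseteq> I" "\<And>x. x \<in> I - {c..d} \<Longrightarrow> f x = 0"
  shows "(LINT x|M. f x) = integral {c..d} (\<lambda>x. of_real (r x) * f x)"
proof -
  have "(LINT x|M. f x) = integral I (\<lambda>x. if x \<in> {c..d} then of_real (r x) * f x else 0)"
    unfolding integral_M[OF assms(1)] by (rule integral_cong) (use assms(3) in auto)
  also have "\<dots> = integral {c..d} (\<lambda>x. of_real (r x) * f x)"
  proof -
    have "integral I (\<lambda>x. if x \<in> {c..d} then of_real (r x) * f x else 0) =
        integral UNIV (\<lambda>x. if x \<in> I then if x \<in> {c..d} then of_real (r x) * f x else 0 else 0)"
      by (simp only: integral_restrict_UNIV)
    also have "\<dots> = integral UNIV (\<lambda>x. if x \<in> {c..d} then of_real (r x) * f x else 0)"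
      by (rule integral_cong) (use assms(2) in auto)
    finally show ?thesis by (simp only: integral_restrict_UNIV)
  qed
  finally show ?thesis .
qed

lemma Icc_sets_M: "{c..d} \<subseteq> I \<Longrightarrow> {c..d} \<in> sets M" "{c<..<d} \<subseteq> I \<Longrightarrow> {c<..<d} \<in> sets M"
  by (auto simp: sets_M sets_restrict_space_iff)

lemma integrable_M_indicator:
  assumes "{c..d} \<subseteq> I"
  shows "integrable M (indicator {c..d} :: real \<Rightarrow> real)"
proof -
  have "integrable M (\<lambda>x. complex_of_real (indicator {c..d} x))"
  proof (subst integrable_M)
    have "(\<lambda>x. complex_of_real (r x)) absolutely_integrable_on {c..d}"
      using loc_integrable_of_real[OF r_int] assms by (simp add: loc_integrable_def)
    then have "(\<lambda>x. if x \<in> {c..d} then complex_of_real (r x) else 0) absolutely_integrable_on UNIV"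
      by (subst absolutely_integrable_restrict_UNIV)
    moreover have "(\<lambda>x. if x \<in> {c..d} then complex_of_real (r x) else 0) =
        (\<lambda>x. if x \<in> I then complex_of_real (r x) * complex_of_real (indicator {c..d} x) else 0)"
      using assms by (auto simp: fun_eq_iff split: split_indicator)
    ultimately show "(\<lambda>x. complex_of_real (r x) * complex_of_real (indicator {c..d} x)) absolutely_integrable_on I"
      by (simp only: absolutely_integrable_restrict_UNIV)
  qed (use Icc_sets_M(1)[OF assms] in simp)
  then show ?thesis by (simp only: complex_of_real_integrable_eq)
qed

text \<open>\<open>norm k\<close> is at most \<open>1 + (norm k)^2\<close>, and \<open>r\<close> is
  locally integrable. So the equation \<tau> f = k has an admissible source for every
  \<open>k\<close> in the Hilbert space.\<close>

lemma loc_integrable_sq_integrable: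
  assumes k: "k \<in> sq_integrable M"
  shows "loc_integrable I (\<lambda>x. of_real (r x) * k x)"
  unfolding loc_integrable_def
proof (intro allI impI)
  fix c d assume cd: "{c..d} \<subseteq> I"
  note [measurable] = sq_integrableD(1)[OF k]
  have [measurable]: "{c..d} \<in> sets M" using Icc_sets_M(1)[OF cd] .
  have "integrable M (\<lambda>x. indicator {c..d} x *\<^sub>R k x)"
  proof (rule Bochner_Integration.integrable_bound)
    show "integrable M (\<lambda>x. indicator {c..d} x + (norm (k x))\<^sup>2)"
      using integrable_M_indicator[OF cd] sq_integrableD(2)[OF k] by auto
    have "norm z \<le> 1 + (norm z)\<^sup>2" for z :: complex
    proof -
      have "2 * norm z \<le> (norm z)\<^sup>2 + 1" using sum_squares_bound[of "norm z" 1] by simp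
      moreover have "0 \<le> (norm z)\<^sup>2" "0 \<le> norm z" by simp_all
      ultimately show ?thesis by linarith
    qed
    then show "AE x in M. norm (indicator {c..d} x *\<^sub>R k x) \<le> norm (indicator {c..d} x + (norm (k x))\<^sup>2)"
      by (auto split: split_indicator)
  qed measurable
  then have "(\<lambda>x. of_real (r x) * (indicator {c..d} x *\<^sub>R k x)) absolutely_integrable_on I"
    using integrable_M by (meson borel_measurable_integrable)
  then have "(\<lambda>x. of_real (r x) * (indicator {c..d} x *\<^sub>R k x)) absolutely_integrable_on {c..d}"
    by (rule set_integrable_subset) (use cd in auto)
  then show "(\<lambda>x. of_real (r x) * k x) absolutely_integrable_on {c..d}"
    by (rule set_integrable_cong[THEN iffD1, rotated -1]) auto
qed

end

lemma ip_add_left: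
  assumes "f \<in> sq_integrable M" "g \<in> sq_integrable M" "h \<in> sq_integrable M"
  shows "ip M (\<lambda>x. g x + h x) f = ip M g f + ip M h f"
  using ip_add_right[OF assms] by (metis ip_cnj complex_cnj_add)

text \<open>The function \<open>T f\<close> is known only up to null sets; completeness of Lebesgue
  measure still makes it measurable.\<close>

lemma borel_measurable_lebesgue_on_AE:
  fixes f g :: "real \<Rightarrow> complex"
  assumes S: "S \<in> sets lebesgue" and g: "g \<in> borel_measurable (lebesgue_on S)" and ae: "AE x in lebesgue_on S. f x = g x"
  shows "f \<in> borel_measurable (lebesgue_on S)"
proof -
  have "(\<lambda>x. if x \<in> S then g x else 0) \<in> borel_measurable lebesgue" using g S by (simp add: borel_measurable_if)
  moreover have "AE x in lebesgue. (if x \<in> S then g x else 0) = (if x \<in> S then f x else 0)"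
    using ae S by (subst (asm) AE_restrict_space_iff) (auto elim: eventually_mono)
  ultimately have "(\<lambda>x. if x \<in> S then f x else 0) \<in> borel_measurable lebesgue" by (rule borel_measurable_AE)
  then show ?thesis using S by (simp add: borel_measurable_if)
qed

context sturm_liouville
begin

subsection \<open>The maximal domain\<close>

text \<open>The quasi-derivative and the image are carried along as data. Sums, multiples and
  conjugates of triples are then formed componentwise, which \<open>qd\<close> and \<open>T\<close>
  permit only on \<open>I\<close> or almost everywhere.\<close>

definition max_triple :: "(real \<Rightarrow> complex) \<Rightarrow> (real \<Rightarrow> complex) \<Rightarrow> (real \<Rightarrow> complex) \<Rightarrow> bool" where
  "max_triple f h k \<longleftrightarrow> quasi_system f h (\<lambda>x. of_real (r x) * k x) \<and> f \<in> sq_integrable M \<and> k \<in> sq_integrable M"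

lemma max_tripleD:
  assumes "max_triple f h k"
  shows "quasi_system f h (\<lambda>x. of_real (r x) * k x)" "f \<in> sq_integrable M" "k \<in> sq_integrable M"
  using assms by (auto simp: max_triple_def)

lemma dmax_triple: "f \<in> dmax \<Longrightarrow> max_triple f (qd f) (T f)"
  by (auto simp: dom_Tmax_def max_triple_def D_tau_quasi_system)

lemma triple_dmax:
  assumes "max_triple f h k"
  shows "f \<in> dmax" "\<And>x. x \<in> I \<Longrightarrow> qd f x = h x" "AE x in M. T f x = k x" "T f \<in> sq_integrable M"
proof -
  note E = max_tripleD[OF assms]
  note D = quasi_system_D_tau[OF E(1)]
  show "qd f x = h x" if "x \<in> I" for x by (rule D(2)[OF that])
  have ae: "AE x in lebesgue_on I. T f x = k x"
    using D(3) r_pos by eventually_elim simp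
  then show "AE x in M. T f x = k x" by (simp only: AE_M)
  have "T f \<in> borel_measurable (lebesgue_on I)"
    by (rule borel_measurable_lebesgue_on_AE[OF I_lebesgue _ ae]) (use sq_integrableD(1)[OF E(3)] measurable_M in blast)
  then have "T f \<in> borel_measurable M" unfolding measurable_M .
  then show "T f \<in> sq_integrable M"
    by (rule sq_integrable_AE[OF E(3)]) (use ae AE_M in blast)
  then show "f \<in> dmax" using D(1) E(2) by (simp add: dom_Tmax_def)
qed

lemma triple_add:
  assumes "max_triple f h k" "max_triple f' h' k'"
  shows "max_triple (\<lambda>x. f x + f' x) (\<lambda>x. h x + h' x) (\<lambda>x. k x + k' x)"
  using quasi_system_add[OF max_tripleD(1)[OF assms(1)] max_tripleD(1)[OF assms(2)]] max_tripleD[OF assms(1)] max_tripleD[OF assms(2)]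
  by (simp add: max_triple_def sq_integrable_add distrib_left)

lemma triple_cmult:
  assumes "max_triple f h k"
  shows "max_triple (\<lambda>x. c * f x) (\<lambda>x. c * h x) (\<lambda>x. c * k x)"
  using quasi_system_cmult[OF max_tripleD(1)[OF assms(1)], of c] max_tripleD[OF assms(1)]
  by (simp add: max_triple_def sq_integrable_cmult mult.left_commute)

lemma triple_cnj:
  assumes "max_triple f h k"
  shows "max_triple (\<lambda>x. cnj (f x)) (\<lambda>x. cnj (h x)) (\<lambda>x. cnj (k x))"
  using quasi_system_cnj[OF max_tripleD(1)[OF assms(1)]] max_tripleD[OF assms(1)]
  by (simp add: max_triple_def sq_integrable_cnj)

lemma sq_integrable_cong_M:
  assumes "f \<in> sq_integrable M" "\<And>x. x \<in> I \<Longrightarrow> g x = f x"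
  shows "g \<in> sq_integrable M"
proof -
  have "g \<in> borel_measurable M \<longleftrightarrow> f \<in> borel_measurable M" by (rule measurable_cong) (use assms in simp)
  then show ?thesis
    by (intro sq_integrable_AE[OF assms(1)]) (use sq_integrableD(1)[OF assms(1)] assms(2) in auto)
qed

lemma triple_cong:
  assumes "max_triple f h k" "\<And>x. x \<in> I \<Longrightarrow> f' x = f x" "\<And>x. x \<in> I \<Longrightarrow> h' x = h x" "\<And>x. x \<in> I \<Longrightarrow> k' x = k x"
  shows "max_triple f' h' k'"
proof -
  have *: "AE x in lebesgue_on I. x \<in> I"
    using AE_space[of "lebesgue_on I"] by (simp add: space_restrict_space)
  show ?thesis unfolding max_triple_def
    using max_tripleD[OF assms(1)] assms(2-4) *
    by (auto intro!: quasi_system_cong[OF max_tripleD(1)[OF assms(1)]] intro: sq_integrable_cong_M elim!: eventually_mono)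
qed

lemma bounded_sq_integrable:
  assumes cd: "{c..d} \<subseteq> I" and f: "f \<in> borel_measurable M" "\<And>x. x \<in> {c..d} \<Longrightarrow> norm (f x) \<le> B" "\<And>x. x \<in> I - {c..d} \<Longrightarrow> f x = 0"
  shows "f \<in> sq_integrable M"
  unfolding sq_integrable_def
proof (intro CollectI conjI f(1))
  note [measurable] = f(1)
  show "integrable M (\<lambda>x. (norm (f x))\<^sup>2)"
  proof (rule Bochner_Integration.integrable_bound)
    show "integrable M (\<lambda>x. B\<^sup>2 * indicator {c..d} x)" using integrable_M_indicator[OF cd] by auto
    have "(norm (f x))\<^sup>2 \<le> B\<^sup>2 * indicator {c..d} x" if "x \<in> space M" for x
      using f(2)[of x] f(3)[of x] that by (cases "x \<in> {c..d}") (auto intro: power_mono)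
    then show "AE x in M. norm ((norm (f x))\<^sup>2) \<le> norm (B\<^sup>2 * indicator {c..d} x)"
      by (intro AE_I2) (auto intro: order_trans[OF _ abs_ge_self])
  qed measurable
qed

lemma continuous_bounded:
  assumes "{c..d} \<subseteq> I" "continuous_on I f"
  obtains B where "\<And>x. x \<in> {c..d} \<Longrightarrow> norm (f x :: complex) \<le> B"
proof -
  have "bounded (f ` {c..d})"
    by (intro compact_imp_bounded compact_continuous_image continuous_on_subset[OF assms(2,1)]) auto
  then show ?thesis using that unfolding bounded_iff by blast
qed

section \<open>Functions on a subinterval and their extension by zero\<close>

definition cut :: "real \<Rightarrow> real \<Rightarrow> (real \<Rightarrow> complex) \<Rightarrow> real \<Rightarrow> complex" where
  "cut c d f x = (if x \<in> {c<..<d} then f x else 0)"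

abbreviation N :: "real \<Rightarrow> real \<Rightarrow> real measure" where "N c d \<equiv> restrict_space M {c<..<d}"

lemma measurable_N:
  assumes "{c<..<d} \<subseteq> I"
  shows "f \<in> borel_measurable (N c d) \<longleftrightarrow> cut c d f \<in> borel_measurable M"
  unfolding cut_def using Icc_sets_M(2)[OF assms] assms
  by (subst measurable_restrict_space_iff[where c = 0]) (auto simp: Int_absorb2)

lemma sq_N_iff:
  assumes J: "{c<..<d} \<subseteq> I"
  shows "f \<in> sq_integrable (N c d) \<longleftrightarrow> cut c d f \<in> sq_integrable M"
proof -
  have "integrable (N c d) (\<lambda>x. (norm (f x))\<^sup>2) \<longleftrightarrow> integrable M (\<lambda>x. (norm (cut c d f x))\<^sup>2)"
    using Icc_sets_M(2)[OF J] J
    by (subst integrable_restrict_space) (auto simp: Int_absorb2 cut_def intro!: Bochner_Integration.integrable_cong split: split_indicator)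
  then show ?thesis using measurable_N[OF J, of f] by (simp add: sq_integrable_def)
qed

lemma cut_sq:
  assumes J: "{c<..<d} \<subseteq> I" and f: "f \<in> sq_integrable M"
  shows "cut c d f \<in> sq_integrable M"
proof -
  note [measurable] = sq_integrableD(1)[OF f] Icc_sets_M(2)[OF J]
  have [measurable]: "cut c d f \<in> borel_measurable M" unfolding cut_def[abs_def] by measurable
  have "integrable M (\<lambda>x. (norm (cut c d f x))\<^sup>2)"
  proof (rule Bochner_Integration.integrable_bound[OF sq_integrableD(2)[OF f]])
    show "AE x in M. norm ((norm (cut c d f x))\<^sup>2) \<le> norm ((norm (f x))\<^sup>2)" by (simp add: cut_def)
  qed measurable
  then show ?thesis by (simp add: sq_integrable_def)
qed

lemma cut_continuous_sq:
  assumes cd: "{c..d} \<subseteq> I" and f: "continuous_on I f"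
  shows "cut c d f \<in> sq_integrable M"
proof -
  have J: "{c<..<d} \<subseteq> I" using cd by (meson greaterThanLessThan_subseteq_atLeastAtMost_iff order_refl order_trans)
  note [measurable] = continuous_measurable_M[OF f] Icc_sets_M(2)[OF J]
  have m: "cut c d f \<in> borel_measurable M" unfolding cut_def[abs_def] by measurable
  obtain B where "\<And>x. x \<in> {c..d} \<Longrightarrow> norm (f x) \<le> B" using continuous_bounded[OF cd f] by blast
  then show ?thesis
    by (intro bounded_sq_integrable[OF cd m, of "max B 0"]) (auto simp: cut_def intro: max.coboundedI1)
qed

lemma ip_N:
  assumes J: "{c<..<d} \<subseteq> I"
  shows "ip (N c d) f g = (LINT x|M. cnj (f x) * cut c d g x)"
  unfolding ip_def using Icc_sets_M(2)[OF J] J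
  by (subst integral_restrict_space) (auto simp: Int_absorb2 cut_def intro!: Bochner_Integration.integral_cong split: split_indicator)

lemma AE_N:
  assumes J: "{c<..<d} \<subseteq> I"
  shows "(AE x in N c d. P x) \<longleftrightarrow> (\<exists>N. negligible N \<and> (\<forall>x\<in>{c<..<d} - N. P x))"
proof -
  have "(AE x in N c d. P x) \<longleftrightarrow> (AE x in M. x \<in> {c<..<d} \<longrightarrow> P x)"
    using Icc_sets_M(2)[OF J] J by (subst AE_restrict_space_iff) (auto simp: Int_absorb2)
  also have "\<dots> \<longleftrightarrow> (\<exists>N. negligible N \<and> (\<forall>x\<in>I - N. x \<in> {c<..<d} \<longrightarrow> P x))"
    unfolding AE_M by (rule AE_lebesgue_on_iff) simp
  also have "\<dots> \<longleftrightarrow> (\<exists>N. negligible N \<and> (\<forall>x\<in>{c<..<d} - N. P x))" using J by blast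
  finally show ?thesis .
qed

lemma cut_mult_integrable:
  assumes J: "{c<..<d} \<subseteq> I" and f: "f \<in> sq_integrable (N c d)" and g: "g \<in> sq_integrable (N c d)"
  shows "integrable M (\<lambda>x. f x * cut c d g x)"
proof -
  have "integrable M (\<lambda>x. cut c d f x * cut c d g x)"
    by (rule sq_integrable_mult) (use f g sq_N_iff[OF J] in auto)
  then show ?thesis by (rule Bochner_Integration.integrable_cong[THEN iffD1, rotated -1]) (auto simp: cut_def)
qed

lemma integrable_M_Icc:
  assumes "integrable M f" "{c..d} \<subseteq> I"
  shows "(\<lambda>x. complex_of_real (r x) * f x) absolutely_integrable_on {c..d}"
proof -
  have "(\<lambda>x. complex_of_real (r x) * f x) absolutely_integrable_on I"
    using assms(1) integrable_M[OF borel_measurable_integrable[OF assms(1)]] by simp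
  then show ?thesis by (rule set_integrable_subset) (use assms(2) in auto)
qed

subsection \<open>Compactly supported solutions\<close>

text \<open>The solution with zero data at \<open>c\<close> has Wronskians with \<open>u1\<close>
  and \<open>u2\<close> that grow by the integral of the source. The orthogonality conditions bring
  both back to 0 at \<open>d\<close>, and \<open>fundamental_zero\<close> then makes the solution
  vanish beyond \<open>d\<close>.\<close>

lemma compact_solution:
  assumes F: "fundamental u1 v1 u2 v2" and cd: "c < d" "{c..d} \<subseteq> I"
    and k: "k \<in> sq_integrable M" "\<And>x. x \<in> I - {c<..<d} \<Longrightarrow> k x = 0"
    and orth: "integral {c..d} (\<lambda>x. of_real (r x) * k x * u1 x) = 0" "integral {c..d} (\<lambda>x. of_real (r x) * k x * u2 x) = 0"
  obtains f h where "max_triple f h k" "\<And>x. x \<in> I - {c<..<d} \<Longrightarrow> f x = 0 \<and> h x = 0"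
proof -
  have cI: "c \<in> I" and dI: "d \<in> I" using cd by auto
  obtain f h where fh: "quasi_system f h (\<lambda>x. of_real (r x) * k x)" "f c = 0" "h c = 0"
    using quasi_system_exists[OF loc_integrable_sq_integrable[OF k(1)] cI] by blast
  have D0: "f x * v x - h x * u x = 0"
    if uv: "quasi_system u v (\<lambda>_. 0)" "integral {c..d} (\<lambda>x. of_real (r x) * k x * u x) = 0" and x: "x \<in> I - {c<..<d}" for u v x
  proof -
    have W: "integral {y..z} (\<lambda>x. of_real (r x) * k x * u x) = (f z * v z - h z * u z) - (f y * v y - h y * u y)"
      if "y \<in> I" "z \<in> I" "y \<le> z" for y z
      using indefD(2)[OF lagrange[OF fh(1) uv(1)] that(3) einterval_ivl_subset[OF that(1,2)]] by simp
    have Z: "integral {y..z} (\<lambda>x. of_real (r x) * k x * u x) = 0" if "y \<in> I" "z \<in> I" "z \<le> c \<or> d \<le> y" for y z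
    proof -
      have "integral {y..z} (\<lambda>x. of_real (r x) * k x * u x) = integral {y..z} (\<lambda>x. 0)"
        by (rule integral_cong) (use k(2) that einterval_ivl_subset[OF that(1,2)] in \<open>auto simp: subset_iff\<close>)
      then show ?thesis by simp
    qed
    show ?thesis
    proof (cases "x \<le> c")
      case True
      then show ?thesis using W[of x c] Z[of x c] x cI fh by simp
    next
      case False
      then have "d \<le> x" using x by auto
      then show ?thesis using W[of d x] Z[of d x] W[of c d] uv(2) x cI dI cd(1) fh by simp
    qed
  qed
  have uv: "quasi_system u1 v1 (\<lambda>_. 0)" "quasi_system u2 v2 (\<lambda>_. 0)" using F by (simp_all add: fundamental_def)
  have zero: "f x = 0 \<and> h x = 0" if x: "x \<in> I - {c<..<d}" for x
    using fundamental_zero[OF F DiffD1[OF x] D0[OF uv(1) orth(1) x] D0[OF uv(2) orth(2) x]] by blast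
  obtain B where B: "\<And>x. x \<in> {c..d} \<Longrightarrow> norm (f x) \<le> B"
    using continuous_bounded[OF cd(2) quasi_system_continuous(1)[OF fh(1)]] by blast
  have "f \<in> sq_integrable M"
    by (rule bounded_sq_integrable[OF cd(2) continuous_measurable_M[OF quasi_system_continuous(1)[OF fh(1)]] B]) (use zero in auto)
  then have "max_triple f h k" using fh(1) k(1) by (simp add: max_triple_def)
  then show ?thesis using zero by (rule that)
qed

text \<open>The difference \<open>u - f0\<close> is orthogonal in \<open>L\<^sup>2(c, d)\<close> to every \<open>k\<close> that is orthogonal to the conjugates
  of the solutions of \<open>\<tau> y = 0\<close>, so it lies in their span.\<close>

lemma adjoint_local:
  assumes F: "fundamental u1 v1 u2 v2" and cd: "c < d" "{c..d} \<subseteq> I"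
    and u: "u \<in> sq_integrable M" and v: "v \<in> sq_integrable M"
    and H: "\<And>f h k. max_triple f h k \<Longrightarrow> (\<And>x. x \<in> I - {c<..<d} \<Longrightarrow> f x = 0 \<and> h x = 0) \<Longrightarrow> ip M u k = ip M v f"
    and fh: "quasi_system f0 h0 (\<lambda>x. of_real (r x) * v x)"
  obtains \<alpha> \<beta> Z where "negligible Z" "\<And>x. x \<in> {c<..<d} - Z \<Longrightarrow> u x - f0 x = \<alpha> * cnj (u1 x) + \<beta> * cnj (u2 x)"
proof -
  have J: "{c<..<d} \<subseteq> I" using cd by (meson greaterThanLessThan_subseteq_atLeastAtMost_iff order_refl order_trans)
  let ?N = "N c d"
  define w where "w x = u x - f0 x" for x
  define e1 where "e1 x = cnj (u1 x)" for x
  define e2 where "e2 x = cnj (u2 x)" for x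
  have uc: "continuous_on I u1" "continuous_on I u2" using F by (auto simp: fundamental_def quasi_system_continuous)
  have e: "e1 \<in> sq_integrable ?N" "e2 \<in> sq_integrable ?N"
    unfolding e1_def[abs_def] e2_def[abs_def] sq_N_iff[OF J]
    by (intro cut_continuous_sq[OF cd(2)] continuous_intros uc)+
  have uN: "u \<in> sq_integrable ?N" unfolding sq_N_iff[OF J] by (rule cut_sq[OF J u])
  have fN: "f0 \<in> sq_integrable ?N" unfolding sq_N_iff[OF J] by (rule cut_continuous_sq[OF cd(2) quasi_system_continuous(1)[OF fh]])
  have w: "w \<in> sq_integrable ?N" unfolding w_def[abs_def] by (rule sq_integrable_diff[OF uN fN])
  obtain \<alpha> \<beta> where ab: "ip ?N e1 (\<lambda>x. w x - (\<alpha> * e1 x + \<beta> * e2 x)) = 0" "ip ?N e2 (\<lambda>x. w x - (\<alpha> * e1 x + \<beta> * e2 x)) = 0"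
    using ip_projection2[OF e w] .
  define L where "L x = \<alpha> * e1 x + \<beta> * e2 x" for x
  define K where "K x = w x - L x" for x
  have L: "L \<in> sq_integrable ?N" unfolding L_def[abs_def] by (intro sq_integrable_add sq_integrable_cmult e)
  have K: "K \<in> sq_integrable ?N" unfolding K_def[abs_def] by (rule sq_integrable_diff[OF w L])
  have eK: "ip ?N e1 K = 0" "ip ?N e2 K = 0" using ab by (simp_all add: K_def[abs_def] L_def)
  \<comment> \<open>The defect \<open>K\<close> itself is the test function. For the solution
    \<open>f\<close> of \<tau> f = K the hypothesis gives \<open>ip M u ?k = ip M v f\<close>, and
    Lagrange's identity without boundary terms turns the right side into the product of
    \<open>f0\<close> with \<open>K\<close>. So \<open>K\<close> is orthogonal to
    \<open>u - f0\<close> and to the solutions, hence to itself.\<close>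
  let ?k = "cut c d K"
  have k: "?k \<in> sq_integrable M" using K sq_N_iff[OF J] by simp
  have k0: "?k x = 0" if "x \<in> I - {c<..<d}" for x using that by (auto simp: cut_def)
  have ipint: "ip ?N g K = integral {c..d} (\<lambda>x. of_real (r x) * (cnj (g x) * ?k x))" if g: "g \<in> sq_integrable ?N" for g
    unfolding ip_N[OF J]
    by (rule integral_M_compact[OF cut_mult_integrable[OF J sq_integrable_cnj[OF g] K] cd(2)]) (auto simp: cut_def)
  have "integral {c..d} (\<lambda>x. of_real (r x) * ?k x * u1 x) = 0"
    using ipint[OF e(1)] eK(1) by (simp add: e1_def mult_ac)
  moreover have "integral {c..d} (\<lambda>x. of_real (r x) * ?k x * u2 x) = 0"
    using ipint[OF e(2)] eK(2) by (simp add: e2_def mult_ac)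
  ultimately obtain f h where f: "max_triple f h ?k" "\<And>x. x \<in> I - {c<..<d} \<Longrightarrow> f x = 0 \<and> h x = 0"
    using compact_solution[OF F cd k k0] by blast
  have "ip ?N u K = ip M u ?k" unfolding ip_N[OF J] by (simp add: ip_def)
  also have "\<dots> = ip M v f" by (rule H[OF f])
  also have "\<dots> = integral {c..d} (\<lambda>x. of_real (r x) * (cnj (v x) * f x))"
    unfolding ip_def
    by (rule integral_M_compact[OF ip_integrable[OF v max_tripleD(2)[OF f(1)]] cd(2)]) (use f(2) in auto)
  also have "\<dots> = integral {c..d} (\<lambda>x. of_real (r x) * (cnj (f0 x) * ?k x))"
  proof -
    have "integral {c..d} (\<lambda>x. cnj (of_real (r x) * v x) * f x - cnj (f0 x) * (of_real (r x) * ?k x)) =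
        (cnj (f0 d) * h d - cnj (h0 d) * f d) - (cnj (f0 c) * h c - cnj (h0 c) * f c)"
      using indefD(2)[OF lagrange[OF quasi_system_cnj[OF fh] max_tripleD(1)[OF f(1)]] _ cd(2)] cd(1) by simp
    also have "\<dots> = 0"
    proof -
      have "c \<in> I" "d \<in> I" using cd by (auto simp: subset_iff)
      then show ?thesis using f(2)[of c] f(2)[of d] by simp
    qed
    finally have "integral {c..d} (\<lambda>x. of_real (r x) * (cnj (v x) * f x) - of_real (r x) * (cnj (f0 x) * ?k x)) = 0"
      by (simp add: mult_ac)
    moreover have "(\<lambda>x. of_real (r x) * (cnj (v x) * f x)) integrable_on {c..d}"
      using integrable_M_Icc[OF ip_integrable[OF v max_tripleD(2)[OF f(1)]] cd(2)] by (simp add: absolutely_integrable_on_def)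
    moreover have "(\<lambda>x. of_real (r x) * (cnj (f0 x) * ?k x)) integrable_on {c..d}"
      using integrable_M_Icc[OF cut_mult_integrable[OF J sq_integrable_cnj[OF fN] K] cd(2)] by (simp add: absolutely_integrable_on_def)
    ultimately show ?thesis by (simp add: Henstock_Kurzweil_Integration.integral_diff)
  qed
  also have "\<dots> = ip ?N f0 K" using ipint[OF fN] by simp
  finally have "ip ?N w K = 0"
    using ip_diff_left[OF K uN fN] by (simp add: w_def[abs_def])
  moreover have "ip ?N L K = 0"
    unfolding L_def[abs_def]
    by (simp add: ip_add_left[OF K sq_integrable_cmult[OF e(1)] sq_integrable_cmult[OF e(2)]] ip_cmult_left eK)
  ultimately have "ip ?N K K = 0"
    using ip_diff_left[OF K w L] by (simp add: K_def[abs_def])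
  then have "AE x in ?N. K x = 0" using sqn_eq_0[OF K] by (simp add: ip_self)
  then obtain Z where "negligible Z" "\<And>x. x \<in> {c<..<d} - Z \<Longrightarrow> K x = 0" unfolding AE_N[OF J] by blast
  then show ?thesis by (intro that[of Z \<alpha> \<beta>]) (auto simp: K_def w_def L_def e1_def e2_def)
qed

text \<open>\<open>adjoint_local\<close> gives coefficients for each compact interval. Enlarging an
  interval until it contains the reference interval \<open>{c..d}\<close> makes its coefficients
  comparable with those found there, and independence of the solutions identifies them.\<close>

proposition adjoint_main:
  assumes u: "u \<in> sq_integrable M" and v: "v \<in> sq_integrable M"
    and H: "\<And>f h k c d. max_triple f h k \<Longrightarrow> {c..d} \<subseteq> I \<Longrightarrow> c < d \<Longrightarrow> (\<And>x. x \<in> I - {c<..<d} \<Longrightarrow> f x = 0 \<and> h x = 0) \<Longrightarrow> ip M u k = ip M v f"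
  obtains f h where "max_triple f h v" "AE x in M. u x = f x"
proof -
  obtain u1 v1 u2 v2 where F: "fundamental u1 v1 u2 v2" using fundamental_exists .
  obtain x0 where x0: "x0 \<in> I" using einterval_nonempty[OF ab] by blast
  then obtain c0 d0 where cd0: "of_rat c0 < x0" "x0 < of_rat d0" "{of_rat c0..of_rat d0} \<subseteq> I" by (rule einterval_rat_cover)
  define c where "c = real_of_rat c0"
  define d where "d = real_of_rat d0"
  have cd: "c < d" "{c..d} \<subseteq> I" using cd0 by (auto simp: c_def d_def)
  then have cI: "c \<in> I" and dI: "d \<in> I" by auto
  obtain f0 h0 where fh: "quasi_system f0 h0 (\<lambda>x. of_real (r x) * v x)" 
    using quasi_system_exists[OF loc_integrable_sq_integrable[OF v] x0] by blast
  have loc: "\<exists>\<alpha> \<beta> Z. negligible Z \<and> (\<forall>x\<in>{c'<..<d'} - Z. u x - f0 x = \<alpha> * cnj (u1 x) + \<beta> * cnj (u2 x))"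
    if "c' < d'" "{c'..d'} \<subseteq> I" for c' d'
    using adjoint_local[OF F that u v _ fh] H that by metis
  obtain \<alpha> \<beta> Z where Z: "negligible Z" "\<And>x. x \<in> {c<..<d} - Z \<Longrightarrow> u x - f0 x = \<alpha> * cnj (u1 x) + \<beta> * cnj (u2 x)"
    using loc[OF cd] by blast
  have ae: "AE x in lebesgue_on I. u x - f0 x = \<alpha> * cnj (u1 x) + \<beta> * cnj (u2 x)"
  proof (rule AE_einterval_localI)
    fix c' d' assume cd': "c' < d'" "{c'..d'} \<subseteq> I"
    let ?c = "min c c'" and ?d = "max d d'"
    have sub: "{?c..?d} \<subseteq> I" using cd' cI dI by (intro einterval_ivl_subset) (auto simp: min_def max_def)
    have lt: "?c < ?d" using cd by auto
    obtain \<alpha>' \<beta>' Z' where Z': "negligible Z'" "\<And>x. x \<in> {?c<..<?d} - Z' \<Longrightarrow> u x - f0 x = \<alpha>' * cnj (u1 x) + \<beta>' * cnj (u2 x)"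
      using loc[OF lt sub] by blast
    have *: "(\<alpha> - \<alpha>') * cnj (u1 x) + (\<beta> - \<beta>') * cnj (u2 x) = 0" if x: "x \<in> {c<..<d} - (Z \<union> Z')" for x
    proof -
      have "u x - f0 x = \<alpha> * cnj (u1 x) + \<beta> * cnj (u2 x)" using Z(2)[of x] x by auto
      moreover have "u x - f0 x = \<alpha>' * cnj (u1 x) + \<beta>' * cnj (u2 x)" using Z'(2)[of x] x by (auto simp: min_def max_def split: if_splits)
      ultimately show ?thesis by (simp add: algebra_simps)
    qed
    have "negligible (Z \<union> Z')" using Z(1) Z'(1) by simp
    from fundamental_independent[OF F cd this *] have "\<alpha> = \<alpha>'" "\<beta> = \<beta>'" by simp_all
    then show "\<exists>N. negligible N \<and> (\<forall>x\<in>{c'<..<d'} - N. u x - f0 x = \<alpha> * cnj (u1 x) + \<beta> * cnj (u2 x))"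
    proof (intro exI conjI ballI)
      fix x assume x: "x \<in> {c'<..<d'} - Z'"
      then have "x \<in> {?c<..<?d} - Z'" by (auto simp: min_def max_def)
      then show "u x - f0 x = \<alpha> * cnj (u1 x) + \<beta> * cnj (u2 x)"
        using Z'(2) \<open>\<alpha> = \<alpha>'\<close> \<open>\<beta> = \<beta>'\<close> by blast
    qed (rule Z'(1))
  qed
  define f where "f x = f0 x + (\<alpha> * cnj (u1 x) + \<beta> * cnj (u2 x))" for x
  define h where "h x = h0 x + (\<alpha> * cnj (v1 x) + \<beta> * cnj (v2 x))" for x
  have uv: "quasi_system u1 v1 (\<lambda>_. 0)" "quasi_system u2 v2 (\<lambda>_. 0)" using F by (auto simp: fundamental_def)
  have fh_system: "quasi_system f h (\<lambda>x. of_real (r x) * v x)"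
    using quasi_system_add[OF fh quasi_system_add[OF quasi_system_cmult[OF quasi_system_cnj[OF uv(1)], of \<alpha>] quasi_system_cmult[OF quasi_system_cnj[OF uv(2)], of \<beta>]]]
    by (simp add: f_def[abs_def] h_def[abs_def])
  have uf: "AE x in M. u x = f x"
    unfolding AE_M using ae by eventually_elim (simp add: f_def algebra_simps)
  have "f \<in> sq_integrable M"
    by (rule sq_integrable_AE[OF u continuous_measurable_M[OF quasi_system_continuous(1)[OF fh_system]]]) (use uf in \<open>auto elim: eventually_mono\<close>)
  with fh_system v uf show ?thesis by (intro that[of f h]) (auto simp: max_triple_def)
qed

text \<open>The equation is solved from the data of \<open>f1\<close> at \<open>c\<close>, with a
  source on \<open>(c, d)\<close> that steers the solution to the data of \<open>f2\<close> at
  \<open>d\<close>. The target amounts to two Wronskian conditions, that is, two moments of the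
  source.\<close>

proposition naimark_patching:
  assumes 1: "max_triple f1 h1 k1" and 2: "max_triple f2 h2 k2"
  obtains f h k c d where "max_triple f h k" "c < d" "{c..d} \<subseteq> I"
    "\<And>x. x \<in> I \<Longrightarrow> x \<le> c \<Longrightarrow> f x = f1 x \<and> h x = h1 x" "\<And>x. x \<in> I \<Longrightarrow> d \<le> x \<Longrightarrow> f x = f2 x \<and> h x = h2 x"
proof -
  obtain u1 v1 u2 v2 where F: "fundamental u1 v1 u2 v2" using fundamental_exists .
  have uv: "quasi_system u1 v1 (\<lambda>_. 0)" "quasi_system u2 v2 (\<lambda>_. 0)" using F by (auto simp: fundamental_def)
  obtain x0 where x0: "x0 \<in> I" using einterval_nonempty[OF ab] by blast
  then obtain c0 d0 where cd0: "of_rat c0 < x0" "x0 < of_rat d0" "{of_rat c0..of_rat d0} \<subseteq> I" by (rule einterval_rat_cover)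
  define c where "c = real_of_rat c0"
  define d where "d = real_of_rat d0"
  have cd: "c < d" "{c..d} \<subseteq> I" using cd0 by (auto simp: c_def d_def)
  then have cI: "c \<in> I" and dI: "d \<in> I" by auto
  have J: "{c<..<d} \<subseteq> I" using cd by (meson greaterThanLessThan_subseteq_atLeastAtMost_iff order_refl order_trans)
  let ?N = "N c d"
  define e1 where "e1 x = cnj (u1 x)" for x
  define e2 where "e2 x = cnj (u2 x)" for x
  have e: "e1 \<in> sq_integrable ?N" "e2 \<in> sq_integrable ?N"
    unfolding e1_def[abs_def] e2_def[abs_def] sq_N_iff[OF J]
    by (intro cut_continuous_sq[OF cd(2)] continuous_intros quasi_system_continuous(1)[OF uv(1)] quasi_system_continuous(1)[OF uv(2)])+
  have ind: "\<alpha> = 0 \<and> \<beta> = 0" if "AE x in ?N. \<alpha> * e1 x + \<beta> * e2 x = 0" for \<alpha> \<beta>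
    using that fundamental_independent[OF F cd] unfolding AE_N[OF J] e1_def e2_def by metis
  \<comment> \<open>The Wronskian of \<open>f - f2\<close> with \<open>u\<close> must reach 0 at
    \<open>d\<close>. It starts from that of \<open>f1 - f2\<close> at \<open>c\<close>, so its
    increment, the moment of the source, must be the negative of this value.\<close>
  define t where "t u v = - ((f1 c - f2 c) * v c - (h1 c - h2 c) * u c)" for u v :: "real \<Rightarrow> complex"
  obtain \<kappa> where \<kappa>: "\<kappa> \<in> sq_integrable ?N" "ip ?N e1 \<kappa> = t u1 v1" "ip ?N e2 \<kappa> = t u2 v2"
    using ip_moments[OF e ind] by blast
  define k where "k x = (if x \<le> c then k1 x else k2 x + cut c d \<kappa> x)" for x
  have [measurable]: "k1 \<in> borel_measurable M" "k2 \<in> borel_measurable M" "cut c d \<kappa> \<in> borel_measurable M"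
    using max_tripleD(3)[OF 1] max_tripleD(3)[OF 2] \<kappa>(1)[unfolded sq_N_iff[OF J]] by (auto intro: sq_integrableD(1))
  have le_c [measurable]: "Measurable.pred M (\<lambda>x. x \<le> c)"
  proof -
    have "{x \<in> space M. x \<le> c} = {..c} \<inter> I" by auto
    moreover have "{..c} \<inter> I \<in> sets M" by (auto simp: sets_M sets_restrict_space intro!: image_eqI[of _ _ "{..c}"])
    ultimately show ?thesis by (simp add: pred_def)
  qed
  have k: "k \<in> sq_integrable M"
    unfolding sq_integrable_def
  proof (intro CollectI conjI)
    show [measurable]: "k \<in> borel_measurable M" unfolding k_def[abs_def] by measurable
    have s: "(\<lambda>x. k2 x + cut c d \<kappa> x) \<in> sq_integrable M"
      using \<kappa>(1) by (intro sq_integrable_add max_tripleD(3)[OF 2]) (simp add: sq_N_iff[OF J])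
    show "integrable M (\<lambda>x. (norm (k x))\<^sup>2)"
    proof (rule Bochner_Integration.integrable_bound)
      show "integrable M (\<lambda>x. (norm (k1 x))\<^sup>2 + (norm (k2 x + cut c d \<kappa> x))\<^sup>2)"
        using sq_integrableD(2)[OF max_tripleD(3)[OF 1]] sq_integrableD(2)[OF s] by auto
    qed (auto simp: k_def)
  qed
  obtain f h where fh: "quasi_system f h (\<lambda>x. of_real (r x) * k x)" "f c = f1 c" "h c = h1 c"
    using quasi_system_exists[OF loc_integrable_sq_integrable[OF k] cI] by blast
  note d1 = quasi_system_diff[OF fh(1) max_tripleD(1)[OF 1]]
  note d2 = quasi_system_diff[OF fh(1) max_tripleD(1)[OF 2]]
  have left: "f x = f1 x \<and> h x = h1 x" if x: "x \<in> I" "x \<le> c" for x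
  proof -
    have D: "(f x - f1 x) * v x - (h x - h1 x) * u x = 0" if uv: "quasi_system u v (\<lambda>_. 0)" for u v
    proof -
      have "integral {x..c} (\<lambda>x. (of_real (r x) * k x - of_real (r x) * k1 x) * u x) =
          ((f c - f1 c) * v c - (h c - h1 c) * u c) - ((f x - f1 x) * v x - (h x - h1 x) * u x)"
        using indefD(2)[OF lagrange[OF d1 uv] x(2) einterval_ivl_subset[OF x(1) cI]] by simp
      moreover have "integral {x..c} (\<lambda>x. (of_real (r x) * k x - of_real (r x) * k1 x) * u x) = integral {x..c} (\<lambda>x. 0)"
        by (rule integral_cong) (auto simp: k_def)
      ultimately show ?thesis using fh by simp
    qed
    show ?thesis using fundamental_zero[OF F x(1) D[OF uv(1)] D[OF uv(2)]] by simp
  qed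
  have right: "f x = f2 x \<and> h x = h2 x" if x: "x \<in> I" "d \<le> x" for x
  proof -
    have D: "(f x - f2 x) * v x - (h x - h2 x) * u x = 0"
      if uv: "quasi_system u v (\<lambda>_. 0)" and m: "ip ?N (\<lambda>x. cnj (u x)) \<kappa> = t u v" and eu: "(\<lambda>x. cnj (u x)) \<in> sq_integrable ?N" for u v
    proof -
      let ?g = "\<lambda>x. (of_real (r x) * k x - of_real (r x) * k2 x) * u x"
      note L = lagrange[OF d2 uv]
      have "integral {c..d} ?g = ((f d - f2 d) * v d - (h d - h2 d) * u d) - ((f c - f2 c) * v c - (h c - h2 c) * u c)"
        using indefD(2)[OF L _ cd(2)] cd(1) by simp
      moreover have "integral {d..x} ?g = ((f x - f2 x) * v x - (h x - h2 x) * u x) - ((f d - f2 d) * v d - (h d - h2 d) * u d)"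
        using indefD(2)[OF L x(2) einterval_ivl_subset[OF dI x(1)]] by simp
      moreover have "integral {d..x} ?g = integral {d..x} (\<lambda>x. 0)"
        by (rule integral_cong) (use cd(1) in \<open>auto simp: k_def cut_def\<close>)
      moreover have "integral {c..d} ?g = t u v"
      proof -
        have "t u v = (LINT x|M. cnj (cnj (u x)) * cut c d \<kappa> x)" using m by (simp only: ip_N[OF J])
        also have "\<dots> = integral {c..d} (\<lambda>x. of_real (r x) * (cnj (cnj (u x)) * cut c d \<kappa> x))"
          by (rule integral_M_compact[OF cut_mult_integrable[OF J sq_integrable_cnj[OF eu] \<kappa>(1)] cd(2)]) (auto simp: cut_def)
        \<comment> \<open>At \<open>c\<close> itself \<open>k\<close> takes the branch
          \<open>k1\<close>, so the integrands agree only off this point.\<close>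
        also have "\<dots> = integral {c..d} ?g"
          by (rule integral_spike[of "{c}"]) (auto simp: k_def algebra_simps)
        finally show ?thesis by simp
      qed
      ultimately show ?thesis using fh by (simp add: t_def)
    qed
    show ?thesis
      using fundamental_zero[OF F x(1) D[OF uv(1)] D[OF uv(2)]] \<kappa> e by (simp add: e1_def[abs_def] e2_def[abs_def])
  qed
  have "f \<in> sq_integrable M"
    unfolding sq_integrable_def
  proof (intro CollectI conjI)
    show [measurable]: "f \<in> borel_measurable M" by (rule continuous_measurable_M[OF quasi_system_continuous(1)[OF fh(1)]])
    obtain B where B: "\<And>x. x \<in> {c..d} \<Longrightarrow> norm (f x) \<le> B"
      using continuous_bounded[OF cd(2) quasi_system_continuous(1)[OF fh(1)]] by blast
    show "integrable M (\<lambda>x. (norm (f x))\<^sup>2)"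
    proof (rule Bochner_Integration.integrable_bound)
      show "integrable M (\<lambda>x. ((norm (f1 x))\<^sup>2 + (norm (f2 x))\<^sup>2) + B\<^sup>2 * indicator {c..d} x)"
        using sq_integrableD(2)[OF max_tripleD(2)[OF 1]] sq_integrableD(2)[OF max_tripleD(2)[OF 2]] integrable_M_indicator[OF cd(2)] by auto
      have "(norm (f x))\<^sup>2 \<le> ((norm (f1 x))\<^sup>2 + (norm (f2 x))\<^sup>2) + B\<^sup>2 * indicator {c..d} x" if x: "x \<in> I" for x
      proof -
        consider "x \<le> c" | "d \<le> x" | "x \<in> {c..d}" by force
        then show ?thesis
        proof cases
          case 3
          then have "(norm (f x))\<^sup>2 \<le> B\<^sup>2" by (intro power_mono B) auto
          with 3 show ?thesis by (simp add: add_increasing)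
        qed (use left right x in auto)
      qed
      then show "AE x in M. norm ((norm (f x))\<^sup>2) \<le> norm (((norm (f1 x))\<^sup>2 + (norm (f2 x))\<^sup>2) + B\<^sup>2 * indicator {c..d} x)"
        by (intro AE_I2) (auto intro: order_trans[OF _ abs_ge_self])
    qed measurable
  qed
  then have "max_triple f h k" using fh(1) k by (simp add: max_triple_def)
  then show ?thesis using cd left right by (rule that)
qed


subsection \<open>Boundary values of Wronskians\<close>

text \<open>The limit is taken in the extended reals, as in \<open>wronskian_end\<close>, so that
  infinite endpoints need no separate treatment. As a relation it can be combined by limit laws
  before \<open>Lim\<close> is known to be meaningful.\<close>

definition end_limit :: "ereal \<Rightarrow> (real \<Rightarrow> complex) \<Rightarrow> complex \<Rightarrow> bool" where
  "end_limit c W L \<longleftrightarrow> ((\<lambda>X. W (real_of_ereal X)) \<longlongrightarrow> L) (at c within {a<..<b})"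

lemma end_nontrivial: "c \<in> {a, b} \<Longrightarrow> at c within {a<..<b} \<noteq> bot"
  using islimpt_greaterThanLessThan1[OF ab] islimpt_greaterThanLessThan2[OF ab]
  by (auto simp: trivial_limit_within)

lemma end_limit_unique: "c \<in> {a, b} \<Longrightarrow> end_limit c W L \<Longrightarrow> end_limit c W L' \<Longrightarrow> L = L'"
  unfolding end_limit_def using tendsto_unique end_nontrivial by blast

lemma real_of_ereal_I: "X \<in> {a<..<b} \<Longrightarrow> real_of_ereal X \<in> I \<and> ereal (real_of_ereal X) = X"
  by (cases X) (auto simp: einterval_iff)

lemma end_limit_cong:
  assumes "end_limit c W L" "\<And>x. x \<in> I \<Longrightarrow> V x = W x"
  shows "end_limit c V L"
  using assms(1) unfolding end_limit_def
  by (rule Lim_transform_eventually) (auto simp: eventually_at_filter assms(2) real_of_ereal_I)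

text \<open>An integrable density on all of \<open>I\<close> dominates the partial integrals, so
  these converge towards both ends. \<open>R\<close> and \<open>L\<close> overlap in the single
  point \<open>x0\<close>.\<close>

lemma indef_end_limits:
  assumes W: "indef I W \<phi>" and \<phi>: "\<phi> absolutely_integrable_on I"
  obtains A B where "end_limit a W A" "end_limit b W B" "B - A = integral I \<phi>"
proof -
  obtain x0 where x0: "x0 \<in> I" using einterval_nonempty[OF ab] by blast
  define R where "R t = (if x0 \<le> t then \<phi> t else 0)" for t
  define L where "L t = (if t \<le> x0 then \<phi> t else 0)" for t
  have \<phi>n: "(\<lambda>t. norm (\<phi> t)) integrable_on I" using \<phi> by (simp add: absolutely_integrable_on_def)
  have cutint: "(\<lambda>t. if t \<in> {c..d} then \<phi> t else 0) integrable_on I \<and> integral I (\<lambda>t. if t \<in> {c..d} then \<phi> t else 0) = integral {c..d} \<phi>"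
    if "c \<in> I" "d \<in> I" for c d
  proof -
    have sub: "{c..d} \<subseteq> I" by (rule einterval_ivl_subset[OF that])
    have *: "(\<lambda>t. if t \<in> I then if t \<in> {c..d} then \<phi> t else 0 else 0) = (\<lambda>t. if t \<in> {c..d} then \<phi> t else 0)"
      using sub by (auto simp: fun_eq_iff)
    have "\<phi> integrable_on {c..d}" using set_integrable_subset[OF \<phi> _ sub] by (simp add: absolutely_integrable_on_def)
    then have "(\<lambda>t. if t \<in> {c..d} then \<phi> t else 0) integrable_on UNIV" by (simp only: integrable_restrict_UNIV)
    then have "(\<lambda>t. if t \<in> {c..d} then \<phi> t else 0) integrable_on I" by (subst integrable_restrict_UNIV[symmetric]) (simp only: *)
    moreover have "integral I (\<lambda>t. if t \<in> {c..d} then \<phi> t else 0) = integral UNIV (\<lambda>t. if t \<in> I then if t \<in> {c..d} then \<phi> t else 0 else 0)"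
      by (simp only: integral_restrict_UNIV)
    then have "integral I (\<lambda>t. if t \<in> {c..d} then \<phi> t else 0) = integral {c..d} \<phi>"
      by (simp only: * integral_restrict_UNIV)
    ultimately show ?thesis by blast
  qed
  have R: "end_limit b W (W x0 + integral I R)"
    unfolding end_limit_def tendsto_at_iff_sequentially
  proof (intro allI impI)
    fix X :: "nat \<Rightarrow> ereal" assume X: "\<forall>i. X i \<in> {a<..<b} - {b}" "X \<longlonglongrightarrow> b"
    define y where "y n = real_of_ereal (X n)" for n
    have y: "y n \<in> I" "ereal (y n) = X n" for n using real_of_ereal_I[of "X n"] X(1) by (auto simp: y_def)
    have ev: "\<forall>\<^sub>F n in sequentially. t < y n" if "t \<in> I" for t
    proof -
      have "\<forall>\<^sub>F n in sequentially. ereal t < X n" using that by (intro order_tendstoD(1)[OF X(2)]) (simp add: einterval_iff)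
      then show ?thesis by eventually_elim (simp flip: y(2))
    qed
    have "(\<lambda>n. integral I (\<lambda>t. if t \<in> {x0..y n} then \<phi> t else 0)) \<longlonglongrightarrow> integral I R"
    proof (rule dominated_convergence(2)[OF _ \<phi>n])
      show "(\<lambda>t. if t \<in> {x0..y n} then \<phi> t else 0) integrable_on I" for n using cutint[OF x0 y(1)] by blast
      show "(\<lambda>n. if t \<in> {x0..y n} then \<phi> t else 0) \<longlonglongrightarrow> R t" if "t \<in> I" for t
        by (rule tendsto_eventually, rule eventually_mono[OF ev[OF that]]) (auto simp: R_def)
    qed auto
    then have "(\<lambda>n. W x0 + integral {x0..y n} \<phi>) \<longlonglongrightarrow> W x0 + integral I R"
      using cutint[OF x0 y(1)] by (intro tendsto_intros) simp
    then have "(\<lambda>n. W (y n)) \<longlonglongrightarrow> W x0 + integral I R"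
      by (rule Lim_transform_eventually)
         (rule eventually_mono[OF ev[OF x0]], simp add: indefD(2)[OF W _ einterval_ivl_subset[OF x0 y(1)]])
    then show "((\<lambda>X. W (real_of_ereal X)) \<circ> X) \<longlonglongrightarrow> W x0 + integral I R" by (simp add: y_def o_def)
  qed
  have L: "end_limit a W (W x0 - integral I L)"
    unfolding end_limit_def tendsto_at_iff_sequentially
  proof (intro allI impI)
    fix X :: "nat \<Rightarrow> ereal" assume X: "\<forall>i. X i \<in> {a<..<b} - {a}" "X \<longlonglongrightarrow> a"
    define y where "y n = real_of_ereal (X n)" for n
    have y: "y n \<in> I" "ereal (y n) = X n" for n using real_of_ereal_I[of "X n"] X(1) by (auto simp: y_def)
    have ev: "\<forall>\<^sub>F n in sequentially. y n < t" if "t \<in> I" for t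
    proof -
      have "\<forall>\<^sub>F n in sequentially. X n < ereal t" using that by (intro order_tendstoD(2)[OF X(2)]) (simp add: einterval_iff)
      then show ?thesis by eventually_elim (simp flip: y(2))
    qed
    have "(\<lambda>n. integral I (\<lambda>t. if t \<in> {y n..x0} then \<phi> t else 0)) \<longlonglongrightarrow> integral I L"
    proof (rule dominated_convergence(2)[OF _ \<phi>n])
      show "(\<lambda>t. if t \<in> {y n..x0} then \<phi> t else 0) integrable_on I" for n using cutint[OF y(1) x0] by blast
      show "(\<lambda>n. if t \<in> {y n..x0} then \<phi> t else 0) \<longlonglongrightarrow> L t" if "t \<in> I" for t
        by (rule tendsto_eventually, rule eventually_mono[OF ev[OF that]]) (auto simp: L_def)
    qed auto
    then have "(\<lambda>n. W x0 - integral {y n..x0} \<phi>) \<longlonglongrightarrow> W x0 - integral I L"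
      using cutint[OF y(1) x0] by (intro tendsto_intros) simp
    then have "(\<lambda>n. W (y n)) \<longlonglongrightarrow> W x0 - integral I L"
      by (rule Lim_transform_eventually)
         (rule eventually_mono[OF ev[OF x0]], simp add: indefD(2)[OF W _ einterval_ivl_subset[OF y(1) x0]])
    then show "((\<lambda>X. W (real_of_ereal X)) \<circ> X) \<longlonglongrightarrow> W x0 - integral I L" by (simp add: y_def o_def)
  qed
  have ab: "R integrable_on I" "L integrable_on I"
  proof -
    have "(\<lambda>t. if t \<in> {x0..} \<inter> I then \<phi> t else 0) absolutely_integrable_on UNIV" "(\<lambda>t. if t \<in> {..x0} \<inter> I then \<phi> t else 0) absolutely_integrable_on UNIV"
      unfolding absolutely_integrable_restrict_UNIV by (rule set_integrable_subset[OF \<phi>]; auto)+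
    moreover have "(\<lambda>t. if t \<in> {x0..} \<inter> I then \<phi> t else 0) = (\<lambda>t. if t \<in> I then R t else 0)" "(\<lambda>t. if t \<in> {..x0} \<inter> I then \<phi> t else 0) = (\<lambda>t. if t \<in> I then L t else 0)"
      by (auto simp: R_def L_def)
    ultimately show "R integrable_on I" "L integrable_on I"
      by (simp_all only: absolutely_integrable_restrict_UNIV) (simp_all add: absolutely_integrable_on_def)
  qed
  have "integral I R + integral I L = integral I (\<lambda>t. R t + L t)"
    by (rule Henstock_Kurzweil_Integration.integral_add[OF ab, symmetric])
  also have "\<dots> = integral I \<phi>"
    by (rule integral_spike[of "{x0}"]) (auto simp: R_def L_def)
  finally have "integral I R + integral I L = integral I \<phi>" .
  with L R show ?thesis by (intro that[OF L R]) simp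
qed

abbreviation wend :: "ereal \<Rightarrow> (real \<Rightarrow> complex) \<Rightarrow> (real \<Rightarrow> complex) \<Rightarrow> complex" where
  "wend c f g \<equiv> wronskian_end a b p s c f g"

text \<open>Lagrange's identity expresses the Wronskian as an indefinite integral of products of
  square integrable functions, which are integrable up to the endpoints. Hence the limits hidden in
  \<open>wronskian_end\<close> exist.\<close>

lemma wend_limits:
  assumes f: "max_triple f h k" and g: "max_triple g h' k'"
  shows "c \<in> {a, b} \<Longrightarrow> end_limit c (\<lambda>x. f x * h' x - h x * g x) (wend c f g)"
    "wend b f g - wend a f g = (LINT x|M. k x * g x - f x * k' x)"
proof -
  note F = max_tripleD[OF f] and G = max_tripleD[OF g]
  have i: "integrable M (\<lambda>x. k x * g x - f x * k' x)"
    by (intro Bochner_Integration.integrable_diff sq_integrable_mult F G)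
  then have "(\<lambda>x. of_real (r x) * (k x * g x - f x * k' x)) absolutely_integrable_on I"
    using integrable_M[OF borel_measurable_integrable[OF i]] by simp
  moreover have "indef I (\<lambda>x. f x * h' x - h x * g x) (\<lambda>x. of_real (r x) * (k x * g x - f x * k' x))"
    using lagrange[OF F(1) G(1)] by (simp add: algebra_simps)
  ultimately obtain A B where AB: "end_limit a (\<lambda>x. f x * h' x - h x * g x) A" "end_limit b (\<lambda>x. f x * h' x - h x * g x) B"
      "B - A = integral I (\<lambda>x. of_real (r x) * (k x * g x - f x * k' x))"
    using indef_end_limits by blast
  have lim: "wend c f g = L" if "c \<in> {a, b}" "end_limit c (\<lambda>x. f x * h' x - h x * g x) L" for c L
  proof -
    have "end_limit c (wronskian a b p s f g) L"
      by (rule end_limit_cong[OF that(2)]) (simp add: wronskian_def triple_dmax(2)[OF f] triple_dmax(2)[OF g])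
    then show ?thesis unfolding wronskian_end_def end_limit_def
      using tendsto_Lim[OF end_nontrivial[OF that(1)]] by blast
  qed
  show "end_limit c (\<lambda>x. f x * h' x - h x * g x) (wend c f g)" if "c \<in> {a, b}" for c
    using that lim[of a A] lim[of b B] AB by auto
  show "wend b f g - wend a f g = (LINT x|M. k x * g x - f x * k' x)"
    using lim[of a A] lim[of b B] AB integral_M[OF i] by simp
qed

lemma wend_unique:
  assumes "c \<in> {a, b}" "max_triple f h k" "max_triple g h' k'" "end_limit c (\<lambda>x. f x * h' x - h x * g x) L"
  shows "wend c f g = L"
  using end_limit_unique[OF assms(1) wend_limits(1)[OF assms(2,3,1)] assms(4)] .

lemma dmax_cnj: "f \<in> dmax \<Longrightarrow> cnj \<circ> f \<in> dmax"
  using triple_dmax(1)[OF triple_cnj[OF dmax_triple]] by (simp add: o_def)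

lemma dmax_lin: "f \<in> dmax \<Longrightarrow> g \<in> dmax \<Longrightarrow> (\<lambda>x. \<alpha> * f x + \<beta> * g x) \<in> dmax"
  using triple_dmax(1)[OF triple_add[OF triple_cmult triple_cmult]] dmax_triple by blast

lemma wend_lin_left:
  assumes c: "c \<in> {a, b}" and f: "f \<in> dmax" and g: "g \<in> dmax" and h: "h \<in> dmax"
  shows "wend c (\<lambda>x. \<alpha> * f x + \<beta> * g x) h = \<alpha> * wend c f h + \<beta> * wend c g h"
proof (rule wend_unique[OF c triple_add[OF triple_cmult[OF dmax_triple[OF f]] triple_cmult[OF dmax_triple[OF g]]] dmax_triple[OF h]])
  have "end_limit c (\<lambda>x. \<alpha> * (f x * qd h x - qd f x * h x) + \<beta> * (g x * qd h x - qd g x * h x)) (\<alpha> * wend c f h + \<beta> * wend c g h)"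
    using wend_limits(1)[OF dmax_triple[OF f] dmax_triple[OF h] c] wend_limits(1)[OF dmax_triple[OF g] dmax_triple[OF h] c]
    unfolding end_limit_def by (intro tendsto_intros)
  then show "end_limit c (\<lambda>x. (\<alpha> * f x + \<beta> * g x) * qd h x - (\<alpha> * qd f x + \<beta> * qd g x) * h x) (\<alpha> * wend c f h + \<beta> * wend c g h)"
    by (simp add: algebra_simps)
qed

lemma wend_antisym:
  assumes c: "c \<in> {a, b}" and f: "f \<in> dmax" and g: "g \<in> dmax"
  shows "wend c g f = - wend c f g"
proof (rule wend_unique[OF c dmax_triple[OF g] dmax_triple[OF f]])
  have "end_limit c (\<lambda>x. - (f x * qd g x - qd f x * g x)) (- wend c f g)"
    using wend_limits(1)[OF dmax_triple[OF f] dmax_triple[OF g] c]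
    unfolding end_limit_def by (intro tendsto_intros)
  then show "end_limit c (\<lambda>x. g x * qd f x - qd g x * f x) (- wend c f g)"
    by (simp add: algebra_simps)
qed

lemma wend_cnj:
  assumes c: "c \<in> {a, b}" and f: "f \<in> dmax" and g: "g \<in> dmax"
  shows "wend c (cnj \<circ> f) (cnj \<circ> g) = cnj (wend c f g)"
  unfolding o_def
proof (rule wend_unique[OF c triple_cnj[OF dmax_triple[OF f]] triple_cnj[OF dmax_triple[OF g]]])
  have "end_limit c (\<lambda>x. cnj (f x * qd g x - qd f x * g x)) (cnj (wend c f g))"
    using wend_limits(1)[OF dmax_triple[OF f] dmax_triple[OF g] c]
    unfolding end_limit_def by (intro tendsto_intros)
  then show "end_limit c (\<lambda>x. cnj (f x) * cnj (qd g x) - cnj (qd f x) * cnj (g x)) (cnj (wend c f g))"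
    by simp
qed

text \<open>The identity for determinants holds at every point and passes to the limit, because each
  Wronskian converges. The functions and their quasi-derivatives need not converge
  themselves.\<close>

lemma wend_pluecker:
  assumes c: "c \<in> {a, b}" and f: "f1 \<in> dmax" "f2 \<in> dmax" "f3 \<in> dmax" "f4 \<in> dmax"
  shows "wend c f1 f2 * wend c f3 f4 + wend c f1 f3 * wend c f4 f2 + wend c f1 f4 * wend c f2 f3 = 0"
proof (rule end_limit_unique[OF c])
  let ?w = "\<lambda>f g x. f x * qd g x - qd f x * g x"
  have w: "((\<lambda>X. ?w f g (real_of_ereal X)) \<longlongrightarrow> wend c f g) (at c within {a<..<b})" if "f \<in> dmax" "g \<in> dmax" for f g
    using wend_limits(1)[OF dmax_triple[OF that(1)] dmax_triple[OF that(2)] c] by (simp add: end_limit_def)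
  show "end_limit c (\<lambda>x. ?w f1 f2 x * ?w f3 f4 x + ?w f1 f3 x * ?w f4 f2 x + ?w f1 f4 x * ?w f2 f3 x)
      (wend c f1 f2 * wend c f3 f4 + wend c f1 f3 * wend c f4 f2 + wend c f1 f4 * wend c f2 f3)"
    unfolding end_limit_def by (intro tendsto_add tendsto_mult w f)
  have "(\<lambda>x. ?w f1 f2 x * ?w f3 f4 x + ?w f1 f3 x * ?w f4 f2 x + ?w f1 f4 x * ?w f2 f3 x) = (\<lambda>x. 0)"
    by (simp add: algebra_simps)
  then show "end_limit c (\<lambda>x. ?w f1 f2 x * ?w f3 f4 x + ?w f1 f3 x * ?w f4 f2 x + ?w f1 f4 x * ?w f2 f3 x) 0"
    by (simp add: end_limit_def)
qed

lemma dmax_cong: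
  assumes "f \<in> dmax" "\<And>x. x \<in> I \<Longrightarrow> g x = f x"
  shows "g \<in> dmax" "AE x in M. T g x = T f x" "\<And>x. x \<in> I \<Longrightarrow> qd g x = qd f x"
proof -
  have "max_triple g (qd f) (T f)" by (rule triple_cong[OF dmax_triple[OF assms(1)]]) (use assms(2) in auto)
  note this[THEN triple_dmax(1)] this[THEN triple_dmax(3)] this[THEN triple_dmax(2)]
  then show "g \<in> dmax" "AE x in M. T g x = T f x" "\<And>x. x \<in> I \<Longrightarrow> qd g x = qd f x" by auto
qed

lemma wend_local:
  assumes c: "c \<in> {a, b}" and fg: "f \<in> dmax" "f' \<in> dmax" "g \<in> dmax"
    and eq: "\<forall>\<^sub>F X in at c within {a<..<b}. f' (real_of_ereal X) = f (real_of_ereal X) \<and> qd f' (real_of_ereal X) = qd f (real_of_ereal X)"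
  shows "wend c f' g = wend c f g"
proof (rule wend_unique[OF c dmax_triple[OF fg(2)] dmax_triple[OF fg(3)]])
  show "end_limit c (\<lambda>x. f' x * qd g x - qd f' x * g x) (wend c f g)"
    using wend_limits(1)[OF dmax_triple[OF fg(1)] dmax_triple[OF fg(3)] c]
    unfolding end_limit_def
    by (rule Lim_transform_eventually) (use eq in eventually_elim, simp)
qed

lemma eventually_near_a: "x \<in> I \<Longrightarrow> \<forall>\<^sub>F X in at a within {a<..<b}. real_of_ereal X \<in> I \<and> real_of_ereal X \<le> x"
proof -
  assume "x \<in> I"
  then have "\<forall>\<^sub>F X in at a within {a<..<b}. X < ereal x"
    by (intro order_tendstoD(2)[OF tendsto_ident_at]) (simp add: einterval_iff)
  moreover have "\<forall>\<^sub>F X in at a within {a<..<b}. X \<in> {a<..<b}" by (auto simp: eventually_at_filter)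
  ultimately show ?thesis
    by eventually_elim (metis real_of_ereal_I ereal_less_eq(3) less_imp_le)
qed

lemma eventually_near_b: "x \<in> I \<Longrightarrow> \<forall>\<^sub>F X in at b within {a<..<b}. real_of_ereal X \<in> I \<and> x \<le> real_of_ereal X"
proof -
  assume "x \<in> I"
  then have "\<forall>\<^sub>F X in at b within {a<..<b}. ereal x < X"
    by (intro order_tendstoD(1)[OF tendsto_ident_at]) (simp add: einterval_iff)
  moreover have "\<forall>\<^sub>F X in at b within {a<..<b}. X \<in> {a<..<b}" by (auto simp: eventually_at_filter)
  ultimately show ?thesis
    by eventually_elim (metis real_of_ereal_I ereal_less_eq(3) less_imp_le)
qed

lemma dmax_patch:
  assumes f1: "f1 \<in> dmax" and f2: "f2 \<in> dmax"
  obtains f where "f \<in> dmax" "\<And>g. g \<in> dmax \<Longrightarrow> wend a f g = wend a f1 g" "\<And>g. g \<in> dmax \<Longrightarrow> wend b f g = wend b f2 g"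
proof -
  obtain f h k c d where *: "max_triple f h k" "c < d" "{c..d} \<subseteq> I"
    "\<And>x. x \<in> I \<Longrightarrow> x \<le> c \<Longrightarrow> f x = f1 x \<and> h x = qd f1 x" "\<And>x. x \<in> I \<Longrightarrow> d \<le> x \<Longrightarrow> f x = f2 x \<and> h x = qd f2 x"
    using naimark_patching[OF dmax_triple[OF f1] dmax_triple[OF f2]] by blast
  note q = triple_dmax(2)[OF *(1)]
  have cd: "c \<in> I" "d \<in> I" using *(2,3) by (auto simp: subset_iff)
  have f: "f \<in> dmax" by (rule triple_dmax(1)[OF *(1)])
  have A: "wend a f g = wend a f1 g" if "g \<in> dmax" for g
    by (rule wend_local[OF _ f1 f that]) (simp, rule eventually_mono[OF eventually_near_a[OF cd(1)]], use *(4) q in auto)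
  have B: "wend b f g = wend b f2 g" if "g \<in> dmax" for g
    by (rule wend_local[OF _ f2 f that]) (simp, rule eventually_mono[OF eventually_near_b[OF cd(2)]], use *(5) q in auto)
  from f A B show ?thesis by (rule that)
qed

end

text \<open>By \<open>green\<close> below this is \<open>W(f, cnj g)(c)\<close> in the coordinates \<open>(BC1, BC2)\<close> of \<open>f\<close> and \<open>g\<close>.\<close>

definition bform :: "complex \<times> complex \<Rightarrow> complex \<times> complex \<Rightarrow> complex" where
  "bform x y = fst x * cnj (snd y) - snd x * cnj (fst y)"

definition bform2 :: "(complex \<times> complex) \<times> (complex \<times> complex) \<Rightarrow> (complex \<times> complex) \<times> (complex \<times> complex) \<Rightarrow> complex" where
  "bform2 p q = bform (snd p) (snd q) - bform (fst p) (fst q)"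

text \<open>Its fixed points are the Lagrangian subspaces. An orthogonal complement is always a
  subspace, so linearity need not be required of \<open>L\<close>; see
  \<open>lagrangian_comb\<close>.\<close>

definition bform_perp :: "((complex \<times> complex) \<times> (complex \<times> complex)) set \<Rightarrow> ((complex \<times> complex) \<times> (complex \<times> complex)) set" where
  "bform_perp L = {p. \<forall>q\<in>L. bform2 p q = 0}"

lemma bform_swap: "bform y x = - cnj (bform x y)"
  by (simp add: bform_def)

lemma bform2_swap: "bform2 q p = - cnj (bform2 p q)"
  by (simp add: bform2_def bform_def)

lemma bform2_zero_swap: "bform2 q p = 0 \<longleftrightarrow> bform2 p q = 0"
  using bform2_swap[of q p] by auto

section \<open>Boundary values as coordinates\<close>

locale boundary_functionals = sturm_liouville +
  fixes w1 w2 :: "real \<Rightarrow> complex"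
  assumes w1: "w1 \<in> dom_Tmax a b p q r s" and w2: "w2 \<in> dom_Tmax a b p q r s"
    and w12: "\<And>c. c \<in> {a, b} \<Longrightarrow> wronskian_end a b p s c w1 (cnj \<circ> w2) = 1"
    and w11: "\<And>c. c \<in> {a, b} \<Longrightarrow> wronskian_end a b p s c w1 (cnj \<circ> w1) = 0"
    and w22: "\<And>c. c \<in> {a, b} \<Longrightarrow> wronskian_end a b p s c w2 (cnj \<circ> w2) = 0"
begin

definition BC :: "ereal \<Rightarrow> (real \<Rightarrow> complex) \<Rightarrow> complex \<times> complex" where
  "BC c f = (BC1 a b p s w2 c f, BC2 a b p s w1 c f)"

lemma BC_eq: 
  assumes "c \<in> {a, b}" "f \<in> dmax"
  shows "BC c f = (wend c f (cnj \<circ> w2), - wend c f (cnj \<circ> w1))"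
  by (simp add: BC_def BC1_def BC2_def wend_antisym[OF assms dmax_cnj[OF w1]])

text \<open>Pluecker's identity expands every Wronskian at \<open>c\<close> in terms of \<open>cnj w1\<close> and \<open>cnj w2\<close>. As \<open>w1\<close> and
  \<open>w2\<close> are not assumed real, their own expansions bring in the factor \<open>\<mu> = W(cnj w1, cnj w2)(c)\<close>, which has
  modulus 1 and cancels.\<close>

lemma green:
  assumes c: "c \<in> {a, b}" and f: "f \<in> dmax" and g: "g \<in> dmax"
  shows "wend c f (cnj \<circ> g) = bform (BC c f) (BC c g)"
proof -
  let ?A = "cnj \<circ> w1" and ?B = "cnj \<circ> w2" and ?g = "cnj \<circ> g"
  note A = dmax_cnj[OF w1] and B = dmax_cnj[OF w2] and gc = dmax_cnj[OF g]
  define \<mu> where "\<mu> = wend c ?A ?B"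
  have w2A: "wend c w2 ?A = - 1"
  proof -
    have "wend c w2 ?A = cnj (wend c ?B w1)" using wend_cnj[OF c B w1] by (simp add: o_def)
    also have "\<dots> = - 1" using wend_antisym[OF c w1 B] w12[OF c] by simp
    finally show ?thesis .
  qed
  have Bw2: "wend c ?B w2 = 0" using wend_antisym[OF c w2 B] w22[OF c] by simp
  have Bw1: "wend c ?B w1 = - 1" using wend_antisym[OF c w1 B] w12[OF c] by simp
  have "wend c g w2 * \<mu> + wend c g ?A * wend c ?B w2 + wend c g ?B * wend c w2 ?A = 0"
    unfolding \<mu>_def by (rule wend_pluecker[OF c g w2 A B])
  then have 1: "wend c g w2 * \<mu> = wend c g ?B" using Bw2 w2A by simp
  have "wend c g w1 * \<mu> + wend c g ?A * wend c ?B w1 + wend c g ?B * wend c w1 ?A = 0"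
    unfolding \<mu>_def by (rule wend_pluecker[OF c g w1 A B])
  then have 2: "wend c g w1 * \<mu> = wend c g ?A" using Bw1 w11[OF c] by simp
  have "wend c w1 w2 * \<mu> + wend c w1 ?A * wend c ?B w2 + wend c w1 ?B * wend c w2 ?A = 0"
    unfolding \<mu>_def by (rule wend_pluecker[OF c w1 w2 A B])
  then have "wend c w1 w2 * \<mu> = 1" using Bw2 w2A w12[OF c] by simp
  moreover have "wend c w1 w2 = cnj \<mu>" using wend_cnj[OF c w1 w2] by (simp add: \<mu>_def)
  ultimately have mu: "cnj \<mu> * \<mu> = 1" by simp
  have "wend c f ?g * \<mu> + wend c f ?A * wend c ?B ?g + wend c f ?B * wend c ?g ?A = 0"
    unfolding \<mu>_def by (rule wend_pluecker[OF c f gc A B])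
  moreover have "wend c ?B ?g = - cnj (wend c g w2)" using wend_cnj[OF c w2 g] wend_antisym[OF c g w2] by simp
  moreover have "wend c ?g ?A = cnj (wend c g w1)" using wend_cnj[OF c g w1] by simp
  ultimately have "wend c f ?g * \<mu> = wend c f ?A * cnj (wend c g w2) - wend c f ?B * cnj (wend c g w1)"
    by (simp add: algebra_simps)
  then have "cnj \<mu> * (wend c f ?g * \<mu>) = wend c f ?A * cnj (wend c g w2 * \<mu>) - wend c f ?B * cnj (wend c g w1 * \<mu>)"
    by (simp only:) (simp add: algebra_simps)
  moreover have "cnj \<mu> * (wend c f ?g * \<mu>) = wend c f ?g * (cnj \<mu> * \<mu>)" by (simp add: mult_ac)
  ultimately have "wend c f ?g * (cnj \<mu> * \<mu>) = wend c f ?A * cnj (wend c g w2 * \<mu>) - wend c f ?B * cnj (wend c g w1 * \<mu>)"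
    by (simp only:)
  then show ?thesis
    unfolding mu 1 2 by (simp add: BC_eq[OF c f] BC_eq[OF c g] bform_def)
qed

lemma BC_lin:
  assumes c: "c \<in> {a, b}" and f: "f \<in> dmax" and g: "g \<in> dmax"
  shows "BC c (\<lambda>x. \<alpha> * f x + \<beta> * g x) = (\<alpha> * fst (BC c f) + \<beta> * fst (BC c g), \<alpha> * snd (BC c f) + \<beta> * snd (BC c g))"
  by (simp add: BC_eq[OF c f] BC_eq[OF c g] BC_eq[OF c dmax_lin[OF f g]] wend_lin_left[OF c f g] dmax_cnj w1 w2)

text \<open>\<open>w1\<close> and \<open>w2\<close> have boundary values \<open>(1, 0)\<close> and
  \<open>(0, 1)\<close> at both endpoints. Two combinations of them, one for each endpoint, are
  patched together.\<close>

lemma BC_surj: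
  obtains f where "f \<in> dmax" "BC a f = x" "BC b f = y"
proof -
  have c: "a \<in> {a, b}" "b \<in> {a, b}" by auto
  have e: "BC c w1 = (1, 0) \<and> BC c w2 = (0, 1)" if "c \<in> {a, b}" for c
  proof -
    have "wend c w2 (cnj \<circ> w1) = cnj (wend c (cnj \<circ> w2) w1)" using wend_cnj[OF that dmax_cnj[OF w2] w1] by (simp add: o_def)
    also have "\<dots> = - 1" using wend_antisym[OF that w1 dmax_cnj[OF w2]] w12[OF that] by simp
    finally show ?thesis by (simp add: BC_eq[OF that] w1 w2 w11[OF that] w22[OF that] w12[OF that])
  qed
  obtain f where f: "f \<in> dmax"
    "\<And>g. g \<in> dmax \<Longrightarrow> wend a f g = wend a (\<lambda>t. fst x * w1 t + snd x * w2 t) g"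
    "\<And>g. g \<in> dmax \<Longrightarrow> wend b f g = wend b (\<lambda>t. fst y * w1 t + snd y * w2 t) g"
    using dmax_patch[OF dmax_lin[OF w1 w2] dmax_lin[OF w1 w2]] by blast
  have "BC a f = BC a (\<lambda>t. fst x * w1 t + snd x * w2 t)"
    unfolding BC_eq[OF c(1) f(1)] BC_eq[OF c(1) dmax_lin[OF w1 w2]] by (simp add: f(2) dmax_cnj w1 w2)
  moreover have "BC b f = BC b (\<lambda>t. fst y * w1 t + snd y * w2 t)"
    unfolding BC_eq[OF c(2) f(1)] BC_eq[OF c(2) dmax_lin[OF w1 w2]] by (simp add: f(3) dmax_cnj w1 w2)
  ultimately show ?thesis
    using f(1) e[OF c(1)] e[OF c(2)] by (intro that[of f]) (simp_all add: BC_lin[OF _ w1 w2])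
qed

lemma BC_cong:
  assumes "c \<in> {a, b}" "f \<in> dmax" "\<And>x. x \<in> I \<Longrightarrow> g x = f x"
  shows "BC c g = BC c f"
proof -
  note g = dmax_cong[OF assms(2,3)]
  have "wend c g h = wend c f h" if "h \<in> dmax" for h
    by (rule wend_local[OF assms(1,2) g(1) that])
       (auto simp: eventually_at_filter assms(3) g(3) real_of_ereal_I)
  then show ?thesis by (simp add: BC_eq[OF assms(1) g(1)] BC_eq[OF assms(1,2)] dmax_cnj w1 w2)
qed

definition BB :: "(real \<Rightarrow> complex) \<Rightarrow> (complex \<times> complex) \<times> (complex \<times> complex)" where
  "BB f = (BC a f, BC b f)"

text \<open>Lagrange's identity is bilinear and \<open>ip\<close> conjugates its first argument, so
  it is applied to \<open>g\<close> and the conjugate of \<open>f\<close>; this explains the order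
  in \<open>bform2\<close>.\<close>

lemma ip_green:
  assumes f: "f \<in> dmax" and g: "g \<in> dmax"
  shows "ip M f (T g) - ip M (T f) g = bform2 (BB g) (BB f)"
proof -
  note F = dmax_triple[OF f] and G = dmax_triple[OF g]
  have c: "a \<in> {a, b}" "b \<in> {a, b}" by auto
  have "(LINT x|M. T g x * cnj (f x) - g x * cnj (T f x)) = wend b g (cnj \<circ> f) - wend a g (cnj \<circ> f)"
    using wend_limits(2)[OF G triple_cnj[OF F]] by (simp add: o_def)
  also have "\<dots> = bform2 (BB g) (BB f)" by (simp add: green[OF c(1) g f] green[OF c(2) g f] bform2_def BB_def)
  also have "(LINT x|M. T g x * cnj (f x) - g x * cnj (T f x)) = (LINT x|M. cnj (f x) * T g x - cnj (T f x) * g x)"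
    by (simp add: mult.commute)
  also have "\<dots> = ip M f (T g) - ip M (T f) g"
    unfolding ip_def
    by (rule Bochner_Integration.integral_diff) (intro ip_integrable max_tripleD(2,3)[OF F] max_tripleD(2,3)[OF G])+
  finally show ?thesis by simp
qed

section \<open>Operators given by a set of boundary values\<close>

definition bc_dom :: "((complex \<times> complex) \<times> (complex \<times> complex)) set \<Rightarrow> (real \<Rightarrow> complex) set" where
  "bc_dom L = {g \<in> dmax. BB g \<in> L}"

abbreviation "cl \<equiv> L2_class M"
abbreviation "tauop \<equiv> tau_operator a b p q r s"

lemma dmax_sq: "f \<in> dmax \<Longrightarrow> f \<in> sq_integrable M" "f \<in> dmax \<Longrightarrow> T f \<in> sq_integrable M"
  using max_tripleD dmax_triple by blast+

lemma dmax_meas: "f \<in> dmax \<Longrightarrow> f \<in> borel_measurable M" "f \<in> dmax \<Longrightarrow> T f \<in> borel_measurable M"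
  using dmax_sq sq_integrableD by blast+

lemma triple_AE_eq:
  assumes "quasi_system f h g" "quasi_system f' h' g'" "AE x in M. f x = f' x" "x \<in> I"
  shows "f x = f' x"
proof -
  obtain N where N: "negligible N" "\<And>x. x \<in> I - N \<Longrightarrow> f x = f' x"
    using assms(3) unfolding AE_M by (subst (asm) AE_lebesgue_on_iff) auto
  show ?thesis
    by (rule continuous_AE_eq[OF quasi_system_continuous(1)[OF assms(1)] quasi_system_continuous(1)[OF assms(2)] open_einterval N assms(4)])
qed

text \<open>A class has only one continuous representative on \<open>I\<close>, so the image under
  \<tau> and the boundary values are functions of the class.\<close>

lemma class_eq:
  assumes f: "f \<in> dmax" and g: "g \<in> dmax" and eq: "cl f = cl g"
  shows "cl (T f) = cl (T g)" "BB f = BB g"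
proof -
  have "AE x in M. g x = f x" using L2_class_eq_iff[OF dmax_meas(1)[OF g] dmax_meas(1)[OF f]] eq by simp
  then have *: "g x = f x" if "x \<in> I" for x
    using triple_AE_eq[OF max_tripleD(1)[OF dmax_triple[OF g]] max_tripleD(1)[OF dmax_triple[OF f]] _ that] by simp
  show "cl (T f) = cl (T g)"
    unfolding L2_class_eq_iff[OF dmax_meas(2)[OF f] dmax_meas(2)[OF g]]
    by (rule AE_mp[OF dmax_cong(2)[OF f *]]) auto
  have "BC c g = BC c f" if "c \<in> {a, b}" for c by (rule BC_cong[OF that f *])
  from this[of a] this[of b] show "BB f = BB g" by (simp add: BB_def)
qed

lemma BB_lin: "f \<in> dmax \<Longrightarrow> g \<in> dmax \<Longrightarrow> BB (\<lambda>x. \<alpha> * f x + \<beta> * g x) =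
   ((\<alpha> * fst (BC a f) + \<beta> * fst (BC a g), \<alpha> * snd (BC a f) + \<beta> * snd (BC a g)),
    (\<alpha> * fst (BC b f) + \<beta> * fst (BC b g), \<alpha> * snd (BC b f) + \<beta> * snd (BC b g)))"
  unfolding BB_def using BC_lin[of a f g \<alpha> \<beta>] BC_lin[of b f g \<alpha> \<beta>] by (simp only: insertI1 insert_iff simp_thms)

lemma BB_surj: obtains f where "f \<in> dmax" "BB f = z"
proof -
  obtain f where "f \<in> dmax" "BC a f = fst z" "BC b f = snd z" by (rule BC_surj)
  then show ?thesis by (intro that[of f]) (simp_all add: BB_def)
qed

lemma perp_lin:
  assumes "bform_perp L = L" "f \<in> bc_dom L" "g \<in> bc_dom L"
  shows "(\<lambda>x. \<alpha> * f x + \<beta> * g x) \<in> bc_dom L"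
proof -
  have f: "f \<in> dmax" "BB f \<in> bform_perp L" and g: "g \<in> dmax" "BB g \<in> bform_perp L"
    using assms by (auto simp: bc_dom_def)
  have "BB (\<lambda>x. \<alpha> * f x + \<beta> * g x) \<in> bform_perp L"
    unfolding bform_perp_def
  proof (intro CollectI ballI)
    fix q assume q: "q \<in> L"
    have "bform2 (BB (\<lambda>x. \<alpha> * f x + \<beta> * g x)) q = \<alpha> * bform2 (BB f) q + \<beta> * bform2 (BB g) q"
      unfolding BB_lin[OF f(1) g(1)] by (simp add: bform2_def bform_def BB_def algebra_simps)
    then show "bform2 (BB (\<lambda>x. \<alpha> * f x + \<beta> * g x)) q = 0" using f g q by (auto simp: bform_perp_def)
  qed
  then show ?thesis using assms(1) f g dmax_lin by (simp add: bc_dom_def)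
qed

text \<open>Near each endpoint \<open>f\<close> agrees with the zero function. Such functions
  therefore lie in every domain \<open>bc_dom L\<close> with \<open>0\<close> in
  \<open>L\<close>.\<close>

lemma compact_bc_dom:
  assumes f: "max_triple f h k" "{c..d} \<subseteq> I" "c < d" "\<And>x. x \<in> I - {c<..<d} \<Longrightarrow> f x = 0 \<and> h x = 0"
  shows "f \<in> dmax" "BB f = 0"
proof -
  show fd: "f \<in> dmax" by (rule triple_dmax(1)[OF f(1)])
  have z: "max_triple (\<lambda>x. 0) (\<lambda>x. 0) (\<lambda>x. 0)" using triple_cmult[OF f(1), of 0] by simp
  note zd = triple_dmax(1)[OF z] and q = triple_dmax(2)[OF f(1)] and qz = triple_dmax(2)[OF z]
  have cd: "c \<in> I" "d \<in> I" using f(2,3) by (auto simp: subset_iff)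
  have zero: "wend c' (\<lambda>x. 0) g = 0" if "c' \<in> {a, b}" "g \<in> dmax" for c' g
    using wend_lin_left[OF that(1) zd zd that(2), of 0 0] by simp
  have "wend a f g = 0" if "g \<in> dmax" for g
  proof -
    have "wend a f g = wend a (\<lambda>x. 0) g"
      by (rule wend_local[OF _ zd fd that]) (simp, rule eventually_mono[OF eventually_near_a[OF cd(1)]], use f(4) q qz in auto)
    then show ?thesis using zero that by simp
  qed
  moreover have "wend b f g = 0" if "g \<in> dmax" for g
  proof -
    have "wend b f g = wend b (\<lambda>x. 0) g"
      by (rule wend_local[OF _ zd fd that]) (simp, rule eventually_mono[OF eventually_near_b[OF cd(2)]], use f(4) q qz in auto)
    then show ?thesis using zero that by simp
  qed
  ultimately show "BB f = 0" by (simp add: BB_def BC_eq fd dmax_cnj w1 w2 zero_prod_def)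
qed

lemma perp_zero: "bform_perp L = L \<Longrightarrow> 0 \<in> L"
proof -
  assume "bform_perp L = L"
  moreover have "0 \<in> bform_perp L" by (simp add: bform_perp_def bform2_def bform_def)
  ultimately show ?thesis by simp
qed

text \<open>Compactly supported test functions identify the adjoint action as \<tau>. Test functions
  with arbitrary boundary values in \<open>L\<close> then put \<open>BB f\<close> into
  \<open>bform_perp L\<close>.\<close>

lemma adjoint_bc:
  assumes L: "bform_perp L = L" and u: "u \<in> sq_integrable M" and v: "v \<in> sq_integrable M"
    and H: "\<And>g. g \<in> bc_dom L \<Longrightarrow> ip M u (T g) = ip M v g"
  obtains f where "f \<in> bc_dom L" "AE x in M. u x = f x" "AE x in M. T f x = v x"
proof -
  have H': "ip M u k = ip M v f" if "max_triple f h k" "{c..d} \<subseteq> I" "c < d" "\<And>x. x \<in> I - {c<..<d} \<Longrightarrow> f x = 0 \<and> h x = 0" for f h k c d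
  proof -
    have "f \<in> bc_dom L" using compact_bc_dom[OF that] perp_zero[OF L] by (simp add: bc_dom_def)
    then have "ip M u (T f) = ip M v f" by (rule H)
    moreover have "ip M u (T f) = ip M u k"
      using triple_dmax(3)[OF that(1)] max_tripleD(3)[OF that(1)] triple_dmax(4)[OF that(1)] u
      by (intro ip_cong_AE) (auto dest: sq_integrableD(1))
    ultimately show ?thesis by simp
  qed
  obtain f h where f: "max_triple f h v" "AE x in M. u x = f x"
  proof (rule adjoint_main[OF u v])
    fix f h k c d
    assume "max_triple f h k" "{c..d} \<subseteq> I" "c < d" "\<And>x. x \<in> I - {c<..<d} \<Longrightarrow> f x = 0 \<and> h x = 0"
    then show "ip M u k = ip M v f" by (rule H')
  qed
  have fd: "f \<in> dmax" by (rule triple_dmax(1)[OF f(1)])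
  have "BB f \<in> bform_perp L"
    unfolding bform_perp_def
  proof (intro CollectI ballI)
    fix z assume z: "z \<in> L"
    obtain g where g: "g \<in> dmax" "BB g = z" by (rule BB_surj)
    then have gL: "g \<in> bc_dom L" using z by (simp add: bc_dom_def)
    have "ip M f (T g) = ip M u (T g)" "ip M (T f) g = ip M v g"
      using f(2) triple_dmax(3)[OF f(1)] u v dmax_meas[OF fd] dmax_meas[OF g(1)]
      by (auto intro!: ip_cong_AE dest: sq_integrableD(1) elim: eventually_mono)
    then have "bform2 (BB g) (BB f) = 0" using ip_green[OF fd g(1)] H[OF gL] by simp
    then show "bform2 (BB f) z = 0" using g(2) bform2_zero_swap by blast
  qed
  then have "f \<in> bc_dom L" using L fd by (simp add: bc_dom_def)
  then show ?thesis using f(2) triple_dmax(3)[OF f(1)] by (rule that)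
qed

proposition self_adjoint_bc:
  assumes L: "bform_perp L = L"
  shows "self_adjoint_restriction a b p q r s (tauop (bc_dom L))"
proof -
  let ?S = "tauop (bc_dom L)"
  have D: "f \<in> dmax" if "f \<in> bc_dom L" for f using that by (simp add: bc_dom_def)
  have zd: "(\<lambda>x. 0) \<in> bc_dom L"
  proof -
    have "(\<lambda>x. 0 * w1 x + 0 * w1 x) \<in> dmax" by (rule dmax_lin[OF w1 w1])
    moreover have "BB (\<lambda>x. 0 * w1 x + 0 * w1 x) = 0" unfolding BB_lin[OF w1 w1] by (simp add: zero_prod_def)
    ultimately show ?thesis using perp_zero[OF L] by (simp add: bc_dom_def)
  qed
  have T0: "AE x in M. T (\<lambda>x. 0) x = 0"
    using triple_dmax(3)[OF triple_cmult[OF dmax_triple[OF w1], of 0]] by simp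
  have lin: "linear_operator M ?S"
    unfolding linear_operator_def
  proof (intro conjI ballI allI impI)
    show "?S \<subseteq> L2_space M \<times> L2_space M"
    proof (rule subsetI)
      fix z assume "z \<in> ?S"
      then obtain f where f: "f \<in> bc_dom L" "z = (cl f, cl (T f))" by (auto simp: tau_operator_def)
      then show "z \<in> L2_space M \<times> L2_space M" using dmax_sq[OF D[OF f(1)]] by (auto simp: L2_space_def)
    qed
    show "single_valued ?S"
    proof (rule single_valuedI)
      fix x y z assume "(x, y) \<in> ?S" "(x, z) \<in> ?S"
      then show "y = z" unfolding tau_operator_def using class_eq(1) D by blast
    qed
    have "cl (T (\<lambda>x. 0)) = cl (\<lambda>x. 0)" using T0 dmax_meas(2)[OF D[OF zd]] by (subst L2_class_eq_iff) auto
    then show "(cl (\<lambda>_. 0), cl (\<lambda>_. 0)) \<in> ?S" using zd unfolding tau_operator_def by (metis (no_types, lifting) image_eqI)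
    fix f g h k \<alpha> \<beta>
    assume sq: "f \<in> sq_integrable M" "g \<in> sq_integrable M" "h \<in> sq_integrable M" "k \<in> sq_integrable M"
      and S: "(cl f, cl g) \<in> ?S" "(cl h, cl k) \<in> ?S"
    obtain f' h' where f': "f' \<in> bc_dom L" "cl f = cl f'" "cl g = cl (T f')" and h': "h' \<in> bc_dom L" "cl h = cl h'" "cl k = cl (T h')"
      using S unfolding tau_operator_def by auto
    note m = sq_integrableD(1)[OF sq(1)] sq_integrableD(1)[OF sq(2)] sq_integrableD(1)[OF sq(3)] sq_integrableD(1)[OF sq(4)]
    note fm = dmax_meas[OF D[OF f'(1)]] and hm = dmax_meas[OF D[OF h'(1)]]
    let ?e = "\<lambda>x. \<alpha> * f' x + \<beta> * h' x"
    have e: "?e \<in> bc_dom L" by (rule perp_lin[OF L f'(1) h'(1)])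
    note [measurable] = m fm hm
    have ae: "AE x in M. f x = f' x" "AE x in M. g x = T f' x" "AE x in M. h x = h' x" "AE x in M. k x = T h' x"
      using f'(2,3) h'(2,3) by (simp_all add: L2_class_eq_iff)
    have Te: "AE x in M. T ?e x = \<alpha> * T f' x + \<beta> * T h' x"
      by (rule triple_dmax(3)[OF triple_add[OF triple_cmult triple_cmult]]) (rule dmax_triple D f'(1) h'(1))+
    have "cl (\<lambda>x. \<alpha> * f x + \<beta> * h x) = cl ?e"
      using ae(1,3) by (subst L2_class_eq_iff) (measurable, auto elim: eventually_elim2)
    moreover have "cl (\<lambda>x. \<alpha> * g x + \<beta> * k x) = cl (T ?e)"
    proof (subst L2_class_eq_iff)
      show "AE x in M. \<alpha> * g x + \<beta> * k x = T ?e x" using ae(2,4) Te by eventually_elim simp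
      show "T ?e \<in> borel_measurable M" by (rule dmax_meas(2)[OF D[OF e]])
    qed simp_all
    ultimately show "(cl (\<lambda>x. \<alpha> * f x + \<beta> * h x), cl (\<lambda>x. \<alpha> * g x + \<beta> * k x)) \<in> ?S"
      using e unfolding tau_operator_def by (intro image_eqI[of _ _ ?e]) auto
  qed
  have dense: "densely_defined M ?S"
    unfolding densely_defined_def
  proof (intro ballI allI impI)
    fix U and \<epsilon> :: real assume "U \<in> L2_space M" "0 < \<epsilon>"
    then obtain u where u: "u \<in> sq_integrable M" "U = cl u" by (auto simp: L2_space_def)
    have "\<exists>v\<in>bc_dom L. sqn M (\<lambda>x. u x - v x) < \<epsilon>\<^sup>2"
    proof (rule dense_if_orthogonal_trivial[OF _ _ _ _ u(1)])
      show "bc_dom L \<subseteq> sq_integrable M" using D dmax_sq by blast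
      show "bc_dom L \<noteq> {}" using zd by blast
      show "(\<lambda>x. \<alpha> * f x + \<beta> * g x) \<in> bc_dom L" if "f \<in> bc_dom L" "g \<in> bc_dom L" for f g \<alpha> \<beta>
        by (rule perp_lin[OF L that])
      fix v assume v: "v \<in> sq_integrable M" and orth: "\<And>g. g \<in> bc_dom L \<Longrightarrow> ip M g v = 0"
      \<comment> \<open>Orthogonality to the domain says that the pair of 0 and \<open>v\<close>
        belongs to the adjoint. The function produced by \<open>adjoint_bc\<close> is then 0 almost
        everywhere, and so is its image \<open>v\<close>.\<close>
      have "ip M (\<lambda>x. 0) (T g) = ip M v g" if "g \<in> bc_dom L" for g
        using orth[OF that] ip_cnj[of M g v] by (simp add: ip_def)
      from adjoint_bc[OF L sq_integrable_zero v this]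
      obtain f where f: "f \<in> bc_dom L" "AE x in M. 0 = f x" "AE x in M. T f x = v x" by blast
      have "AE x in M. f x = 0" using f(2) by eventually_elim simp
      then have "cl f = cl (\<lambda>x. 0)" using dmax_meas(1)[OF D[OF f(1)]] by (subst L2_class_eq_iff) auto
      from class_eq(1)[OF D[OF f(1)] D[OF zd] this]
      have "AE x in M. T f x = T (\<lambda>x. 0) x"
        using dmax_meas(2)[OF D[OF f(1)]] dmax_meas(2)[OF D[OF zd]] by (simp add: L2_class_eq_iff)
      with f(3) T0 show "AE x in M. v x = 0" by eventually_elim simp
    qed (use \<open>0 < \<epsilon>\<close> in simp)
    then obtain v where v: "v \<in> bc_dom L" "sqn M (\<lambda>x. u x - v x) < \<epsilon>\<^sup>2" by blast
    have "L2_dist M U (cl v) = sqrt (sqn M (\<lambda>x. u x - v x))"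
      unfolding u(2) by (rule L2_dist_class[OF sq_integrableD(1)[OF u(1)] dmax_meas(1)[OF D[OF v(1)]]])
    also have "\<dots> < \<epsilon>" using v(2) \<open>0 < \<epsilon>\<close> by (simp add: real_less_lsqrt)
    finally show "\<exists>V\<in>Domain ?S. L2_dist M U V < \<epsilon>"
      using v(1) by (intro bexI[of _ "cl v"]) (auto simp: tau_operator_def)
  qed
  have "adjoint_operator M ?S = ?S"
  proof (intro set_eqI iffI; clarify)
    fix U V assume "(U, V) \<in> ?S"
    then obtain f where f: "f \<in> bc_dom L" "U = cl f" "V = cl (T f)" by (auto simp: tau_operator_def)
    have "L2_inner M U (cl (T g)) = L2_inner M V (cl g)" if g: "g \<in> bc_dom L" for g
    proof -
      have "BB f \<in> bform_perp L" "BB g \<in> L" using f g L by (auto simp: bc_dom_def)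
      then have "bform2 (BB g) (BB f) = 0" using bform2_zero_swap by (auto simp: bform_perp_def)
      then have "ip M f (T g) = ip M (T f) g" using ip_green[OF D[OF f(1)] D[OF g]] by simp
      then show ?thesis using f dmax_meas[OF D[OF f(1)]] dmax_meas[OF D[OF g]] by (simp add: L2_inner_class)
    qed
    moreover have "U \<in> L2_space M" "V \<in> L2_space M" using f dmax_sq[OF D[OF f(1)]] by (auto simp: L2_space_def)
    ultimately show "(U, V) \<in> adjoint_operator M ?S"
      by (auto simp: adjoint_operator_def tau_operator_def)
  next
    fix U V assume UV: "(U, V) \<in> adjoint_operator M ?S"
    then obtain u v where uv: "u \<in> sq_integrable M" "v \<in> sq_integrable M" "U = cl u" "V = cl v"
      by (auto simp: adjoint_operator_def L2_space_def)
    note m = sq_integrableD(1)[OF uv(1)] sq_integrableD(1)[OF uv(2)]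
    have "ip M u (T g) = ip M v g" if g: "g \<in> bc_dom L" for g
    proof -
      have "(cl g, cl (T g)) \<in> ?S" using g by (auto simp: tau_operator_def)
      then have "L2_inner M U (cl (T g)) = L2_inner M V (cl g)" using UV by (auto simp: adjoint_operator_def)
      then show ?thesis using uv m dmax_meas[OF D[OF g]] by (simp add: L2_inner_class)
    qed
    from adjoint_bc[OF L uv(1,2) this] obtain f where f: "f \<in> bc_dom L" "AE x in M. u x = f x" "AE x in M. T f x = v x" by blast
    have "U = cl f" "V = cl (T f)"
      using f(2,3) m dmax_meas[OF D[OF f(1)]] uv by (auto simp: L2_class_eq_iff elim: eventually_mono)
    then show "(U, V) \<in> ?S" using f(1) by (auto simp: tau_operator_def)
  qed
  moreover have "?S \<subseteq> Tmax a b p q r s" using D by (auto simp: Tmax_def tau_operator_def)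
  ultimately show ?thesis using lin dense by (simp add: self_adjoint_restriction_def self_adjoint_operator_def)
qed

text \<open>For a given operator, \<open>L\<close> is the set of boundary values of its domain.
  Symmetry gives \<open>L \<subseteq> bform_perp L\<close>. Conversely, any function with boundary
  values in \<open>bform_perp L\<close> lies in the domain of the adjoint, hence in that of the
  operator; this also shows that the domain is the full preimage of \<open>L\<close>.\<close>

proposition self_adjoint_restriction_iff:
  "self_adjoint_restriction a b p q r s S \<longleftrightarrow> (\<exists>L. bform_perp L = L \<and> S = tauop (bc_dom L))"
proof
  assume "self_adjoint_restriction a b p q r s S"
  then have adj: "adjoint_operator M S = S" and sub: "S \<subseteq> Tmax a b p q r s"
    by (auto simp: self_adjoint_restriction_def self_adjoint_operator_def)
  define D where "D = {g \<in> dmax. (cl g, cl (T g)) \<in> S}"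
  have S: "S = tauop D" using sub by (auto simp: D_def Tmax_def tau_operator_def)
  define L where "L = BB ` D"
  have sym: "bform2 (BB g) (BB f) = 0" if "f \<in> D" "g \<in> D" for f g
  proof -
    have "(cl f, cl (T f)) \<in> adjoint_operator M S" "(cl g, cl (T g)) \<in> S" using that adj by (auto simp: D_def)
    then have "L2_inner M (cl f) (cl (T g)) = L2_inner M (cl (T f)) (cl g)" by (auto simp: adjoint_operator_def)
    moreover have "f \<in> dmax" "g \<in> dmax" using that by (auto simp: D_def)
    ultimately show ?thesis using ip_green[of f g] dmax_meas by (simp add: L2_inner_class)
  qed
  have max: "f \<in> D" if f: "f \<in> dmax" "BB f \<in> bform_perp L" for f
  proof -
    have "L2_inner M (cl f) (cl (T g)) = L2_inner M (cl (T f)) (cl g)" if g: "g \<in> D" for g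
    proof -
      have gd: "g \<in> dmax" using g by (simp add: D_def)
      have "bform2 (BB f) (BB g) = 0" using f(2) g by (auto simp: bform_perp_def L_def)
      then have "bform2 (BB g) (BB f) = 0" using bform2_zero_swap by blast
      then have "ip M f (T g) = ip M (T f) g" using ip_green[OF f(1) gd] by simp
      then show ?thesis using dmax_meas[OF f(1)] dmax_meas[OF gd] by (simp add: L2_inner_class)
    qed
    then have "(cl f, cl (T f)) \<in> adjoint_operator M S"
      using dmax_sq[OF f(1)] by (auto simp: adjoint_operator_def S tau_operator_def L2_space_def)
    then show ?thesis using adj f by (simp add: D_def)
  qed
  have "bform_perp L = L"
  proof
    show "bform_perp L \<subseteq> L"
    proof
      fix z assume z: "z \<in> bform_perp L"
      obtain f where f: "f \<in> dmax" "BB f = z" by (rule BB_surj)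
      then have "f \<in> D" using max z by blast
      then show "z \<in> L" using f by (auto simp: L_def)
    qed
    show "L \<subseteq> bform_perp L" using sym by (auto simp: L_def bform_perp_def)
  qed
  moreover have "D = bc_dom L"
    using max \<open>bform_perp L = L\<close> by (auto simp: bc_dom_def L_def) (auto simp: D_def)
  ultimately show "\<exists>L. bform_perp L = L \<and> S = tauop (bc_dom L)" using S by blast
qed (use self_adjoint_bc in blast)

lemma Domain_bc: "Domain (tauop (bc_dom L)) = cl ` bc_dom L"
  by (auto simp: tau_operator_def)

text \<open>\<open>separated_bc\<close> prescribes only the domain; since both operators act as
  \<tau>, the domain determines the graph.\<close>

lemma restriction_from_Domain:
  assumes "S \<subseteq> Tmax a b p q r s" "Domain S = cl ` D" "D \<subseteq> dmax"
  shows "S = tauop D"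
proof (intro set_eqI iffI)
  fix z assume z: "z \<in> S"
  then obtain g where g: "g \<in> dmax" "z = (cl g, cl (T g))" using assms(1) by (auto simp: Tmax_def tau_operator_def)
  then have "cl g \<in> cl ` D" using z assms(2) by blast
  then obtain g' where g': "g' \<in> D" "cl g = cl g'" by blast
  then have "z = (cl g', cl (T g'))" using g class_eq(1)[of g g'] assms(3) by auto
  then show "z \<in> tauop D" using g' by (auto simp: tau_operator_def)
next
  fix z assume "z \<in> tauop D"
  then obtain g where g: "g \<in> D" "z = (cl g, cl (T g))" by (auto simp: tau_operator_def)
  then obtain y where y: "(cl g, y) \<in> S" using assms(2) by blast
  then obtain g' where g': "g' \<in> dmax" "cl g = cl g'" "y = cl (T g')" using assms(1) by (auto simp: Tmax_def tau_operator_def)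
  then have "y = cl (T g)" using class_eq(1)[of g g'] g(1) assms(3) by auto
  then show "z \<in> S" using y g by simp
qed

text \<open>Every boundary value is attained, and a class determines its boundary values, so
  \<open>L\<close> can be read off from the domain.\<close>

lemma bc_dom_inj:
  assumes "cl ` bc_dom L = cl ` bc_dom L'"
  shows "L = L'"
proof -
  have "L1 \<subseteq> L2" if "cl ` bc_dom L1 = cl ` bc_dom L2" for L1 L2
  proof
    fix z assume "z \<in> L1"
    obtain f where f: "f \<in> dmax" "BB f = z" by (rule BB_surj)
    then have "cl f \<in> cl ` bc_dom L2" using that \<open>z \<in> L1\<close> by (auto simp: bc_dom_def)
    then obtain g where "g \<in> dmax" "BB g \<in> L2" "cl f = cl g" by (auto simp: bc_dom_def)
    then show "z \<in> L2" using class_eq(2)[of f g] f by simp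
  qed
  then show ?thesis using assms by blast
qed

end

subsection \<open>Lagrangian subspaces\<close>

definition sep_space :: "complex \<times> complex \<Rightarrow> complex \<times> complex \<Rightarrow> ((complex \<times> complex) \<times> (complex \<times> complex)) set" where
  "sep_space v w = {(x, y). bform x v = 0 \<and> bform y w = 0}"

definition coupling :: "real \<Rightarrow> real^2^2 \<Rightarrow> complex \<times> complex \<Rightarrow> complex \<times> complex" where
  "coupling \<phi> R x = (exp (\<i> * of_real \<phi>) * (of_real (R$1$1) * fst x + of_real (R$1$2) * snd x),
     exp (\<i> * of_real \<phi>) * (of_real (R$2$1) * fst x + of_real (R$2$2) * snd x))"

text \<open>The form is nondegenerate in dimension two, so the vectors orthogonal to
  \<open>v\<close> form a line; isotropy puts \<open>v\<close> on it.\<close>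

lemma bform_isotropic_line:
  assumes v: "bform v v = 0" "v \<noteq> 0" and x: "bform x v = 0"
  obtains \<kappa> where "x = (\<kappa> * fst v, \<kappa> * snd v)"
proof (cases "snd v = 0")
  case False
  have "fst x * cnj (snd v) = snd x * cnj (fst v)" "fst v * cnj (snd v) = snd v * cnj (fst v)"
    using v x by (auto simp: bform_def)
  then have "fst x * cnj (snd v) * snd v = snd x * (fst v * cnj (snd v))" by simp
  then have "fst x * snd v = snd x * fst v" using False by simp
  then have "fst x = snd x / snd v * fst v" using False by (simp add: field_simps)
  then show ?thesis using False by (intro that[of "snd x / snd v"]) (simp add: prod_eq_iff)
next
  case True
  then have "fst v \<noteq> 0" using v(2) by (auto simp: prod_eq_iff)
  then show ?thesis using x True by (intro that[of "fst x / fst v"]) (simp add: prod_eq_iff bform_def)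
qed

lemma bform_isotropic_kernel:
  assumes "bform v v = 0" "v \<noteq> 0" "bform x v = 0" "bform y v = 0"
  shows "bform x y = 0"
proof -
  obtain \<kappa> where "x = (\<kappa> * fst v, \<kappa> * snd v)" by (rule bform_isotropic_line[OF assms(1-3)])
  moreover obtain \<mu> where "y = (\<mu> * fst v, \<mu> * snd v)" by (rule bform_isotropic_line[OF assms(1,2,4)])
  ultimately have "bform x y = \<kappa> * cnj \<mu> * bform v v" by (simp add: bform_def algebra_simps)
  then show ?thesis using assms(1) by simp
qed

lemma bform_nondegenerate: "v \<noteq> 0 \<Longrightarrow> \<exists>x. bform x v \<noteq> 0"
proof -
  assume v: "v \<noteq> 0"
  \<comment> \<open>For this vector the form gives the squared norm of \<open>v\<close>.\<close>
  have "bform (snd v, - fst v) v = of_real ((norm (fst v))\<^sup>2 + (norm (snd v))\<^sup>2)"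
    by (simp add: bform_def complex_norm_square del: of_real_power)
  moreover have "(norm (fst v))\<^sup>2 + (norm (snd v))\<^sup>2 \<noteq> 0"
    using v by (auto simp: prod_eq_iff sum_power2_eq_zero_iff)
  ultimately show ?thesis by (metis of_real_eq_0_iff)
qed

lemma bform_zero [simp]: "bform 0 v = 0" "bform v 0 = 0"
  by (simp_all add: bform_def)

text \<open>By isotropy \<open>(v, 0)\<close> and \<open>(0, w)\<close> lie in the space, and
  testing against them gives its two equations. Conversely, each factor is an isotropic
  line.\<close>

lemma sep_space_lagrangian:
  assumes v: "bform v v = 0" "v \<noteq> 0" and w: "bform w w = 0" "w \<noteq> 0"
  shows "bform_perp (sep_space v w) = sep_space v w"
proof
  show "bform_perp (sep_space v w) \<subseteq> sep_space v w"
  proof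
    fix p assume p: "p \<in> bform_perp (sep_space v w)"
    have "(v, 0) \<in> sep_space v w" "(0, w) \<in> sep_space v w" using v w by (auto simp: sep_space_def)
    then have "bform2 p (v, 0) = 0" "bform2 p (0, w) = 0" using p by (auto simp: bform_perp_def)
    then show "p \<in> sep_space v w" by (cases p) (auto simp: bform2_def sep_space_def)
  qed
  show "sep_space v w \<subseteq> bform_perp (sep_space v w)"
  proof (unfold bform_perp_def, intro subsetI CollectI ballI)
    fix p q assume "p \<in> sep_space v w" "q \<in> sep_space v w"
    then have "bform (fst p) v = 0" "bform (snd p) w = 0" "bform (fst q) v = 0" "bform (snd q) w = 0"
      by (auto simp: sep_space_def)
    then show "bform2 p q = 0"
      unfolding bform2_def using bform_isotropic_kernel[OF v, of "fst p" "fst q"] bform_isotropic_kernel[OF w, of "snd p" "snd q"] by simp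
  qed
qed

text \<open>Polar coordinates with a radius of either sign: an angle outside [0, pi) is shifted by
  half a turn, and the radius changes sign.\<close>

lemma polar_half_plane:
  fixes s c :: real
  assumes "(s, c) \<noteq> (0, 0)"
  obtains \<rho> \<phi> where "\<rho> \<noteq> 0" "\<phi> \<in> {0..<pi}" "s = \<rho> * sin \<phi>" "c = \<rho> * cos \<phi>"
proof -
  define z where "z = Complex c s"
  have z: "norm z \<noteq> 0" using assms by (auto simp: z_def complex_eq_iff)
  have "Re (rcis (norm z) (Arg z)) = c" "Im (rcis (norm z) (Arg z)) = s"
    by (simp_all only: rcis_cmod_Arg) (simp_all add: z_def)
  then have zc: "c = norm z * cos (Arg z)" "s = norm z * sin (Arg z)" by simp_all
  consider "0 \<le> Arg z" "Arg z < pi" | "Arg z = pi" | "Arg z < 0" using Arg_bounded[of z] by linarith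
  then show ?thesis
  proof cases
    case 1
    then show ?thesis using z zc by (intro that[of "norm z" "Arg z"]) auto
  next
    case 2
    then show ?thesis using z zc by (intro that[of "- norm z" 0]) auto
  next
    case 3
    then show ?thesis using z zc Arg_bounded[of z] by (intro that[of "- norm z" "Arg z + pi"]) auto
  qed
qed

text \<open>Isotropy says that \<open>fst v * cnj (snd v)\<close> is real, hence the quotient of the
  two components is real.\<close>

lemma bform_isotropic_real:
  assumes v: "bform v v = 0" "v \<noteq> 0"
  obtains \<kappa> s c where "\<kappa> \<noteq> 0" "(s, c) \<noteq> (0, 0)" "v = (\<kappa> * of_real s, \<kappa> * of_real c)"
proof (cases "snd v = 0")
  case True
  then have "fst v \<noteq> 0" using v(2) by (auto simp: prod_eq_iff)
  then show ?thesis using True by (intro that[of "fst v" 1 0]) (auto simp: prod_eq_iff)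
next
  case False
  have "fst v * cnj (snd v) = cnj (fst v * cnj (snd v))" using v(1) by (simp add: bform_def mult.commute)
  then have "fst v / snd v = cnj (fst v / snd v)" using False by (simp add: field_simps)
  then have "fst v / snd v \<in> \<real>" using Reals_cnj_iff by metis
  then obtain t where "fst v / snd v = of_real t" by (auto elim: Reals_cases)
  then have "fst v = snd v * of_real t" using False by (simp add: field_simps)
  then show ?thesis using False by (intro that[of "snd v" t 1]) (auto simp: prod_eq_iff)
qed

lemma bform_isotropic_angle:
  assumes v: "bform v v = 0" "v \<noteq> 0"
  obtains \<phi> where "\<phi> \<in> {0..<pi}" "\<And>x. bform x v = 0 \<longleftrightarrow> bform x (of_real (sin \<phi>), of_real (cos \<phi>)) = 0"
proof -
  obtain \<kappa> s c where 1: "\<kappa> \<noteq> 0" "(s, c) \<noteq> (0, 0)" "v = (\<kappa> * of_real s, \<kappa> * of_real c)"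
    by (rule bform_isotropic_real[OF v])
  obtain \<rho> \<phi> where 2: "\<rho> \<noteq> 0" "\<phi> \<in> {0..<pi}" "s = \<rho> * sin \<phi>" "c = \<rho> * cos \<phi>"
    by (rule polar_half_plane[OF 1(2)])
  have "bform x v = cnj \<kappa> * of_real \<rho> * bform x (of_real (sin \<phi>), of_real (cos \<phi>))" for x
    using 1(3) 2(3,4) by (simp add: bform_def algebra_simps)
  then show ?thesis using 1(1) 2(1,2) by (intro that[of \<phi>]) auto
qed

text \<open>Here \<open>polar_half_plane\<close> is applied to the complex factor rather than to the
  real direction, and the signed radius is absorbed into the real vector.\<close>

lemma bform_isotropic_phase:
  assumes v: "bform v v = 0" "v \<noteq> 0"
  obtains \<phi> s c where "\<phi> \<in> {0..<pi}" "v = (exp (\<i> * of_real \<phi>) * of_real s, exp (\<i> * of_real \<phi>) * of_real c)"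
proof -
  obtain \<kappa> s c where 1: "\<kappa> \<noteq> 0" "(s, c) \<noteq> (0, 0)" "v = (\<kappa> * of_real s, \<kappa> * of_real c)"
    by (rule bform_isotropic_real[OF v])
  have "(Im \<kappa>, Re \<kappa>) \<noteq> (0, 0)" using 1(1) by (auto simp: complex_eq_iff)
  then obtain \<rho> \<phi> where 2: "\<rho> \<noteq> 0" "\<phi> \<in> {0..<pi}" "Im \<kappa> = \<rho> * sin \<phi>" "Re \<kappa> = \<rho> * cos \<phi>"
    by (rule polar_half_plane)
  have "\<kappa> = exp (\<i> * of_real \<phi>) * of_real \<rho>"
    using 2(3,4) by (simp add: complex_eq_iff cis_conv_exp[symmetric] mult.commute)
  then show ?thesis using 1(3) 2(2) by (intro that[of \<phi> "\<rho> * s" "\<rho> * c"]) (simp_all add: mult.assoc)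
qed

definition comb :: "complex \<Rightarrow> complex \<times> complex \<Rightarrow> complex \<Rightarrow> complex \<times> complex \<Rightarrow> complex \<times> complex" where
  "comb \<alpha> x \<beta> y = (\<alpha> * fst x + \<beta> * fst y, \<alpha> * snd x + \<beta> * snd y)"

lemma bform_comb: "bform (comb \<alpha> x \<beta> y) z = \<alpha> * bform x z + \<beta> * bform y z"
  by (simp add: comb_def bform_def algebra_simps)

lemma lagrangian_comb:
  assumes L: "bform_perp L = L" and "(x, y) \<in> L" "(x', y') \<in> L"
  shows "(comb \<alpha> x \<beta> x', comb \<alpha> y \<beta> y') \<in> L"
proof -
  have "(x, y) \<in> bform_perp L" "(x', y') \<in> bform_perp L" using assms by auto
  then have "bform y (snd q) = bform x (fst q)" "bform y' (snd q) = bform x' (fst q)" if "q \<in> L" for q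
    using that by (auto simp: bform_perp_def bform2_def)
  then have "(comb \<alpha> x \<beta> x', comb \<alpha> y \<beta> y') \<in> bform_perp L"
    by (simp add: bform_perp_def bform2_def bform_comb)
  then show ?thesis using L by simp
qed

lemma lagrangian_symp:
  assumes "bform_perp L = L" "(x, y) \<in> L" "(x', y') \<in> L"
  shows "bform y y' = bform x x'"
proof -
  have "(x, y) \<in> bform_perp L" using assms by simp
  then have "bform2 (x, y) (x', y') = 0" using assms(3) by (auto simp: bform_perp_def)
  then show ?thesis by (simp add: bform2_def)
qed

lemma lagrangian_subset_eq:
  assumes "bform_perp L = L" "bform_perp K = K" "L \<subseteq> K"
  shows "L = K"
  using assms unfolding bform_perp_def by blast

lemma lagrangianI:
  assumes "bform_perp L = L" "\<And>x' y'. (x', y') \<in> L \<Longrightarrow> bform y y' = bform x x'"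
  shows "(x, y) \<in> L"
proof -
  have "(x, y) \<in> bform_perp L" using assms(2) by (auto simp: bform_perp_def bform2_def)
  then show ?thesis using assms(1) by simp
qed

definition is_separated :: "((complex \<times> complex) \<times> (complex \<times> complex)) set \<Rightarrow> bool" where
  "is_separated L \<longleftrightarrow> (\<exists>v w. bform v v = 0 \<and> v \<noteq> 0 \<and> bform w w = 0 \<and> w \<noteq> 0 \<and> L = sep_space v w)"

lemma is_separatedI:
  "bform v v = 0 \<Longrightarrow> v \<noteq> 0 \<Longrightarrow> bform w w = 0 \<Longrightarrow> w \<noteq> 0 \<Longrightarrow> is_separated (sep_space v w)"
  unfolding is_separated_def by blast

text \<open>Pairing with \<open>(x, 0)\<close> confines the first components of \<open>L\<close> to
  the isotropic line of \<open>x\<close>, where the form vanishes. So the form also vanishes between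
  any two second components, and a nonzero one, \<open>y1\<close>, gives the other factor. If all
  second components were 0, \<open>(0, (1, 0))\<close> would be orthogonal to \<open>L\<close> and
  hence in it.\<close>

lemma lagrangian_separated_left:
  assumes L: "bform_perp L = L" and x: "(x, 0) \<in> L" "x \<noteq> 0"
  shows "is_separated L"
proof -
  have xx: "bform x x = 0" using lagrangian_symp[OF L x(1) x(1)] by simp
  have kx: "bform x' x = 0" if "(x', y') \<in> L" for x' y' using lagrangian_symp[OF L that x(1)] by simp
  have "\<exists>x1 y1. (x1, y1) \<in> L \<and> y1 \<noteq> 0"
  proof (rule ccontr)
    assume "\<not> ?thesis"
    then have z: "y' = 0" if "(x', y') \<in> L" for x' y' using that by blast
    have "(0, (1, 0)) \<in> L" by (rule lagrangianI[OF L]) (auto dest: z)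
    from z[OF this] show False by (simp add: zero_prod_def)
  qed
  then obtain x1 y1 where 1: "(x1, y1) \<in> L" "y1 \<noteq> 0" by blast
  have y1: "bform y1 y' = 0" if "(x', y') \<in> L" for x' y'
    using lagrangian_symp[OF L 1(1) that] bform_isotropic_kernel[OF xx x(2) kx[OF 1(1)] kx[OF that]] by simp
  have "L \<subseteq> sep_space x y1"
  proof clarify
    fix u v u' v' assume "((u, v), (u', v')) \<in> L"
    then show "((u, v), (u', v')) \<in> sep_space x y1" using kx y1 bform_swap[of "(u', v')" y1] by (auto simp: sep_space_def)
  qed
  moreover have "bform y1 y1 = 0" by (rule y1[OF 1(1)])
  ultimately have "L = sep_space x y1"
    using lagrangian_subset_eq[OF L sep_space_lagrangian] xx x(2) 1(2) by blast
  then show ?thesis using is_separatedI xx x(2) 1(2) \<open>bform y1 y1 = 0\<close> by metis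
qed

text \<open>The mirror image of \<open>lagrangian_separated_left\<close>, with the endpoints
  exchanged.\<close>

lemma lagrangian_separated_right:
  assumes L: "bform_perp L = L" and y: "(0, y) \<in> L" "y \<noteq> 0"
  shows "is_separated L"
proof -
  have yy: "bform y y = 0" using lagrangian_symp[OF L y(1) y(1)] by simp
  have ky: "bform y' y = 0" if "(x', y') \<in> L" for x' y' using lagrangian_symp[OF L that y(1)] by simp
  have "\<exists>x1 y1. (x1, y1) \<in> L \<and> x1 \<noteq> 0"
  proof (rule ccontr)
    assume "\<not> ?thesis"
    then have z: "x' = 0" if "(x', y') \<in> L" for x' y' using that by blast
    have "((1, 0), 0) \<in> L" by (rule lagrangianI[OF L]) (auto dest: z)
    from z[OF this] show False by (simp add: zero_prod_def)
  qed
  then obtain x1 y1 where 1: "(x1, y1) \<in> L" "x1 \<noteq> 0" by blast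
  have x1: "bform x1 x' = 0" if "(x', y') \<in> L" for x' y'
    using lagrangian_symp[OF L 1(1) that] bform_isotropic_kernel[OF yy y(2) ky[OF 1(1)] ky[OF that]] by simp
  have "L \<subseteq> sep_space x1 y"
  proof clarify
    fix u v u' v' assume "((u, v), (u', v')) \<in> L"
    then show "((u, v), (u', v')) \<in> sep_space x1 y" using ky x1 bform_swap[of "(u, v)" x1] by (auto simp: sep_space_def)
  qed
  moreover have "bform x1 x1 = 0" by (rule x1[OF 1(1)])
  ultimately have "L = sep_space x1 y"
    using lagrangian_subset_eq[OF L sep_space_lagrangian] yy y(2) 1(2) by blast
  then show ?thesis using is_separatedI yy y(2) 1(2) \<open>bform x1 x1 = 0\<close> by metis
qed

text \<open>A real matrix commutes with conjugation and multiplies the form by its determinant; the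
  phase has modulus 1.\<close>

lemma bform_coupling:
  assumes "det R = 1"
  shows "bform (coupling \<phi> R x) (coupling \<phi> R y) = bform x y"
proof -
  let ?E = "exp (\<i> * complex_of_real \<phi>)"
  have E: "?E * cnj ?E = 1" by (simp add: exp_cnj exp_minus_inverse flip: exp_add)
  have "bform (coupling \<phi> R x) (coupling \<phi> R y) = (?E * cnj ?E) * of_real (det R) * bform x y"
    by (simp add: coupling_def bform_def det_2 algebra_simps)
  then show ?thesis unfolding E assms by simp
qed

lemma coupling_surj:
  assumes "det R = 1"
  obtains x where "coupling \<phi> R x = y"
proof -
  let ?E = "exp (\<i> * complex_of_real \<phi>)"
  define x where "x = ((of_real (R$2$2) * fst y - of_real (R$1$2) * snd y) / ?E, (of_real (R$1$1) * snd y - of_real (R$2$1) * fst y) / ?E)"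
  have d: "complex_of_real (R$1$1) * of_real (R$2$2) - of_real (R$1$2) * of_real (R$2$1) = 1"
    using assms unfolding det_2 by (metis of_real_1 of_real_diff of_real_mult)
  have "fst (coupling \<phi> R x) = (complex_of_real (R$1$1) * of_real (R$2$2) - of_real (R$1$2) * of_real (R$2$1)) * fst y"
    by (simp add: coupling_def x_def field_simps)
  moreover have "snd (coupling \<phi> R x) = (complex_of_real (R$1$1) * of_real (R$2$2) - of_real (R$1$2) * of_real (R$2$1)) * snd y"
    by (simp add: coupling_def x_def field_simps)
  ultimately have "coupling \<phi> R x = y" unfolding d by (simp add: prod_eq_iff)
  then show ?thesis by (rule that)
qed

text \<open>For \<open>p\<close> in the complement, the difference \<open>d\<close> between
  \<open>snd p\<close> and the image of \<open>fst p\<close> is orthogonal to the range of the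
  coupling. The range is everything, so \<open>d\<close> is 0 by nondegeneracy.\<close>

lemma coupling_lagrangian:
  assumes "det R = 1"
  shows "bform_perp {(x, y). y = coupling \<phi> R x} = {(x, y). y = coupling \<phi> R x}" (is "bform_perp ?L = ?L")
proof
  show "?L \<subseteq> bform_perp ?L" by (auto simp: bform_perp_def bform2_def bform_coupling[OF assms])
  show "bform_perp ?L \<subseteq> ?L"
  proof
    fix p assume p: "p \<in> bform_perp ?L"
    define d where "d = comb 1 (snd p) (-1) (coupling \<phi> R (fst p))"
    have "bform d w = 0" for w
    proof -
      obtain z where z: "coupling \<phi> R z = w" by (rule coupling_surj[OF assms])
      then have "(z, w) \<in> ?L" by simp
      then have "bform2 p (z, w) = 0" using p unfolding bform_perp_def by blast
      then show ?thesis using bform_coupling[OF assms, of \<phi> "fst p" z] z by (simp add: d_def bform_comb bform2_def)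
    qed
    then have "bform w d = 0" for w using bform_swap[of w d] by simp
    then have "d = 0" using bform_nondegenerate by blast
    then have "snd p = coupling \<phi> R (fst p)" by (simp add: d_def comb_def prod_eq_iff)
    then show "p \<in> ?L" by (cases p) simp
  qed
qed

text \<open>A separated space contains \<open>(v, 0)\<close> with nonzero \<open>v\<close>, whereas
  an isometry of a nondegenerate form is injective.\<close>

lemma coupling_not_separated:
  assumes "det R = 1"
  shows "\<not> is_separated {(x, y). y = coupling \<phi> R x}"
proof
  assume "is_separated {(x, y). y = coupling \<phi> R x}"
  then obtain v w where v: "bform v v = 0" "v \<noteq> 0" and eq: "{(x, y). y = coupling \<phi> R x} = sep_space v w"
    by (auto simp: is_separated_def)
  have "(v, 0) \<in> sep_space v w" using v by (simp add: sep_space_def)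
  then have c: "coupling \<phi> R v = 0" unfolding eq[symmetric] by simp
  have "bform z v = 0" for z using bform_coupling[OF assms, of \<phi> z v] c by simp
  then show False using bform_nondegenerate[OF v(2)] by blast
qed

text \<open>As \<open>L\<close> contains no nonzero \<open>(x, 0)\<close> or \<open>(0, y)\<close>,
  it is the graph of a linear map, whose columns \<open>m1\<close> and \<open>m2\<close> inherit the
  values of the form on the standard basis. Both columns are isotropic, so each is a phase times a
  real vector, and \<open>bform m1 m2 = 1\<close> ties the phases together.\<close>

proposition lagrangian_not_separated:
  assumes L: "bform_perp L = L" and ns: "\<not> is_separated L"
  obtains \<phi> R where "\<phi> \<in> {0..<pi}" "det R = 1" "L = {(x, y). y = coupling \<phi> R x}"
proof -
  have left: "x = 0" if "(x, 0) \<in> L" for x using lagrangian_separated_left[OF L that] ns by blast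
  have right: "y = 0" if "(0, y) \<in> L" for y using lagrangian_separated_right[OF L that] ns by blast
  let ?det = "\<lambda>p q. fst p * snd q - snd p * fst (q :: complex \<times> complex)"
  \<comment> \<open>The first components of \<open>L\<close> span the plane. Otherwise they all lie
    on one line, and a nonzero \<open>(x, 0)\<close> orthogonal to \<open>L\<close> would belong to
    it.\<close>
  have "\<exists>p\<in>L. \<exists>q\<in>L. ?det (fst p) (fst q) \<noteq> 0"
  proof (rule ccontr)
    assume "\<not> ?thesis"
    then have z: "?det x x' = 0" if "(x, y) \<in> L" "(x', y') \<in> L" for x y x' y' using that by force
    show False
    proof (cases "\<exists>v y. (v, y) \<in> L \<and> v \<noteq> 0")
      case True
      then obtain v y where v: "(v, y) \<in> L" "v \<noteq> 0" by blast
      \<comment> \<open>Conjugation turns the sesquilinear form into the determinant: pairing the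
        conjugate of \<open>v\<close> with \<open>x'\<close> gives
        \<open>cnj (?det v x')\<close>.\<close>
      have "((cnj (fst v), cnj (snd v)), 0) \<in> L"
      proof (rule lagrangianI[OF L])
        fix x' y' assume "(x', y') \<in> L"
        from z[OF v(1) this] have "cnj (?det v x') = 0" by simp
        then show "bform 0 y' = bform (cnj (fst v), cnj (snd v)) x'" by (simp add: bform_def)
      qed
      from left[OF this] show False using v(2) by (simp add: prod_eq_iff)
    next
      case False
      then have z: "x' = 0" if "(x', y') \<in> L" for x' y' using that by blast
      have "((1, 0), 0) \<in> L" by (rule lagrangianI[OF L]) (auto dest: z)
      from left[OF this] show False by (simp add: zero_prod_def)
    qed
  qed
  then obtain x1 y1 x2 y2 where b: "(x1, y1) \<in> L" "(x2, y2) \<in> L" and d: "?det x1 x2 \<noteq> 0" by fastforce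
  define D where "D = ?det x1 x2"
  \<comment> \<open>By Cramer's rule, the same coefficients combine \<open>x1\<close> and
    \<open>x2\<close> to \<open>(1, 0)\<close>, and those of \<open>m2\<close> give
    \<open>(0, 1)\<close>.\<close>
  define m1 where "m1 = comb (snd x2 / D) y1 (- snd x1 / D) y2"
  define m2 where "m2 = comb (- fst x2 / D) y1 (fst x1 / D) y2"
  have "comb (snd x2 / D) x1 (- snd x1 / D) x2 = (1, 0)" "comb (- fst x2 / D) x1 (fst x1 / D) x2 = (0, 1)"
  proof -
    have "D \<noteq> 0" and D: "fst x1 * snd x2 = D + snd x1 * fst x2" using d by (simp_all add: D_def)
    then show "comb (snd x2 / D) x1 (- snd x1 / D) x2 = (1, 0)" "comb (- fst x2 / D) x1 (fst x1 / D) x2 = (0, 1)"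
      by (simp_all add: comb_def divide_simps) (simp_all add: algebra_simps)
  qed
  then have m: "((1, 0), m1) \<in> L" "((0, 1), m2) \<in> L"
    using lagrangian_comb[OF L b, of "snd x2 / D" "- snd x1 / D"] lagrangian_comb[OF L b, of "- fst x2 / D" "fst x1 / D"]
    by (auto simp: m1_def m2_def)
  have s: "bform m1 m1 = 0" "bform m2 m2 = 0" "bform m1 m2 = 1"
    using lagrangian_symp[OF L m(1) m(1)] lagrangian_symp[OF L m(2) m(2)] lagrangian_symp[OF L m(1) m(2)]
    by (simp_all add: bform_def)
  have nz: "m1 \<noteq> 0" "m2 \<noteq> 0" using s(3) by auto
  obtain \<phi> s1 c1 where 1: "\<phi> \<in> {0..<pi}" "m1 = (exp (\<i> * of_real \<phi>) * of_real s1, exp (\<i> * of_real \<phi>) * of_real c1)"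
    by (rule bform_isotropic_phase[OF s(1) nz(1)])
  obtain \<psi> s2 c2 where 2: "m2 = (exp (\<i> * of_real \<psi>) * of_real s2, exp (\<i> * of_real \<psi>) * of_real c2)"
    by (rule bform_isotropic_phase[OF s(2) nz(2)])
  define e where "e = exp (\<i> * complex_of_real \<phi>)"
  define e' where "e' = exp (\<i> * complex_of_real \<psi>)"
  have e: "norm e = 1" "norm e' = 1" "e' * cnj e' = 1" "e \<noteq> 0"
    by (simp_all add: e_def e'_def exp_cnj flip: exp_add)
  \<comment> \<open>The determinant of the two real vectors. Since
    \<open>e * cnj e' * \<delta> = 1\<close> with phases of modulus 1, it is 1 or -1, and
    \<open>e' = e * \<delta>\<close>.\<close>
  define \<delta> where "\<delta> = s1 * c2 - c1 * s2"
  have dd: "e * cnj e' * of_real \<delta> = 1"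
    using s(3) unfolding 1(2) 2 by (simp add: bform_def e_def e'_def \<delta>_def algebra_simps)
  then have "norm (e * cnj e' * of_real \<delta>) = 1" by simp
  then have "\<bar>\<delta>\<bar> = 1" by (simp add: norm_mult e)
  then have \<delta>2: "\<delta> * \<delta> = 1" by (metis abs_mult_self_eq mult_1)
  have "e' = e * cnj e' * of_real \<delta> * e'" using dd by simp
  also have "\<dots> = e * of_real \<delta> * (e' * cnj e')" by (simp add: mult_ac)
  finally have e'_eq: "e' = e * of_real \<delta>" using e(3) by simp
  \<comment> \<open>The sign between the phases goes into the second column, so that both columns
    share the phase \<open>e\<close> and the determinant becomes
    \<open>\<delta> * \<delta>\<close>.\<close>
  define R :: "real^2^2" where "R = vector [vector [s1, \<delta> * s2], vector [c1, \<delta> * c2]]"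
  have R: "R$1$1 = s1" "R$1$2 = \<delta> * s2" "R$2$1 = c1" "R$2$2 = \<delta> * c2" by (simp_all add: R_def)
  have "det R = \<delta> * \<delta>" by (simp add: det_2 R \<delta>_def algebra_simps)
  then have detR: "det R = 1" using \<delta>2 by simp
  have coup: "coupling \<phi> R x = comb (fst x) m1 (snd x) m2" for x
    using e'_eq unfolding 1(2) 2 by (simp add: coupling_def comb_def R e_def e'_def algebra_simps)
  have graph: "(x, coupling \<phi> R x) \<in> L" for x
    using lagrangian_comb[OF L m, of "fst x" "snd x"] by (simp add: coup) (simp add: comb_def)
  have "L = {(x, y). y = coupling \<phi> R x}"
  proof (intro set_eqI iffI)
    fix p assume p: "p \<in> L"
    have "(comb 1 (fst p) (-1) (fst p), comb 1 (snd p) (-1) (coupling \<phi> R (fst p))) \<in> L"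
      using lagrangian_comb[OF L _ graph, of "fst p" "snd p"] p by simp
    moreover have "comb 1 (fst p) (-1) (fst p) = 0" by (simp add: comb_def zero_prod_def)
    ultimately have "comb 1 (snd p) (-1) (coupling \<phi> R (fst p)) = 0" using right by simp
    then have "snd p = coupling \<phi> R (fst p)" by (simp add: comb_def zero_prod_def prod_eq_iff)
    then show "p \<in> {(x, y). y = coupling \<phi> R x}" by (simp add: case_prod_unfold)
  qed (use graph in auto)
  with 1(1) detR show ?thesis by (rule that)
qed

context boundary_functionals
begin

subsection \<open>Separated and coupled boundary conditions\<close>

text \<open>By \<open>green\<close>, the Wronskian conditions on \<open>v\<close> and
  \<open>w\<close> say that their boundary vectors are isotropic; the function \<open>h\<close>
  exists exactly when both vectors are nonzero.\<close>

lemma separated_bc_iff: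
  assumes "S \<subseteq> Tmax a b p q r s"
  shows "separated_bc a b p q r s S \<longleftrightarrow> (\<exists>L. is_separated L \<and> S = tauop (bc_dom L))"
proof
  have c: "a \<in> {a, b}" "b \<in> {a, b}" by auto
  have dom: "{g \<in> dmax. wend a g (cnj \<circ> v) = 0 \<and> wend b g (cnj \<circ> w) = 0} = bc_dom (sep_space (BC a v) (BC b w))"
    if "v \<in> dmax" "w \<in> dmax" for v w
    using that by (auto simp: bc_dom_def BB_def sep_space_def green[OF c(1)] green[OF c(2)])
  {
    assume "separated_bc a b p q r s S"
    then obtain v w h where vw: "v \<in> dmax" "w \<in> dmax" "wend a v (cnj \<circ> v) = 0" "wend b w (cnj \<circ> w) = 0"
      "h \<in> dmax" "wend a h (cnj \<circ> v) \<noteq> 0" "wend b h (cnj \<circ> w) \<noteq> 0"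
      "Domain S = cl ` {g \<in> dmax. wend a g (cnj \<circ> v) = 0 \<and> wend b g (cnj \<circ> w) = 0}"
      unfolding separated_bc_def by blast
    have "bform (BC a v) (BC a v) = 0" "bform (BC b w) (BC b w) = 0" "BC a v \<noteq> 0" "BC b w \<noteq> 0"
      using vw(3,4,6,7) by (auto simp: green[OF c(1) vw(1,1)] green[OF c(2) vw(2,2)] green[OF c(1) vw(5,1)] green[OF c(2) vw(5,2)])
    then have "is_separated (sep_space (BC a v) (BC b w))" by (intro is_separatedI)
    moreover have "S = tauop (bc_dom (sep_space (BC a v) (BC b w)))"
      by (rule restriction_from_Domain[OF assms]) (use vw(8) dom[OF vw(1,2)] in \<open>auto simp: bc_dom_def\<close>)
    ultimately show "\<exists>L. is_separated L \<and> S = tauop (bc_dom L)" by blast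
  }
  {
    assume "\<exists>L. is_separated L \<and> S = tauop (bc_dom L)"
    then obtain x y where xy: "bform x x = 0" "x \<noteq> 0" "bform y y = 0" "y \<noteq> 0" and S: "S = tauop (bc_dom (sep_space x y))"
      by (auto simp: is_separated_def)
    obtain v where v: "v \<in> dmax" "BC a v = x" by (rule BC_surj)
    obtain w where w: "w \<in> dmax" "BC b w = y" by (rule BC_surj)
    obtain x' y' where xy': "bform x' x \<noteq> 0" "bform y' y \<noteq> 0" using bform_nondegenerate xy by blast
    obtain h where h: "h \<in> dmax" "BC a h = x'" "BC b h = y'" by (rule BC_surj)
    show "separated_bc a b p q r s S"
      unfolding separated_bc_def
    proof (rule bexI[OF _ v(1)], rule bexI[OF _ w(1)], intro conjI)
      show "wend a v (cnj \<circ> v) = 0" "wend b w (cnj \<circ> w) = 0"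
        using xy by (simp_all add: green[OF c(1) v(1) v(1)] green[OF c(2) w(1) w(1)] v w)
      show "\<exists>h\<in>dmax. wend a h (cnj \<circ> v) \<noteq> 0 \<and> wend b h (cnj \<circ> w) \<noteq> 0"
        using h xy' by (intro bexI[of _ h]) (simp_all add: green[OF c(1) h(1) v(1)] green[OF c(2) h(1) w(1)] v w)
      show "Domain S = cl ` {g \<in> dmax. wend a g (cnj \<circ> v) = 0 \<and> wend b g (cnj \<circ> w) = 0}"
        unfolding dom[OF v(1) w(1)] v(2) w(2) S by (rule Domain_bc)
    qed
  }
qed

lemma tauop_inj: "tauop (bc_dom L) = tauop (bc_dom L') \<Longrightarrow> L = L'"
  by (rule bc_dom_inj) (metis Domain_bc)

lemma is_separated_lagrangian: "is_separated L \<Longrightarrow> bform_perp L = L"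
  by (auto simp: is_separated_def sep_space_lagrangian)

lemma sa_separated_iff: "sa_separated a b p q r s S \<longleftrightarrow> (\<exists>L. is_separated L \<and> S = tauop (bc_dom L))"
  unfolding sa_separated_def
  using separated_bc_iff self_adjoint_bc[OF is_separated_lagrangian]
  by (metis self_adjoint_restriction_def)

text \<open>\<open>L\<close> is determined by the operator, by \<open>tauop_inj\<close>, so negating
  \<open>separated_bc\<close> amounts to negating \<open>is_separated\<close> for this one
  \<open>L\<close>.\<close>

lemma sa_coupled_iff:
  "sa_coupled a b p q r s S \<longleftrightarrow> (\<exists>L. bform_perp L = L \<and> \<not> is_separated L \<and> S = tauop (bc_dom L))"
proof -
  have sub: "S \<subseteq> Tmax a b p q r s" if "self_adjoint_restriction a b p q r s S"
    using that by (simp add: self_adjoint_restriction_def)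
  show ?thesis
    unfolding sa_coupled_def
    using separated_bc_iff sub self_adjoint_restriction_iff[of S] tauop_inj by metis
qed

theorem separated_classification:
  "sa_separated a b p q r s S \<longleftrightarrow>
    (\<exists>\<phi>a\<in>{0..<pi}. \<exists>\<phi>b\<in>{0..<pi}.
       S = tauop {g \<in> dmax.
         BC1 a b p s w2 a g * of_real (cos \<phi>a) - BC2 a b p s w1 a g * of_real (sin \<phi>a) = 0 \<and>
         BC1 a b p s w2 b g * of_real (cos \<phi>b) - BC2 a b p s w1 b g * of_real (sin \<phi>b) = 0})"
proof -
  \<comment> \<open>With this real vector the form \<open>bform x (A \<phi>)\<close> is the boundary
    expression with cosine and sine.\<close>
  define A where "A \<phi> = (complex_of_real (sin \<phi>), complex_of_real (cos \<phi>))" for \<phi>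
  have A: "bform (A \<phi>) (A \<phi>) = 0" "A \<phi> \<noteq> 0" for \<phi>
  proof -
    show "bform (A \<phi>) (A \<phi>) = 0" by (simp add: A_def bform_def)
    have "sin \<phi> \<noteq> 0 \<or> cos \<phi> \<noteq> 0" using sin_zero_abs_cos_one by fastforce
    then show "A \<phi> \<noteq> 0" by (simp add: A_def zero_prod_def)
  qed
  have dom: "{g \<in> dmax.
         BC1 a b p s w2 a g * of_real (cos \<phi>a) - BC2 a b p s w1 a g * of_real (sin \<phi>a) = 0 \<and>
         BC1 a b p s w2 b g * of_real (cos \<phi>b) - BC2 a b p s w1 b g * of_real (sin \<phi>b) = 0} = bc_dom (sep_space (A \<phi>a) (A \<phi>b))" for \<phi>a \<phi>b
    by (simp add: bc_dom_def BB_def BC_def sep_space_def bform_def A_def)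
  have sep: "is_separated L \<longleftrightarrow> (\<exists>\<phi>a\<in>{0..<pi}. \<exists>\<phi>b\<in>{0..<pi}. L = sep_space (A \<phi>a) (A \<phi>b))" for L
  proof
    assume "is_separated L"
    then obtain v w where vw: "bform v v = 0" "v \<noteq> 0" "bform w w = 0" "w \<noteq> 0" "L = sep_space v w"
      by (auto simp: is_separated_def)
    have "\<exists>\<phi>\<in>{0..<pi}. \<forall>x. bform x v = 0 \<longleftrightarrow> bform x (A \<phi>) = 0" if "bform v v = 0" "v \<noteq> 0" for v
      unfolding A_def using bform_isotropic_angle[OF that] by metis
    then obtain \<phi>a \<phi>b where a: "\<phi>a \<in> {0..<pi}" "\<And>x. bform x v = 0 \<longleftrightarrow> bform x (A \<phi>a) = 0"
      and b: "\<phi>b \<in> {0..<pi}" "\<And>x. bform x w = 0 \<longleftrightarrow> bform x (A \<phi>b) = 0" using vw by meson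
    have "L = sep_space (A \<phi>a) (A \<phi>b)" unfolding vw(5) by (simp add: sep_space_def a(2) b(2))
    with a(1) b(1) show "\<exists>\<phi>a\<in>{0..<pi}. \<exists>\<phi>b\<in>{0..<pi}. L = sep_space (A \<phi>a) (A \<phi>b)" by blast
  qed (use is_separatedI[OF A A] in blast)
  show ?thesis unfolding sa_separated_iff dom sep by blast
qed

theorem coupled_classification:
  "sa_coupled a b p q r s S \<longleftrightarrow>
    (\<exists>\<phi>\<in>{0..<pi}. \<exists>R :: real^2^2. det R = 1 \<and>
       S = tauop {g \<in> dmax.
         (vector [BC1 a b p s w2 b g, BC2 a b p s w1 b g] :: complex^2) =
         exp (\<i> * of_real \<phi>) *s
           (map_matrix of_real R *v vector [BC1 a b p s w2 a g, BC2 a b p s w1 a g])})"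
proof -
  have dom: "{g \<in> dmax.
         (vector [BC1 a b p s w2 b g, BC2 a b p s w1 b g] :: complex^2) =
         exp (\<i> * of_real \<phi>) *s
           (map_matrix of_real R *v vector [BC1 a b p s w2 a g, BC2 a b p s w1 a g])} =
      bc_dom {(x, y). y = coupling \<phi> R x}" for \<phi> and R :: "real^2^2"
    by (auto simp: bc_dom_def BB_def BC_def coupling_def vec_eq_iff forall_2 matrix_vector_mult_def sum_2
        map_matrix_def)
  show ?thesis
    unfolding sa_coupled_iff dom
    using lagrangian_not_separated coupling_lagrangian coupling_not_separated by metis
qed

end

theorem theorem6p4:
  fixes a b :: ereal
    and p q r s :: "real \<Rightarrow> real"
    and w1 w2 :: "real \<Rightarrow> complex"
    and S :: "real L2_operator"
  assumes "a < b"
    and "p \<in> borel_measurable (lebesgue_on (einterval a b))"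
    and "q \<in> borel_measurable (lebesgue_on (einterval a b))"
    and "r \<in> borel_measurable (lebesgue_on (einterval a b))"
    and "s \<in> borel_measurable (lebesgue_on (einterval a b))"
    and "locally_integrable_on_ivl a b (\<lambda>x. 1 / p x)"
    and "locally_integrable_on_ivl a b q"
    and "locally_integrable_on_ivl a b r"
    and "locally_integrable_on_ivl a b s"
    and "AE x in lebesgue_on (einterval a b). r x > 0"
    and "AE x in lebesgue_on (einterval a b). p x \<noteq> 0"
    and "limit_circle_left a b p q r s"
    and "limit_circle_right a b p q r s"
    and "w1 \<in> dom_Tmax a b p q r s"
    and "w2 \<in> dom_Tmax a b p q r s"
    and "\<And>c. c \<in> {a, b} \<Longrightarrow> wronskian_end a b p s c w1 (cnj \<circ> w2) = 1"
    and "\<And>c. c \<in> {a, b} \<Longrightarrow> wronskian_end a b p s c w1 (cnj \<circ> w1) = 0"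
    and "\<And>c. c \<in> {a, b} \<Longrightarrow> wronskian_end a b p s c w2 (cnj \<circ> w2) = 0"
  shows "(sa_separated a b p q r s S \<longleftrightarrow>
           (\<exists>\<phi>a\<in>{0..<pi}. \<exists>\<phi>b\<in>{0..<pi}.
              S = tau_operator a b p q r s
                    {g \<in> dom_Tmax a b p q r s.
                       BC1 a b p s w2 a g * of_real (cos \<phi>a) - BC2 a b p s w1 a g * of_real (sin \<phi>a) = 0 \<and>
                       BC1 a b p s w2 b g * of_real (cos \<phi>b) - BC2 a b p s w1 b g * of_real (sin \<phi>b) = 0}))
       \<and> (sa_coupled a b p q r s S \<longleftrightarrow>
           (\<exists>\<phi>\<in>{0..<pi}. \<exists>R :: real^2^2. det R = 1 \<and>
              S = tau_operator a b p q r s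
                    {g \<in> dom_Tmax a b p q r s.
                       (vector [BC1 a b p s w2 b g, BC2 a b p s w1 b g] :: complex^2) =
                       exp (\<i> * of_real \<phi>) *s
                         (map_matrix of_real R *v vector [BC1 a b p s w2 a g, BC2 a b p s w1 a g])}))"
proof -
  interpret boundary_functionals a b p q r s w1 w2
    by unfold_locales (fact assms)+
  show ?thesis using separated_classification coupled_classification by (rule conjI)
qed

end
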